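(* Let $K$ be a perfect field (of prime characteristic $p$) and let $R$ be an $F$-finite $F$-pure $K$-algebra. Then for any $\mathfrak p\in\operatorname{Spec}(R)$, the ring $R_{\mathfrak p}$ is strongly $F$-regular if and only if there exists an integer $C>0$ such that $\mathfrak p^{\langle Cn\rangle_K}\subseteq\mathfrak p^{(n)}$ for all integers $n>0$.
   Context: $R$ is Noetherian of characteristic $p$. $F^e_*R$ denotes $R$ viewed as an $R$-module via the $e$-th iterate of Frobenius. $R$ is $F$-finite if $F^1_*R$ is a finitely generated $R$-module. An $F$-finite ring is $F$-pure if the natural map $R\to F^1_*R$ splits as a map of $R$-modules. A local $F$-finite ring $T$ is strongly $F$-regular if $T$ is a domain and for every nonzero $t\in T$ there is $e\in\mathbb N$ such that the $T$-linear map $T\to F^e_*T$ with $1\mapsto F^e_*t$ splits. $\mathfrak p^{(n)}=\mathfrak p^nR_{\mathfrak p}\cap R$ is the $n$-th symbolic power. Differential operators: $D^0_{R|K}=\operatorname{Hom}_R(R,R)$ and $D^n_{R|K}=\{\delta\in\operatorname{Hom}_K(R,R) : [\delta,r]\in D^{n-1}_{R|K}\ \forall r\in R\}$. Differential powers: $\mathfrak p^{\langle n\rangle_K}=\{f\in R : \delta(f)\in\mathfrak p \text{ for all }\delta\in D^{n-1}_{R|K}\}$. *)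

theory Defs
  imports
    "HOL-Computational_Algebra.Primes"
    "HOL-Algebra.Module"
    "HOL-Algebra.Ideal_Product"
    "HOL-Algebra.Ring_Divisibility"
begin

section \<open>Characteristic and perfect fields\<close>

definition has_char :: "('a, 'b) ring_scheme \<Rightarrow> nat \<Rightarrow> bool" where
  "has_char R n \<longleftrightarrow> (\<forall>k::nat. add_pow R k \<one>\<^bsub>R\<^esub> = \<zero>\<^bsub>R\<^esub> \<longleftrightarrow> n dvd k)"

text \<open>Perfect fields of prime characteristic \<open>p\<close>: the Frobenius is surjective.\<close>

definition perfect_field :: "('a, 'b) ring_scheme \<Rightarrow> nat \<Rightarrow> bool" where
  "perfect_field K p \<longleftrightarrow>
     field K \<and> Factorial_Ring.prime p \<and> has_char K p \<and>
     (\<forall>a\<in>carrier K. \<exists>b\<in>carrier K. b [^]\<^bsub>K\<^esub> p = a)"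


section \<open>Linear maps, split maps, finite generation\<close>

text \<open>As for \<^const>\<open>ring_hom\<close>, only the values on the carrier matter: linear maps are not required
  to be extensional.\<close>

definition linear_maps ::
    "('r, 'm) ring_scheme \<Rightarrow> ('r, 'a, 'n) module_scheme \<Rightarrow> ('r, 'b, 'o) module_scheme \<Rightarrow> ('a \<Rightarrow> 'b) set"
  where
  "linear_maps R M N =
     {f \<in> carrier M \<rightarrow> carrier N.
        (\<forall>x\<in>carrier M. \<forall>y\<in>carrier M. f (x \<oplus>\<^bsub>M\<^esub> y) = f x \<oplus>\<^bsub>N\<^esub> f y) \<and>
        (\<forall>r\<in>carrier R. \<forall>x\<in>carrier M. f (r \<odot>\<^bsub>M\<^esub> x) = r \<odot>\<^bsub>N\<^esub> f x)}"

definition splits ::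
    "('r, 'm) ring_scheme \<Rightarrow> ('r, 'a, 'n) module_scheme \<Rightarrow> ('r, 'b, 'o) module_scheme \<Rightarrow> ('a \<Rightarrow> 'b) \<Rightarrow> bool"
  where
  "splits R M N f \<longleftrightarrow>
     f \<in> linear_maps R M N \<and> (\<exists>g\<in>linear_maps R N M. \<forall>x\<in>carrier M. g (f x) = x)"

definition finitely_generated ::
    "('r, 'm) ring_scheme \<Rightarrow> ('r, 'a, 'n) module_scheme \<Rightarrow> bool" where
  "finitely_generated R M \<longleftrightarrow>
     (\<exists>A. finite A \<and> A \<subseteq> carrier M \<and>
        (\<forall>x\<in>carrier M. \<exists>c\<in>A \<rightarrow> carrier R. x = (\<Oplus>\<^bsub>M\<^esub>a\<in>A. c a \<odot>\<^bsub>M\<^esub> a)))"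

definition self_module :: "('a, 'b) ring_scheme \<Rightarrow> ('a, 'a) module" where
  "self_module R =
     \<lparr>carrier = carrier R, monoid.mult = monoid.mult R, monoid.one = \<one>\<^bsub>R\<^esub>,
      ring.zero = \<zero>\<^bsub>R\<^esub>, ring.add = ring.add R,
      smult = monoid.mult R\<rparr>"


section \<open>Frobenius\<close>

text \<open>\<open>frob R p e\<close> is the \<open>R\<close>-module \<open>F\<^sup>e\<^sub>*R\<close>: the additive group of \<open>R\<close> with
  \<open>r \<odot> F\<^sup>e\<^sub>*x = F\<^sup>e\<^sub>*(r\<^bsup>p^e\<^esup> x)\<close>. Elements \<open>F\<^sup>e\<^sub>*x\<close> are represented by \<open>x\<close> itself.\<close>

definition frob :: "('a, 'b) ring_scheme \<Rightarrow> nat \<Rightarrow> nat \<Rightarrow> ('a, 'a) module" where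
  "frob R p e =
     \<lparr>carrier = carrier R, monoid.mult = monoid.mult R, monoid.one = \<one>\<^bsub>R\<^esub>,
      ring.zero = \<zero>\<^bsub>R\<^esub>, ring.add = ring.add R,
      smult = (\<lambda>r x. r [^]\<^bsub>R\<^esub> (p ^ e) \<otimes>\<^bsub>R\<^esub> x)\<rparr>"

definition F_finite :: "('a, 'b) ring_scheme \<Rightarrow> nat \<Rightarrow> bool" where
  "F_finite R p \<longleftrightarrow> finitely_generated R (frob R p 1)"

definition F_pure :: "('a, 'b) ring_scheme \<Rightarrow> nat \<Rightarrow> bool" where
  "F_pure R p \<longleftrightarrow> splits R (self_module R) (frob R p 1) (\<lambda>r. r [^]\<^bsub>R\<^esub> p)"

definition local_ring :: "('a, 'b) ring_scheme \<Rightarrow> bool" where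
  "local_ring R \<longleftrightarrow> cring R \<and> (\<exists>!M. maximalideal M R)"

text \<open>\<open>F_finite\<close> and \<open>F_pure\<close> are meant for rings of prime characteristic \<open>p\<close>, where
  \<open>frob R p e\<close> is a module; \<open>F_pure\<close> is meant for \<open>F\<close>-finite rings. Strong \<open>F\<close>-regularity is
  a notion for local \<open>F\<close>-finite rings; these two conditions are part of the definition below.
  The \<open>T\<close>-linear map \<open>T \<rightarrow> F\<^sup>e\<^sub>*T\<close> with \<open>1 \<mapsto> F\<^sup>e\<^sub>*t\<close> is \<open>r \<mapsto> r \<odot> F\<^sup>e\<^sub>*t\<close>.\<close>

definition strongly_F_regular :: "('a, 'b) ring_scheme \<Rightarrow> nat \<Rightarrow> bool" where
  "strongly_F_regular T p \<longleftrightarrow>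
     local_ring T \<and> F_finite T p \<and> domain T \<and>
     (\<forall>t\<in>carrier T - {\<zero>\<^bsub>T\<^esub>}. \<exists>e::nat.
        splits T (self_module T) (frob T p e) (\<lambda>r. r \<odot>\<^bsub>frob T p e\<^esub> t))"


section \<open>Localization at a prime and symbolic powers\<close>

text \<open>The elements of \<open>R\<^sub>P\<close> are the classes of pairs \<open>(a, s)\<close>, read as \<open>a/s\<close>.\<close>

definition frac_rel ::
    "('a, 'b) ring_scheme \<Rightarrow> 'a set \<Rightarrow> (('a \<times> 'a) \<times> ('a \<times> 'a)) set" where
  "frac_rel R P =
     {((a, s), (b, t)) | a s b t.
        a \<in> carrier R \<and> b \<in> carrier R \<and> s \<in> carrier R - P \<and> t \<in> carrier R - P \<and>
        (\<exists>u\<in>carrier R - P. u \<otimes>\<^bsub>R\<^esub> (a \<otimes>\<^bsub>R\<^esub> t) = u \<otimes>\<^bsub>R\<^esub> (b \<otimes>\<^bsub>R\<^esub> s))}"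

definition fraction :: "('a, 'b) ring_scheme \<Rightarrow> 'a set \<Rightarrow> 'a \<Rightarrow> 'a \<Rightarrow> ('a \<times> 'a) set" where
  "fraction R P a s = frac_rel R P `` {(a, s)}"

definition localization :: "('a, 'b) ring_scheme \<Rightarrow> 'a set \<Rightarrow> ('a \<times> 'a) set ring" where
  "localization R P =
     \<lparr>carrier = (carrier R \<times> (carrier R - P)) // frac_rel R P,
      monoid.mult = (\<lambda>U V. \<Union>(a, s)\<in>U. \<Union>(b, t)\<in>V. fraction R P (a \<otimes>\<^bsub>R\<^esub> b) (s \<otimes>\<^bsub>R\<^esub> t)),
      monoid.one = fraction R P \<one>\<^bsub>R\<^esub> \<one>\<^bsub>R\<^esub>,
      ring.zero = fraction R P \<zero>\<^bsub>R\<^esub> \<one>\<^bsub>R\<^esub>,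
      ring.add = (\<lambda>U V. \<Union>(a, s)\<in>U. \<Union>(b, t)\<in>V.
               fraction R P (a \<otimes>\<^bsub>R\<^esub> t \<oplus>\<^bsub>R\<^esub> b \<otimes>\<^bsub>R\<^esub> s) (s \<otimes>\<^bsub>R\<^esub> t))\<rparr>"

text \<open>The operations are well defined on classes, and \<open>R\<^sub>P\<close> is a commutative ring.\<close>

context primeideal begin

lemma one_notin: "\<one> \<notin> I" using I_notcarr one_imp_carrier by blast
lemma compl_mult: "s \<in> carrier R - I \<Longrightarrow> t \<in> carrier R - I \<Longrightarrow> s \<otimes> t \<in> carrier R - I"
  using I_prime by auto

lemma equiv_frac: "equiv (carrier R \<times> (carrier R - I)) (frac_rel R I)"
proof (rule equivI)
  show "frac_rel R I \<subseteq> (carrier R \<times> (carrier R - I)) \<times> (carrier R \<times> (carrier R - I))"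
    unfolding frac_rel_def by auto
  show "refl_on (carrier R \<times> (carrier R - I)) (frac_rel R I)"
    unfolding frac_rel_def refl_on_def using one_notin by auto
  show "sym (frac_rel R I)" unfolding frac_rel_def sym_def by (auto, metis DiffI)
  show "trans (frac_rel R I)"
  proof (rule transI, clarify)
    fix a s b t c r
    assume "((a,s),(b,t)) \<in> frac_rel R I" "((b,t),(c,r)) \<in> frac_rel R I"
    then obtain u v where c: "a \<in> carrier R" "b \<in> carrier R" "c \<in> carrier R"
      "s \<in> carrier R - I" "t \<in> carrier R - I" "r \<in> carrier R - I" 
      "u \<in> carrier R - I" "v \<in> carrier R - I"
      and e: "u \<otimes> (a \<otimes> t) = u \<otimes> (b \<otimes> s)" "v \<otimes> (b \<otimes> r) = v \<otimes> (c \<otimes> t)"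
      unfolding frac_rel_def by blast
    have c': "s \<in> carrier R" "t \<in> carrier R" "r \<in> carrier R" "u \<in> carrier R" "v \<in> carrier R" using c by auto
    have "(u \<otimes> v \<otimes> t) \<otimes> (a \<otimes> r) = v \<otimes> r \<otimes> (u \<otimes> (a \<otimes> t))" using c c' by (simp_all add: l_distr r_distr m_ac a_ac)
    also have "\<dots> = v \<otimes> r \<otimes> (u \<otimes> (b \<otimes> s))" using e by simp
    also have "\<dots> = u \<otimes> s \<otimes> (v \<otimes> (b \<otimes> r))" using c c' by (simp_all add: l_distr r_distr m_ac a_ac)
    also have "\<dots> = u \<otimes> s \<otimes> (v \<otimes> (c \<otimes> t))" using e by simp
    also have "\<dots> = (u \<otimes> v \<otimes> t) \<otimes> (c \<otimes> s)" using c c' by (simp_all add: l_distr r_distr m_ac a_ac)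
    finally show "((a,s),(c,r)) \<in> frac_rel R I"
      using c compl_mult[OF compl_mult[OF c(7) c(8)] c(5)] unfolding frac_rel_def mem_Collect_eq by blast
  qed
qed

lemma fraction_eq_iff:
  assumes "a \<in> carrier R" "b \<in> carrier R" "s \<in> carrier R - I" "t \<in> carrier R - I"
  shows "fraction R I a s = fraction R I b t \<longleftrightarrow> (\<exists>u\<in>carrier R - I. u \<otimes> (a \<otimes> t) = u \<otimes> (b \<otimes> s))"
  unfolding fraction_def using eq_equiv_class_iff[OF equiv_frac, of "(a,s)" "(b,t)"] assms
  by (auto simp: frac_rel_def)

lemma carrier_localization:
  "carrier (localization R I) = {fraction R I a s | a s. a \<in> carrier R \<and> s \<in> carrier R - I}"
  unfolding localization_def quotient_def fraction_def by auto

lemma fraction_closed [simp, intro]: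
  "a \<in> carrier R \<Longrightarrow> s \<in> carrier R - I \<Longrightarrow> fraction R I a s \<in> carrier (localization R I)"
  unfolding carrier_localization by blast

lemma mult_fraction:
  assumes "a \<in> carrier R" "b \<in> carrier R" "s \<in> carrier R - I" "t \<in> carrier R - I"
  shows "fraction R I a s \<otimes>\<^bsub>localization R I\<^esub> fraction R I b t = fraction R I (a \<otimes> b) (s \<otimes> t)"
proof -
  have "(\<lambda>(a,s) (b,t). fraction R I (a \<otimes> b) (s \<otimes> t)) respects2 frac_rel R I"
  proof (rule congruent2I'[of "frac_rel R I"], clarify)
    fix a1 s1 a2 s2 b1 t1 b2 t2
    assume "((a1,s1),(a2,s2)) \<in> frac_rel R I" "((b1,t1),(b2,t2)) \<in> frac_rel R I"
    then obtain u v where c: "a1 \<in> carrier R" "a2 \<in> carrier R" "b1 \<in> carrier R" "b2 \<in> carrier R"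
      "s1 \<in> carrier R - I" "s2 \<in> carrier R - I" "t1 \<in> carrier R - I" "t2 \<in> carrier R - I"
      "u \<in> carrier R - I" "v \<in> carrier R - I"
      and e: "u \<otimes> (a1 \<otimes> s2) = u \<otimes> (a2 \<otimes> s1)" "v \<otimes> (b1 \<otimes> t2) = v \<otimes> (b2 \<otimes> t1)"
      unfolding frac_rel_def by blast
    have c': "s1 \<in> carrier R" "s2 \<in> carrier R" "t1 \<in> carrier R" "t2 \<in> carrier R" "u \<in> carrier R" "v \<in> carrier R" using c by auto
    have "(u \<otimes> v) \<otimes> (a1 \<otimes> b1 \<otimes> (s2 \<otimes> t2)) = (u \<otimes> (a1 \<otimes> s2)) \<otimes> (v \<otimes> (b1 \<otimes> t2))" using c c' by (simp_all add: l_distr r_distr m_ac a_ac)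
    also have "\<dots> = (u \<otimes> (a2 \<otimes> s1)) \<otimes> (v \<otimes> (b2 \<otimes> t1))" using e by simp
    also have "\<dots> = (u \<otimes> v) \<otimes> (a2 \<otimes> b2 \<otimes> (s1 \<otimes> t1))" using c c' by (simp_all add: l_distr r_distr m_ac a_ac)
    finally show "fraction R I (a1 \<otimes> b1) (s1 \<otimes> t1) = fraction R I (a2 \<otimes> b2) (s2 \<otimes> t2)"
      using fraction_eq_iff[of "a1 \<otimes> b1" "a2 \<otimes> b2" "s1 \<otimes> t1" "s2 \<otimes> t2"] c compl_mult by blast
  qed
  from UN_equiv_class2[OF equiv_frac equiv_frac this, of "(a,s)" "(b,t)"] assms
  show ?thesis unfolding localization_def by (simp add: fraction_def split_def)
qed

lemma add_fraction:
  assumes "a \<in> carrier R" "b \<in> carrier R" "s \<in> carrier R - I" "t \<in> carrier R - I"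
  shows "fraction R I a s \<oplus>\<^bsub>localization R I\<^esub> fraction R I b t = fraction R I (a \<otimes> t \<oplus> b \<otimes> s) (s \<otimes> t)"
proof -
  have "(\<lambda>(a,s) (b,t). fraction R I (a \<otimes> t \<oplus> b \<otimes> s) (s \<otimes> t)) respects2 frac_rel R I"
  proof (rule congruent2I'[of "frac_rel R I"], clarify)
    fix a1 s1 a2 s2 b1 t1 b2 t2
    assume "((a1,s1),(a2,s2)) \<in> frac_rel R I" "((b1,t1),(b2,t2)) \<in> frac_rel R I"
    then obtain u v where c: "a1 \<in> carrier R" "a2 \<in> carrier R" "b1 \<in> carrier R" "b2 \<in> carrier R"
      "s1 \<in> carrier R - I" "s2 \<in> carrier R - I" "t1 \<in> carrier R - I" "t2 \<in> carrier R - I"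
      "u \<in> carrier R - I" "v \<in> carrier R - I"
      and e: "u \<otimes> (a1 \<otimes> s2) = u \<otimes> (a2 \<otimes> s1)" "v \<otimes> (b1 \<otimes> t2) = v \<otimes> (b2 \<otimes> t1)"
      unfolding frac_rel_def by blast
    have c': "s1 \<in> carrier R" "s2 \<in> carrier R" "t1 \<in> carrier R" "t2 \<in> carrier R" "u \<in> carrier R" "v \<in> carrier R" using c by auto
    have "(u \<otimes> v) \<otimes> ((a1 \<otimes> t1 \<oplus> b1 \<otimes> s1) \<otimes> (s2 \<otimes> t2)) 
      = (u \<otimes> (a1 \<otimes> s2)) \<otimes> (v \<otimes> t1 \<otimes> t2) \<oplus> (v \<otimes> (b1 \<otimes> t2)) \<otimes> (u \<otimes> s1 \<otimes> s2)" using c c' by (simp_all add: l_distr r_distr m_ac a_ac)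
    also have "\<dots> = (u \<otimes> (a2 \<otimes> s1)) \<otimes> (v \<otimes> t1 \<otimes> t2) \<oplus> (v \<otimes> (b2 \<otimes> t1)) \<otimes> (u \<otimes> s1 \<otimes> s2)" using e by simp
    also have "\<dots> = (u \<otimes> v) \<otimes> ((a2 \<otimes> t2 \<oplus> b2 \<otimes> s2) \<otimes> (s1 \<otimes> t1))" using c c' by (simp_all add: l_distr r_distr m_ac a_ac)
    finally show "fraction R I (a1 \<otimes> t1 \<oplus> b1 \<otimes> s1) (s1 \<otimes> t1) = fraction R I (a2 \<otimes> t2 \<oplus> b2 \<otimes> s2) (s2 \<otimes> t2)"
      using fraction_eq_iff[of "a1 \<otimes> t1 \<oplus> b1 \<otimes> s1" "a2 \<otimes> t2 \<oplus> b2 \<otimes> s2" "s1 \<otimes> t1" "s2 \<otimes> t2"] c c' compl_mult by blast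
  qed
  from UN_equiv_class2[OF equiv_frac equiv_frac this, of "(a,s)" "(b,t)"] assms
  show ?thesis unfolding localization_def by (simp add: fraction_def split_def)
qed

lemma fraction_eqI:
  assumes "a \<in> carrier R" "b \<in> carrier R" "s \<in> carrier R - I" "t \<in> carrier R - I" "a \<otimes> t = b \<otimes> s"
  shows "fraction R I a s = fraction R I b t"
  using fraction_eq_iff[OF assms(1-4)] assms(5) one_notin by auto

lemma one_loc: "\<one>\<^bsub>localization R I\<^esub> = fraction R I \<one> \<one>"
  and zero_loc: "\<zero>\<^bsub>localization R I\<^esub> = fraction R I \<zero> \<one>"
  by (simp_all add: localization_def)

lemma cring_localization: "cring (localization R I)"
proof -
  have one: "\<one> \<in> carrier R - I" using one_notin by auto
  let ?L = "localization R I"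
  have cases: "\<exists>a s. x = fraction R I a s \<and> a \<in> carrier R \<and> s \<in> carrier R \<and> s \<in> carrier R - I" if "x \<in> carrier ?L" for x
    using that unfolding carrier_localization by auto
  note S = compl_mult mult_fraction add_fraction one_loc zero_loc
  show ?thesis
  proof (rule cringI)
    show "abelian_group ?L"
    proof (rule abelian_groupI)
      fix x y assume "x \<in> carrier ?L" "y \<in> carrier ?L"
      then show "x \<oplus>\<^bsub>?L\<^esub> y \<in> carrier ?L"
        using cases S by (metis fraction_closed m_closed a_closed)
    next
      show "\<zero>\<^bsub>?L\<^esub> \<in> carrier ?L" using one by (simp add: S)
    next
      fix x y z assume "x \<in> carrier ?L" "y \<in> carrier ?L" "z \<in> carrier ?L"
      then obtain a s b t c r where x: "x = fraction R I a s" "a \<in> carrier R" "s \<in> carrier R" "s \<in> carrier R - I"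
       and y: "y = fraction R I b t" "b \<in> carrier R" "t \<in> carrier R" "t \<in> carrier R - I"
       and z: "z = fraction R I c r" "c \<in> carrier R" "r \<in> carrier R" "r \<in> carrier R - I" using cases by meson
      have "x \<oplus>\<^bsub>?L\<^esub> y \<oplus>\<^bsub>?L\<^esub> z = fraction R I ((a \<otimes> t \<oplus> b \<otimes> s) \<otimes> r \<oplus> c \<otimes> (s \<otimes> t)) (s \<otimes> t \<otimes> r)"
        using x y z compl_mult by (simp add: add_fraction del: Diff_iff)
      moreover have "x \<oplus>\<^bsub>?L\<^esub> (y \<oplus>\<^bsub>?L\<^esub> z) = fraction R I (a \<otimes> (t \<otimes> r) \<oplus> (b \<otimes> r \<oplus> c \<otimes> t) \<otimes> s) (s \<otimes> (t \<otimes> r))"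
        using x y z compl_mult by (simp add: add_fraction del: Diff_iff)
      moreover have "(a \<otimes> t \<oplus> b \<otimes> s) \<otimes> r \<oplus> c \<otimes> (s \<otimes> t) = a \<otimes> (t \<otimes> r) \<oplus> (b \<otimes> r \<oplus> c \<otimes> t) \<otimes> s"
         "s \<otimes> t \<otimes> r = s \<otimes> (t \<otimes> r)"
        using x y z by (simp_all add: l_distr r_distr m_ac a_ac)
      ultimately show "x \<oplus>\<^bsub>?L\<^esub> y \<oplus>\<^bsub>?L\<^esub> z = x \<oplus>\<^bsub>?L\<^esub> (y \<oplus>\<^bsub>?L\<^esub> z)" by simp
    next
      fix x y assume "x \<in> carrier ?L" "y \<in> carrier ?L"
      then obtain a s b t where x: "x = fraction R I a s" "a \<in> carrier R" "s \<in> carrier R" "s \<in> carrier R - I"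
       and y: "y = fraction R I b t" "b \<in> carrier R" "t \<in> carrier R" "t \<in> carrier R - I" using cases by meson
      show "x \<oplus>\<^bsub>?L\<^esub> y = y \<oplus>\<^bsub>?L\<^esub> x"
        using x y by (simp add: add_fraction m_comm a_comm del: Diff_iff)
    next
      fix x assume "x \<in> carrier ?L"
      then obtain a s where x: "x = fraction R I a s" "a \<in> carrier R" "s \<in> carrier R" "s \<in> carrier R - I" using cases by meson
      show "\<zero>\<^bsub>?L\<^esub> \<oplus>\<^bsub>?L\<^esub> x = x" using x one by (simp add: add_fraction zero_loc del: Diff_iff)
      have "fraction R I (\<ominus> a) s \<oplus>\<^bsub>?L\<^esub> x = \<zero>\<^bsub>?L\<^esub>"
        using x one compl_mult[OF x(4) x(4)] fraction_eqI[of \<zero> \<zero> "s \<otimes> s" \<one>] by (simp add: add_fraction zero_loc l_minus l_neg del: Diff_iff)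
      then show "\<exists>y\<in>carrier ?L. y \<oplus>\<^bsub>?L\<^esub> x = \<zero>\<^bsub>?L\<^esub>" using x by (meson fraction_closed a_inv_closed)
    qed
    show "comm_monoid ?L"
    proof (rule comm_monoidI)
      fix x y assume "x \<in> carrier ?L" "y \<in> carrier ?L"
      then show "x \<otimes>\<^bsub>?L\<^esub> y \<in> carrier ?L"
        using cases S by (metis fraction_closed m_closed a_closed)
    next
      show "\<one>\<^bsub>?L\<^esub> \<in> carrier ?L" using one by (simp add: S)
    next
      fix x y z assume "x \<in> carrier ?L" "y \<in> carrier ?L" "z \<in> carrier ?L"
      then obtain a s b t c r where x: "x = fraction R I a s" "a \<in> carrier R" "s \<in> carrier R" "s \<in> carrier R - I"
       and y: "y = fraction R I b t" "b \<in> carrier R" "t \<in> carrier R" "t \<in> carrier R - I"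
       and z: "z = fraction R I c r" "c \<in> carrier R" "r \<in> carrier R" "r \<in> carrier R - I" using cases by meson
      show "x \<otimes>\<^bsub>?L\<^esub> y \<otimes>\<^bsub>?L\<^esub> z = x \<otimes>\<^bsub>?L\<^esub> (y \<otimes>\<^bsub>?L\<^esub> z)"
        using x y z compl_mult by (simp add: mult_fraction m_assoc del: Diff_iff)
    next
      fix x y assume "x \<in> carrier ?L" "y \<in> carrier ?L"
      then show "x \<otimes>\<^bsub>?L\<^esub> y = y \<otimes>\<^bsub>?L\<^esub> x"
        using cases mult_fraction m_comm by metis
    next
      fix x assume "x \<in> carrier ?L"
      then show "\<one>\<^bsub>?L\<^esub> \<otimes>\<^bsub>?L\<^esub> x = x" using cases mult_fraction one one_loc l_one one_closed by metis
    qed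
    fix x y z assume "x \<in> carrier ?L" "y \<in> carrier ?L" "z \<in> carrier ?L"
    then obtain a s b t c r where x: "x = fraction R I a s" "a \<in> carrier R" "s \<in> carrier R" "s \<in> carrier R - I"
       and y: "y = fraction R I b t" "b \<in> carrier R" "t \<in> carrier R" "t \<in> carrier R - I"
       and z: "z = fraction R I c r" "c \<in> carrier R" "r \<in> carrier R" "r \<in> carrier R - I" using cases by meson
    have "(x \<oplus>\<^bsub>?L\<^esub> y) \<otimes>\<^bsub>?L\<^esub> z = fraction R I ((a \<otimes> t \<oplus> b \<otimes> s) \<otimes> c) (s \<otimes> t \<otimes> r)"
      using x y z compl_mult by (simp add: add_fraction mult_fraction del: Diff_iff)
    also have "\<dots> = fraction R I (a \<otimes> c \<otimes> (t \<otimes> r) \<oplus> b \<otimes> c \<otimes> (s \<otimes> r)) (s \<otimes> r \<otimes> (t \<otimes> r))"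
    proof (rule fraction_eqI)
      show "(a \<otimes> t \<oplus> b \<otimes> s) \<otimes> c \<otimes> (s \<otimes> r \<otimes> (t \<otimes> r)) = (a \<otimes> c \<otimes> (t \<otimes> r) \<oplus> b \<otimes> c \<otimes> (s \<otimes> r)) \<otimes> (s \<otimes> t \<otimes> r)"
        using x y z by (simp_all add: l_distr r_distr m_ac a_ac)
    qed (use x y z compl_mult in \<open>simp_all del: Diff_iff\<close>)
    also have "\<dots> = x \<otimes>\<^bsub>?L\<^esub> z \<oplus>\<^bsub>?L\<^esub> y \<otimes>\<^bsub>?L\<^esub> z"
      using x y z compl_mult by (simp add: add_fraction mult_fraction del: Diff_iff)
    finally show "(x \<oplus>\<^bsub>?L\<^esub> y) \<otimes>\<^bsub>?L\<^esub> z = x \<otimes>\<^bsub>?L\<^esub> z \<oplus>\<^bsub>?L\<^esub> y \<otimes>\<^bsub>?L\<^esub> z" .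
  qed
qed
end

text \<open>\<open>P\<^sup>nR\<^sub>P \<inter> R\<close> is the preimage under \<open>R \<rightarrow> R\<^sub>P\<close> of the ideal generated by the image of \<open>P\<^sup>n\<close>;
  \<open>P\<^sup>n\<close> is the power in the monoid of ideals of \<open>R\<close>.\<close>

definition symbolic_power :: "('a, 'b) ring_scheme \<Rightarrow> 'a set \<Rightarrow> nat \<Rightarrow> 'a set" where
  "symbolic_power R P n =
     {f \<in> carrier R. fraction R P f \<one>\<^bsub>R\<^esub> \<in>
        Idl\<^bsub>localization R P\<^esub> ((\<lambda>x. fraction R P x \<one>\<^bsub>R\<^esub>) ` (P [^]\<^bsub>ideals_set R\<^esub> n))}"


section \<open>Differential operators and differential powers\<close>

definition commutator :: "('a, 'b) ring_scheme \<Rightarrow> ('a \<Rightarrow> 'a) \<Rightarrow> 'a \<Rightarrow> 'a \<Rightarrow> 'a" where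
  "commutator R \<delta> r = (\<lambda>x. \<delta> (r \<otimes>\<^bsub>R\<^esub> x) \<ominus>\<^bsub>R\<^esub> r \<otimes>\<^bsub>R\<^esub> \<delta> x)"

fun diff_ops ::
    "('k, 'c) ring_scheme \<Rightarrow> ('k, 'a, 'm) module_scheme \<Rightarrow> nat \<Rightarrow> ('a \<Rightarrow> 'a) set" where
  "diff_ops K R 0 = linear_maps R (self_module R) (self_module R)"
| "diff_ops K R (Suc n) =
     {\<delta> \<in> linear_maps K R R. \<forall>r\<in>carrier R. commutator R \<delta> r \<in> diff_ops K R n}"

text \<open>Only meant for \<open>n > 0\<close>; natural-number subtraction makes the value at \<open>0\<close> equal to that at
  \<open>1\<close>.\<close>

definition diff_power ::
    "('k, 'c) ring_scheme \<Rightarrow> ('k, 'a, 'm) module_scheme \<Rightarrow> 'a set \<Rightarrow> nat \<Rightarrow> 'a set" where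
  "diff_power K R P n = {f \<in> carrier R. \<forall>\<delta>\<in>diff_ops K R (n - 1). \<delta> f \<in> P}"

end

theory Submission
  imports Defs
begin

text \<open>
  Write \<open>T = R\<^sub>P\<close> with maximal ideal \<open>m\<close>, \<open>q = p\<^bsup>e\<^esup>\<close>, and let \<open>I\<^sub>e\<close> be the ideal of all \<open>f\<close> such that
  every \<open>T\<close>-linear map \<open>F\<^sup>e\<^sub>*T \<rightarrow> T\<close> sends \<open>F\<^sup>e\<^sub>*f\<close> into \<open>m\<close>. Over a perfect field, every differential operator is
  \<open>R\<^bsup>q\<^esup>\<close>-linear for some \<open>e\<close>, and all \<open>R\<^bsup>q\<^esup>\<close>-linear maps are differential operators of order at most a
  constant times \<open>q\<close>. Since \<open>R\<close> is \<open>F\<close>-pure, differential powers of \<open>P\<close> are therefore comparable with the \<open>I\<^sub>e\<close>.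

  If the differential powers are linearly bounded by symbolic powers, Krull's intersection theorem shows
  that every nonzero element of \<open>T\<close> escapes some \<open>I\<^sub>e\<close>, which is strong \<open>F\<close>-regularity.

  Conversely, let \<open>T\<close> be strongly \<open>F\<close>-regular. For a suitable \<open>c \<noteq> 0\<close> the module \<open>c F\<^sub>*T\<close> lies in a free submodule
  of \<open>F\<^sub>*T\<close>, so \<open>c\<^bsup>p\<^esup> I\<^bsub>e+1\<^esub>\<close> lies in the Frobenius power of \<open>I\<^sub>e\<close>. Multiplication by \<open>c\<^bsup>p\<^esup>\<close> changes \<open>m\<close>-adic orders by
  a bounded amount \<open>b\<close>, so \<open>I\<^sub>e \<subseteq> m\<^bsup>N\<^esup>\<close> implies \<open>I\<^bsub>e+1\<^esub> \<subseteq> m\<^bsup>pN-b\<^esup>\<close>. As soon as some \<open>I\<^sub>e\<close> lies in \<open>m\<^bsup>b+1\<^esup>\<close>, this gives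
  \<open>I\<^bsub>e+k\<^esub> \<subseteq> m\<^bsup>n\<^esup>\<close> for \<open>n = p\<^bsup>k\<^esup>\<close>, a linear comparison.
\<close>

section \<open>Rings of prime characteristic\<close>

text \<open>F-purity has two uses. A splitting of Frobenius on R turns an \<open>R^q\<close>-linear
  operator into a p^-e-linear map with the same value at a chosen element, so that escaping P is
  visible on maps F^e_*R -> R; extended to T, it makes the ideals \<open>I_e\<close> decrease.

  The hard point is the start of the recursion: strong F-regularity gives only that the
  \<open>I_e\<close> intersect in zero, while an inclusion of one \<open>I_e\<close> in m^(b+1) is
  needed. On a complete ring this would be Chevalley's theorem; here finiteness comes instead from
  leading exponents, which obey Dickson's lemma without any regularity of T.

  R may have zero divisors, so R -> T may have a kernel, and a map on T descends to R only after
  multiplication by some v outside P. This is harmless, because only membership in P is tested.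

  The constant C collects the number of generators of F_*R (an \<open>R^q\<close>-linear map has
  order at most that number times q-1), p^e with e the starting level, one factor p for rounding n
  up to a power of p, and a summand 1 for the index shift in differential powers.\<close>

lemma (in cring) cring_idealI:
  assumes "I \<subseteq> carrier R" "\<zero> \<in> I"
    and add: "\<And>a b. a \<in> I \<Longrightarrow> b \<in> I \<Longrightarrow> a \<oplus> b \<in> I"
    and mult: "\<And>r a. r \<in> carrier R \<Longrightarrow> a \<in> I \<Longrightarrow> r \<otimes> a \<in> I"
  shows "ideal I R"
proof (rule idealI[OF ring_axioms])
  show "subgroup I (add_monoid R)"
  proof (rule subgroup.intro)
    fix x assume x: "x \<in> I"
    then have "x \<in> carrier R" using assms(1) by blast
    then have "\<ominus> x = (\<ominus> \<one>) \<otimes> x" by (simp add: l_minus)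
    then have "\<ominus> x \<in> I" using mult x by simp
    then show "inv\<^bsub>add_monoid R\<^esub> x \<in> I" by (simp add: a_inv_def)
  qed (simp_all add: assms(1,2) add)
  show "\<And>a x. a \<in> I \<Longrightarrow> x \<in> carrier R \<Longrightarrow> x \<otimes> a \<in> I" by (rule mult)
  fix a x assume a: "a \<in> I" "x \<in> carrier R"
  then have "a \<otimes> x = x \<otimes> a" using assms(1) m_comm by blast
  then show "a \<otimes> x \<in> I" using mult a by simp
qed

lemma ideal_addD: "ideal I R \<Longrightarrow> a \<in> I \<Longrightarrow> b \<in> I \<Longrightarrow> a \<oplus>\<^bsub>R\<^esub> b \<in> I"
  by (rule additive_subgroup.a_closed[OF ideal.axioms(1)])

lemma ideal_zeroD: "ideal I R \<Longrightarrow> \<zero>\<^bsub>R\<^esub> \<in> I"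
  by (rule additive_subgroup.zero_closed[OF ideal.axioms(1)])

lemma ideal_subD: "ideal I R \<Longrightarrow> I \<subseteq> carrier R"
  by (rule additive_subgroup.a_subset[OF ideal.axioms(1)])

lemma ideal_negD: "ideal I R \<Longrightarrow> a \<in> I \<Longrightarrow> \<ominus>\<^bsub>R\<^esub> a \<in> I"
  by (rule additive_subgroup.a_inv_closed[OF ideal.axioms(1)]) (simp_all add: ring.is_abelian_group ideal.axioms(2))

lemma ideal_minusD: "ideal I R \<Longrightarrow> a \<in> I \<Longrightarrow> b \<in> I \<Longrightarrow> a \<ominus>\<^bsub>R\<^esub> b \<in> I"
  unfolding a_minus_def by (simp add: ideal_addD ideal_negD)

lemmas ideal_simps = ideal_addD ideal_zeroD ideal_negD ideal_minusD ideal.I_l_closed ideal.I_r_closed ideal.Icarr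

text \<open>Pascal's rule for two commuting additive operators. Using operators on an abelian group
  instead of ring elements lets one statement serve both multiplications on R and the commutator
  operator \<open>ad a\<close> on functions.\<close>

lemma (in abelian_group) binomial_funpow:
  fixes U V :: "'a \<Rightarrow> 'a"
  assumes U: "U \<in> carrier G \<rightarrow> carrier G" "\<And>x y. x \<in> carrier G \<Longrightarrow> y \<in> carrier G \<Longrightarrow> U (x \<oplus> y) = U x \<oplus> U y"
    and V: "V \<in> carrier G \<rightarrow> carrier G" "\<And>x y. x \<in> carrier G \<Longrightarrow> y \<in> carrier G \<Longrightarrow> V (x \<oplus> y) = V x \<oplus> V y"
    and comm: "\<And>x. x \<in> carrier G \<Longrightarrow> U (V x) = V (U x)"
    and W: "\<And>x. x \<in> carrier G \<Longrightarrow> W x = U x \<oplus> V x"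
    and x: "x \<in> carrier G"
  shows "(W ^^ n) x = (\<Oplus>k\<in>{..n}. add_pow G (n choose k) ((U ^^ k) ((V ^^ (n - k)) x)))"
proof -
  have Uc: "(U ^^ k) y \<in> carrier G" if "y \<in> carrier G" for k y
    using that U(1) by (induct k) auto
  have Vc: "(V ^^ k) y \<in> carrier G" if "y \<in> carrier G" for k y
    using that V(1) by (induct k) auto
  have add0: "F \<zero> = \<zero>" if "F \<in> carrier G \<rightarrow> carrier G"
    "\<And>x y. x \<in> carrier G \<Longrightarrow> y \<in> carrier G \<Longrightarrow> F (x \<oplus> y) = F x \<oplus> F y" for F :: "'a \<Rightarrow> 'a"
  proof -
    have "F \<zero> \<oplus> F \<zero> = F \<zero>" using that(2)[of \<zero> \<zero>] by simp
    then show ?thesis using that(1) by (metis Pi_mem add.l_cancel_one' zero_closed)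
  qed
  have addpow: "F (add_pow G (m::nat) y) = add_pow G m (F y)" if "F \<in> carrier G \<rightarrow> carrier G"
    "\<And>x y. x \<in> carrier G \<Longrightarrow> y \<in> carrier G \<Longrightarrow> F (x \<oplus> y) = F x \<oplus> F y" "y \<in> carrier G" for F :: "'a \<Rightarrow> 'a" and m y
    by (induct m) (use that add0[OF that(1,2)] in \<open>auto simp: add.nat_pow_Suc Pi_iff\<close>)
  have addsum: "F (\<Oplus>k\<in>{..m}. g k) = (\<Oplus>k\<in>{..m}. F (g k))" if "F \<in> carrier G \<rightarrow> carrier G"
    "\<And>x y. x \<in> carrier G \<Longrightarrow> y \<in> carrier G \<Longrightarrow> F (x \<oplus> y) = F x \<oplus> F y" "\<And>k. g k \<in> carrier G" for F :: "'a \<Rightarrow> 'a" and m :: nat and g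
    by (induct m) (use that in \<open>auto simp: finsum_Suc Pi_iff\<close>)
  have VU: "V ((U ^^ k) y) = (U ^^ k) (V y)" if "y \<in> carrier G" for k y
    by (induct k) (use that Uc V(1) in \<open>auto simp: Pi_iff comm[symmetric]\<close>)
  show ?thesis
  proof (induct n)
    case 0
    then show ?case using x by simp
  next
    case (Suc n)
    define t where "t = (\<lambda>k. (U ^^ k) ((V ^^ (Suc n - k)) x))"
    have tc: "t k \<in> carrier G" for k unfolding t_def using Uc Vc x by simp
    define g where "g = (\<lambda>k. add_pow G (n choose k) ((U ^^ k) ((V ^^ (n - k)) x)))"
    have gc: "\<And>k. g k \<in> carrier G" unfolding g_def using Uc Vc x by simp
    let ?S = "\<Oplus>k\<in>{..n}. g k"
    have "(W ^^ Suc n) x = W ?S" using Suc by (simp add: g_def)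
    also have "\<dots> = U ?S \<oplus> V ?S" by (rule W) (use gc in auto)
    also have "U ?S = (\<Oplus>k\<in>{..n}. U (g k))" by (rule addsum[OF U gc])
    also have "\<dots> = (\<Oplus>k\<in>{..n}. add_pow G (n choose k) (t (Suc k)))"
      by (rule finsum_cong') (use tc Uc Vc x U(1) addpow[OF U] in \<open>auto simp: g_def t_def Pi_iff\<close>)
    also have "V ?S = (\<Oplus>k\<in>{..n}. V (g k))" by (rule addsum[OF V gc])
    also have "\<dots> = (\<Oplus>k\<in>{..n}. add_pow G (n choose k) (t k))"
      by (rule finsum_cong') (use tc Uc Vc x V(1) addpow[OF V] VU in \<open>auto simp: g_def t_def Suc_diff_le Pi_iff\<close>)
    \<comment> \<open>The added term has coefficient zero; afterwards the k = 0 term is split off,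
      so that both sums run over \<open>t (Suc k)\<close>.\<close>
    also have "(\<Oplus>k\<in>{..n}. add_pow G (n choose k) (t k)) = (\<Oplus>k\<in>{..Suc n}. add_pow G (n choose k) (t k))"
      using tc by (simp add: finsum_Suc binomial_eq_0)
    also have "\<dots> = (\<Oplus>k\<in>{..n}. add_pow G (n choose Suc k) (t (Suc k))) \<oplus> t 0"
      using tc by (subst finsum_Suc2) auto
    also have "(\<Oplus>k\<in>{..n}. add_pow G (n choose k) (t (Suc k))) \<oplus> ((\<Oplus>k\<in>{..n}. add_pow G (n choose Suc k) (t (Suc k))) \<oplus> t 0)
       = ((\<Oplus>k\<in>{..n}. add_pow G (n choose k) (t (Suc k))) \<oplus> (\<Oplus>k\<in>{..n}. add_pow G (n choose Suc k) (t (Suc k)))) \<oplus> t 0"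
      using tc by (simp add: a_assoc)
    also have "(\<Oplus>k\<in>{..n}. add_pow G (n choose k) (t (Suc k))) \<oplus> (\<Oplus>k\<in>{..n}. add_pow G (n choose Suc k) (t (Suc k)))
       = (\<Oplus>k\<in>{..n}. add_pow G (Suc n choose Suc k) (t (Suc k)))"
      using tc by (subst finsum_addf[symmetric]) (auto simp: add.nat_pow_mult)
    also have "(\<Oplus>k\<in>{..n}. add_pow G (Suc n choose Suc k) (t (Suc k))) \<oplus> t 0 = (\<Oplus>k\<in>{..Suc n}. add_pow G (Suc n choose k) (t k))"
      using tc by (subst finsum_Suc2) auto
    finally show ?case unfolding t_def .
  qed
qed

text \<open>The freshman's dream: p divides the inner binomial coefficients and annihilates the
  group, so only k = 0 and k = p survive.\<close>

lemma (in abelian_group) prime_funpow_add: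
  fixes U V :: "'a \<Rightarrow> 'a" and p :: nat
  assumes U: "U \<in> carrier G \<rightarrow> carrier G" "\<And>x y. x \<in> carrier G \<Longrightarrow> y \<in> carrier G \<Longrightarrow> U (x \<oplus> y) = U x \<oplus> U y"
    and V: "V \<in> carrier G \<rightarrow> carrier G" "\<And>x y. x \<in> carrier G \<Longrightarrow> y \<in> carrier G \<Longrightarrow> V (x \<oplus> y) = V x \<oplus> V y"
    and comm: "\<And>x. x \<in> carrier G \<Longrightarrow> U (V x) = V (U x)"
    and W: "\<And>x. x \<in> carrier G \<Longrightarrow> W x = U x \<oplus> V x"
    and x: "x \<in> carrier G"
    and p: "Factorial_Ring.prime p" and tors: "\<And>y. y \<in> carrier G \<Longrightarrow> add_pow G p y = \<zero>"
  shows "(W ^^ p) x = (U ^^ p) x \<oplus> (V ^^ p) x"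
proof -
  have Uc: "(U ^^ k) y \<in> carrier G" if "y \<in> carrier G" for k y
    using that U(1) by (induct k) auto
  have Vc: "(V ^^ k) y \<in> carrier G" if "y \<in> carrier G" for k y
    using that V(1) by (induct k) auto
  define t where "t = (\<lambda>k. (U ^^ k) ((V ^^ (p - k)) x))"
  have tc: "t k \<in> carrier G" for k unfolding t_def using Uc Vc x by simp
  have p0: "p > 0" using p by (simp add: prime_gt_0_nat)
  have z: "add_pow G (p choose k) (t k) = \<zero>" if "0 < k" "k < p" for k
  proof -
    have "p dvd (p choose k)" by (rule dvd_choose_prime) (use that p in auto)
    then obtain m where "p choose k = p * m" by auto
    then have "add_pow G (p choose k) (t k) = add_pow G p (add_pow G m (t k))"
      using tc by (simp add: add.nat_pow_pow mult.commute)
    then show ?thesis using tors tc by simp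
  qed
  have "(W ^^ p) x = (\<Oplus>k\<in>{..p}. add_pow G (p choose k) (t k))"
    unfolding t_def by (rule binomial_funpow[OF U V comm W x])
  also have "\<dots> = (\<Oplus>k\<in>{0,p}. add_pow G (p choose k) (t k))"
    by (rule add.finprod_mono_neutral_cong_right) (use tc z in \<open>auto simp: Pi_iff\<close>)
  also have "\<dots> = t 0 \<oplus> t p" using p0 tc by (simp add: finsum_insert)
  also have "\<dots> = (U ^^ p) x \<oplus> (V ^^ p) x" using tc a_comm by (simp add: t_def Uc Vc x)
  finally show ?thesis .
qed

section \<open>Frobenius and p^-e-linear maps\<close>

locale char_p_cring = cring R for R (structure) +
  fixes p :: nat
  assumes prime: "Factorial_Ring.prime p" and p_one: "add_pow R p \<one> = \<zero>"
begin

lemma p_gt_0 [simp]: "p > 0" and p_ge_2: "p \<ge> 2" and q_gt_0 [simp]: "p ^ e > 0"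
  using prime prime_gt_0_nat prime_ge_2_nat by auto

lemma p_torsion: "y \<in> carrier R \<Longrightarrow> add_pow R p y = \<zero>"
  using add_pow_ldistr[of \<one> y p] p_one by simp

lemma funpow_mult: "a \<in> carrier R \<Longrightarrow> x \<in> carrier R \<Longrightarrow> (((\<otimes>) a) ^^ n) x = a [^] n \<otimes> x"
  by (induct n) (auto simp: m_ac)

lemma frobenius_add1:
  assumes "x \<in> carrier R" "y \<in> carrier R"
  shows "(x \<oplus> y) [^] p = x [^] p \<oplus> y [^] p"
proof -
  have "(((\<otimes>) (x \<oplus> y)) ^^ p) \<one> = (((\<otimes>) x) ^^ p) \<one> \<oplus> (((\<otimes>) y) ^^ p) \<one>"
    by (rule prime_funpow_add) (use assms prime p_torsion in \<open>auto simp: m_ac r_distr l_distr\<close>)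
  then show ?thesis using assms by (simp add: funpow_mult)
qed

lemma frobenius_add:
  assumes "x \<in> carrier R" "y \<in> carrier R"
  shows "(x \<oplus> y) [^] (p ^ e) = x [^] (p ^ e) \<oplus> y [^] (p ^ e)"
proof (induct e)
  case 0 then show ?case using assms by simp
next
  case (Suc e)
  have "(x \<oplus> y) [^] (p ^ Suc e) = ((x \<oplus> y) [^] (p ^ e)) [^] p" using assms by (simp add: nat_pow_pow mult.commute)
  also have "\<dots> = x [^] (p ^ Suc e) \<oplus> y [^] (p ^ Suc e)" using assms Suc frobenius_add1 by (simp add: nat_pow_pow mult.commute)
  finally show ?case .
qed

text \<open>The p^-e-linear maps, that is \<open>Hom_R(F^e_*R, R)\<close> with \<open>F^e_*x\<close>
  written as \<open>x\<close>; see \<open>linear_maps_frob\<close>.\<close>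

definition cartier :: "nat \<Rightarrow> ('a \<Rightarrow> 'a) set" where
  "cartier e = {\<phi> \<in> carrier R \<rightarrow> carrier R.
     (\<forall>x\<in>carrier R. \<forall>y\<in>carrier R. \<phi> (x \<oplus> y) = \<phi> x \<oplus> \<phi> y) \<and>
     (\<forall>a\<in>carrier R. \<forall>x\<in>carrier R. \<phi> (a [^] (p ^ e) \<otimes> x) = a \<otimes> \<phi> x)}"

lemma linear_maps_frob: "linear_maps R (frob R p e) (self_module R) = cartier e"
  unfolding linear_maps_def cartier_def frob_def self_module_def by auto

lemma cartierD:
  assumes "\<phi> \<in> cartier e"
  shows "x \<in> carrier R \<Longrightarrow> \<phi> x \<in> carrier R"
    and "x \<in> carrier R \<Longrightarrow> y \<in> carrier R \<Longrightarrow> \<phi> (x \<oplus> y) = \<phi> x \<oplus> \<phi> y"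
    and "a \<in> carrier R \<Longrightarrow> x \<in> carrier R \<Longrightarrow> \<phi> (a [^] (p ^ e) \<otimes> x) = a \<otimes> \<phi> x"
  using assms unfolding cartier_def by auto

lemma cartierI:
  assumes "\<And>x. x \<in> carrier R \<Longrightarrow> \<phi> x \<in> carrier R"
    and "\<And>x y. x \<in> carrier R \<Longrightarrow> y \<in> carrier R \<Longrightarrow> \<phi> (x \<oplus> y) = \<phi> x \<oplus> \<phi> y"
    and "\<And>a x. a \<in> carrier R \<Longrightarrow> x \<in> carrier R \<Longrightarrow> \<phi> (a [^] (p ^ e) \<otimes> x) = a \<otimes> \<phi> x"
  shows "\<phi> \<in> cartier e"
  using assms unfolding cartier_def by auto

lemma cartier_comp:
  assumes "\<phi> \<in> cartier d" "\<psi> \<in> cartier e"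
  shows "(\<lambda>x. \<phi> (\<psi> x)) \<in> cartier (d + e)"
proof (rule cartierI)
  fix a x assume "a \<in> carrier R" "x \<in> carrier R"
  then show "\<phi> (\<psi> (a [^] (p ^ (d + e)) \<otimes> x)) = a \<otimes> \<phi> (\<psi> x)"
    using cartierD(3)[OF assms(2), of "a [^] (p ^ d)" x] cartierD(3)[OF assms(1), of a "\<psi> x"] cartierD(1)[OF assms(2)]
    by (simp add: nat_pow_pow power_add)
qed (use cartierD[OF assms(1)] cartierD[OF assms(2)] in auto)

lemma cartier_premult:
  assumes "\<phi> \<in> cartier e" "u \<in> carrier R"
  shows "(\<lambda>x. \<phi> (u \<otimes> x)) \<in> cartier e"
proof (rule cartierI)
  fix a x assume "a \<in> carrier R" "x \<in> carrier R"
  then show "\<phi> (u \<otimes> (a [^] (p ^ e) \<otimes> x)) = a \<otimes> \<phi> (u \<otimes> x)"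
    using cartierD(3)[OF assms(1), of a "u \<otimes> x"] assms(2) by (simp add: m_ac)
qed (use assms cartierD[OF assms(1)] in \<open>auto simp: r_distr\<close>)

lemma cartier_postmult:
  assumes "\<phi> \<in> cartier e" "u \<in> carrier R"
  shows "(\<lambda>x. u \<otimes> \<phi> x) \<in> cartier e"
  by (rule cartierI) (use assms cartierD[OF assms(1)] in \<open>auto simp: r_distr m_ac\<close>)

lemma cartier_iterate:
  assumes "\<sigma> \<in> cartier 1"
  shows "(\<sigma> ^^ e) \<in> cartier e"
proof (induct e)
  case 0
  show ?case by (rule cartierI) auto
next
  case (Suc e)
  show ?case using cartier_comp[OF assms Suc] by (simp add: comp_def)
qed

text \<open>This is the largest ideal that \<open>\<phi>\<close> maps into J; the preimage of J
  itself is stable only under p^e-th powers, hence the quantifier over a. It reduces inclusions for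
  \<open>\<phi>\<close> to ideal generators with arbitrary coefficients.\<close>

lemma cartier_ideal:
  assumes "\<phi> \<in> cartier e" "ideal J R"
  shows "ideal {x \<in> carrier R. \<forall>a\<in>carrier R. \<phi> (a \<otimes> x) \<in> J} R"
proof (rule cring_idealI)
  have "\<phi> \<zero> = \<zero>" using cartierD(3)[OF assms(1), of \<zero> \<zero>] cartierD(1)[OF assms(1)] by simp
  then show "\<zero> \<in> {x \<in> carrier R. \<forall>a\<in>carrier R. \<phi> (a \<otimes> x) \<in> J}"
    using assms(2) by (auto simp: ideal_simps)
next
  fix r a assume "r \<in> carrier R" "a \<in> {x \<in> carrier R. \<forall>a\<in>carrier R. \<phi> (a \<otimes> x) \<in> J}"
  then show "r \<otimes> a \<in> {x \<in> carrier R. \<forall>a\<in>carrier R. \<phi> (a \<otimes> x) \<in> J}"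
    by (auto simp: m_assoc[symmetric])
qed (use assms cartierD[OF assms(1)] in \<open>auto simp: ideal_simps r_distr\<close>)

end

section \<open>Monomials and leading exponents\<close>

lemma (in cring) genideal_insertE:
  assumes "m \<in> carrier R" "S \<subseteq> carrier R" "y \<in> Idl (insert m S)"
  obtains a s where "a \<in> carrier R" "s \<in> Idl S" "y = a \<otimes> m \<oplus> s"
proof -
  have S: "ideal (Idl S) R" by (rule genideal_ideal[OF assms(2)])
  let ?J = "{a \<otimes> m \<oplus> s | a s. a \<in> carrier R \<and> s \<in> Idl S}"
  have "ideal ?J R"
  proof (rule cring_idealI)
    show "?J \<subseteq> carrier R" using assms(1) ideal_subD[OF S] by auto
    have "\<zero> = \<zero> \<otimes> m \<oplus> \<zero>" using assms(1) by simp
    then show "\<zero> \<in> ?J" using ideal_zeroD[OF S] by blast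
  next
    fix a b assume "a \<in> ?J" "b \<in> ?J"
    then obtain r s r' s' where *: "a = r \<otimes> m \<oplus> s" "b = r' \<otimes> m \<oplus> s'" "r \<in> carrier R" "r' \<in> carrier R" "s \<in> Idl S" "s' \<in> Idl S"
      by blast
    have c: "s \<in> carrier R" "s' \<in> carrier R" using * ideal_subD[OF S] by auto
    have "a \<oplus> b = (r \<oplus> r') \<otimes> m \<oplus> (s \<oplus> s')" using * c assms(1) by (simp add: l_distr a_ac)
    then show "a \<oplus> b \<in> ?J" using * ideal_addD[OF S] by blast
  next
    fix r a assume "r \<in> carrier R" "a \<in> ?J"
    then obtain r' s where *: "a = r' \<otimes> m \<oplus> s" "r' \<in> carrier R" "s \<in> Idl S" "r \<in> carrier R" by blast
    have c: "s \<in> carrier R" using * ideal_subD[OF S] by auto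
    have "r \<otimes> a = (r \<otimes> r') \<otimes> m \<oplus> r \<otimes> s" using * c assms(1) by (simp add: r_distr m_assoc)
    then show "r \<otimes> a \<in> ?J" using * ideal.I_l_closed[OF S] by blast
  qed
  moreover have "insert m S \<subseteq> ?J"
  proof
    fix z assume "z \<in> insert m S"
    then have "z = \<one> \<otimes> m \<oplus> \<zero> \<or> (z \<in> S \<and> z = \<zero> \<otimes> m \<oplus> z)" using assms by auto
    then show "z \<in> ?J" using ideal_zeroD[OF S] genideal_self[OF assms(2)] by blast
  qed
  ultimately have "Idl (insert m S) \<subseteq> ?J" by (rule genideal_minimal)
  then show thesis using that assms(3) by blast
qed

lemma (in cring) ideal_colon:
  assumes "ideal J R" "S \<subseteq> carrier R"
  shows "ideal {y \<in> carrier R. \<forall>s\<in>S. s \<otimes> y \<in> J} R"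
proof (rule cring_idealI)
  show "\<zero> \<in> {y \<in> carrier R. \<forall>s\<in>S. s \<otimes> y \<in> J}" using assms by (auto simp: ideal_zeroD)
next
  fix a b assume "a \<in> {y \<in> carrier R. \<forall>s\<in>S. s \<otimes> y \<in> J}" "b \<in> {y \<in> carrier R. \<forall>s\<in>S. s \<otimes> y \<in> J}"
  then show "a \<oplus> b \<in> {y \<in> carrier R. \<forall>s\<in>S. s \<otimes> y \<in> J}" using assms by (auto simp: r_distr ideal_addD)
next
  fix r a assume r: "r \<in> carrier R" and a: "a \<in> {y \<in> carrier R. \<forall>s\<in>S. s \<otimes> y \<in> J}"
  have "s \<otimes> (r \<otimes> a) \<in> J" if "s \<in> S" for s
  proof -
    have "s \<otimes> (r \<otimes> a) = r \<otimes> (s \<otimes> a)" using r a assms(2) that by (intro m_lcomm) auto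
    then show ?thesis using a r that ideal.I_l_closed[OF assms(1)] by auto
  qed
  then show "r \<otimes> a \<in> {y \<in> carrier R. \<forall>s\<in>S. s \<otimes> y \<in> J}" using r a by auto
qed auto

text \<open>Two colon ideals, one for each factor, reduce the claim to products of
  generators.\<close>

lemma (in cring) genideal_mult:
  assumes "A \<subseteq> carrier R" "B \<subseteq> carrier R" "ideal J R"
    and AB: "\<And>a b. a \<in> A \<Longrightarrow> b \<in> B \<Longrightarrow> a \<otimes> b \<in> J"
    and "u \<in> Idl A" "v \<in> Idl B"
  shows "u \<otimes> v \<in> J"
proof -
  have A: "Idl A \<subseteq> carrier R" by (rule ideal_subD[OF genideal_ideal[OF assms(1)]])
  have B: "Idl B \<subseteq> carrier R" by (rule ideal_subD[OF genideal_ideal[OF assms(2)]])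
  have *: "Idl B \<subseteq> {y \<in> carrier R. \<forall>s\<in>A. s \<otimes> y \<in> J}"
    by (rule genideal_minimal[OF ideal_colon[OF assms(3,1)]]) (use AB assms(2) in auto)
  then have *: "b \<otimes> a \<in> J" if "a \<in> A" "b \<in> Idl B" for a b
  proof -
    have "a \<in> carrier R" "b \<in> carrier R" "a \<otimes> b \<in> J" using * that assms(1) B by auto
    then show ?thesis using m_comm[of a b] by simp
  qed
  have "Idl A \<subseteq> {y \<in> carrier R. \<forall>s\<in>Idl B. s \<otimes> y \<in> J}"
    by (rule genideal_minimal[OF ideal_colon[OF assms(3) B]]) (use * assms(1) in auto)
  then have "v \<otimes> u \<in> J" "u \<in> carrier R" "v \<in> carrier R" using assms(5,6) A B by auto
  then show ?thesis using m_comm[of u v] by simp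
qed

section \<open>Multi-indices, lexicographic order and Dickson's lemma\<close>

definition edeg :: "nat \<Rightarrow> (nat \<Rightarrow> nat) \<Rightarrow> nat" where
  "edeg \<mu> \<alpha> = (\<Sum>i<\<mu>. \<alpha> i)"

text \<open>Forcing zeros from \<open>\<mu>\<close> on gives each multi-index a single representing
  function, so that \<open>expo \<mu> d\<close> is finite.\<close>

definition expo :: "nat \<Rightarrow> nat \<Rightarrow> (nat \<Rightarrow> nat) set" where
  "expo \<mu> d = {\<alpha>. (\<forall>i\<ge>\<mu>. \<alpha> i = 0) \<and> edeg \<mu> \<alpha> = d}"

lemma expo_add: "\<alpha> \<in> expo \<mu> m \<Longrightarrow> \<beta> \<in> expo \<mu> n \<Longrightarrow> (\<lambda>i. \<alpha> i + \<beta> i) \<in> expo \<mu> (m + n)"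
  unfolding expo_def edeg_def by (auto simp: sum.distrib)

lemma finite_expo: "finite (expo \<mu> d)"
proof (rule finite_subset)
  have "\<alpha> i \<le> edeg \<mu> \<alpha>" if "i < \<mu>" for i \<alpha> unfolding edeg_def
    using that by (intro member_le_sum) auto
  then show "expo \<mu> d \<subseteq> {\<alpha>. \<forall>i. (i \<in> {..<\<mu>} \<longrightarrow> \<alpha> i \<in> {..d}) \<and> (i \<notin> {..<\<mu>} \<longrightarrow> \<alpha> i = 0)}"
    unfolding expo_def by auto
  show "finite {\<alpha>. \<forall>i. (i \<in> {..<\<mu>} \<longrightarrow> \<alpha> i \<in> {..d}) \<and> (i \<notin> {..<\<mu>} \<longrightarrow> \<alpha> i = 0)}"
    by (rule finite_set_of_finite_funs) auto
qed

lemma expo_Suc_cases: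
  assumes "\<alpha> \<in> expo \<mu> (Suc n)"
  obtains i \<beta> where "i < \<mu>" "\<beta> \<in> expo \<mu> n" "\<alpha> = (\<lambda>j. \<beta> j + (if j = i then 1 else 0))"
proof -
  have "\<exists>i<\<mu>. \<alpha> i > 0"
  proof (rule ccontr)
    assume "\<not> ?thesis"
    then have "edeg \<mu> \<alpha> = 0" unfolding edeg_def by auto
    then show False using assms unfolding expo_def by simp
  qed
  then obtain i where i: "i < \<mu>" "\<alpha> i > 0" by blast
  define \<beta> where "\<beta> = \<alpha>(i := \<alpha> i - 1)"
  have eq: "\<alpha> = (\<lambda>j. \<beta> j + (if j = i then 1 else 0))" using i by (auto simp: \<beta>_def)
  have "edeg \<mu> \<alpha> = edeg \<mu> \<beta> + 1" unfolding edeg_def by (subst eq) (use i in \<open>simp add: sum.distrib\<close>)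
  then have "\<beta> \<in> expo \<mu> n" using assms i unfolding expo_def by (auto simp: \<beta>_def)
  then show thesis using that i eq by blast
qed

definition lexlt :: "(nat \<Rightarrow> nat) \<Rightarrow> (nat \<Rightarrow> nat) \<Rightarrow> bool" where
  "lexlt \<alpha> \<beta> \<longleftrightarrow> (\<exists>i. (\<forall>j<i. \<alpha> j = \<beta> j) \<and> \<alpha> i < \<beta> i)"

lemma lexlt_irrefl: "\<not> lexlt \<alpha> \<alpha>"
  unfolding lexlt_def by simp

lemma lexlt_trans: "lexlt \<alpha> \<beta> \<Longrightarrow> lexlt \<beta> \<gamma> \<Longrightarrow> lexlt \<alpha> \<gamma>"
  unfolding lexlt_def
proof clarify
  fix i j assume "\<forall>k<i. \<alpha> k = \<beta> k" "\<alpha> i < \<beta> i" "\<forall>k<j. \<beta> k = \<gamma> k" "\<beta> j < \<gamma> j"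
  then show "\<exists>i. (\<forall>k<i. \<alpha> k = \<gamma> k) \<and> \<alpha> i < \<gamma> i"
    by (intro exI[of _ "min i j"]) (cases i j rule: linorder_cases; auto)
qed

lemma lexlt_total: "\<alpha> \<noteq> \<beta> \<Longrightarrow> lexlt \<alpha> \<beta> \<or> lexlt \<beta> \<alpha>"
proof -
  assume "\<alpha> \<noteq> \<beta>"
  then have ex: "\<exists>i. \<alpha> i \<noteq> \<beta> i" by auto
  define i where "i = (LEAST i. \<alpha> i \<noteq> \<beta> i)"
  have "\<alpha> i \<noteq> \<beta> i" unfolding i_def using ex by (rule LeastI_ex)
  moreover have "\<forall>j<i. \<alpha> j = \<beta> j" unfolding i_def using not_less_Least by blast
  ultimately show ?thesis unfolding lexlt_def by (metis linorder_neqE_nat)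
qed

lemma lexlt_add: "lexlt \<alpha> \<beta> \<Longrightarrow> lexlt (\<lambda>i. \<gamma> i + \<alpha> i) (\<lambda>i. \<gamma> i + \<beta> i)"
  unfolding lexlt_def by auto

lemma ex_lex_min:
  assumes "finite A" "A \<noteq> {}"
  shows "\<exists>\<alpha>\<in>A. \<forall>\<beta>\<in>A. \<beta> = \<alpha> \<or> lexlt \<alpha> \<beta>"
  using assms
proof (induct A rule: finite_ne_induct)
  case (insert a F)
  then obtain m where "m \<in> F" "\<forall>\<beta>\<in>F. \<beta> = m \<or> lexlt m \<beta>" by blast
  then show ?case using lexlt_total[of a m] lexlt_trans by (metis insert_iff)
qed auto

text \<open>An infinite antichain would contain an injective sequence. Thinning it once for each of
  the \<open>\<mu>\<close> coordinates makes all coordinates weakly increasing, and then its first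
  two terms are comparable.\<close>

lemma antichain_finite:
  fixes A :: "(nat \<Rightarrow> nat) set"
  assumes supp: "\<And>\<alpha> i. \<alpha> \<in> A \<Longrightarrow> i \<ge> \<mu> \<Longrightarrow> \<alpha> i = 0"
    and anti: "\<And>\<alpha> \<beta>. \<alpha> \<in> A \<Longrightarrow> \<beta> \<in> A \<Longrightarrow> \<alpha> \<le> \<beta> \<Longrightarrow> \<alpha> = \<beta>"
  shows "finite A"
proof (rule ccontr)
  assume "infinite A"
  then obtain s :: "nat \<Rightarrow> nat \<Rightarrow> nat" where s: "inj s" "range s \<subseteq> A"
    using infinite_countable_subset by blast
  have "\<exists>r::nat \<Rightarrow> nat. strict_mono r \<and> (\<forall>i<k. mono (\<lambda>n. s (r n) i))" for k
  proof (induct k)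
    case 0
    show ?case by (rule exI[of _ id]) (auto simp: strict_mono_def)
  next
    case (Suc k)
    then obtain r :: "nat \<Rightarrow> nat" where r: "strict_mono r" "\<forall>i<k. mono (\<lambda>n. s (r n) i)" by blast
    obtain r' :: "nat \<Rightarrow> nat" where r': "strict_mono r'" "monoseq (\<lambda>n. s (r (r' n)) k)"
      using seq_monosub[of "\<lambda>n. s (r n) k"] by auto
    have "\<exists>N. mono (\<lambda>n. s (r (r' (n + N))) k)"
    proof (cases "mono (\<lambda>n. s (r (r' n)) k)")
      case True
      then show ?thesis by (intro exI[of _ 0]) simp
    next
      case False
      then have dec: "\<And>m n. m \<le> n \<Longrightarrow> s (r (r' n)) k \<le> s (r (r' m)) k"
        using r'(2) unfolding monoseq_def mono_def by auto
      \<comment> \<open>A nonincreasing sequence of naturals is constant from a place where it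
        attains its minimum.\<close>
      define N where "N = (ARG_MIN (\<lambda>n. s (r (r' n)) k) n. True)"
      have "s (r (r' N)) k \<le> s (r (r' n)) k" for n
        unfolding N_def by (rule arg_min_nat_le) simp
      then have "s (r (r' (n + N))) k = s (r (r' N)) k" for n
        using dec[of N "n + N"] by (simp add: le_antisym)
      then show ?thesis by (intro exI[of _ N]) (simp add: mono_def)
    qed
    then obtain N where N: "mono (\<lambda>n. s (r (r' (n + N))) k)" by blast
    let ?r = "\<lambda>n. r (r' (n + N))"
    have "strict_mono ?r" using r(1) r'(1) by (simp add: strict_mono_def)
    moreover have "mono (\<lambda>n. s (?r n) i)" if "i < Suc k" for i
    proof (cases "i = k")
      case False
      then have "mono (\<lambda>n. s (r n) i)" using r(2) that by simp
      then show ?thesis using strict_mono_mono[OF r'(1)] unfolding mono_def by auto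
    qed (use N in simp)
    ultimately show ?case by blast
  qed
  then obtain r :: "nat \<Rightarrow> nat" where r: "strict_mono r" "\<forall>i<\<mu>. mono (\<lambda>n. s (r n) i)" by blast
  have "s (r 0) i \<le> s (r 1) i" for i
  proof (cases "i < \<mu>")
    case True
    then show ?thesis using r(2) unfolding mono_def by simp
  next
    case False
    then show ?thesis using supp s(2) by (metis (no_types, lifting) linorder_not_less order_refl range_subsetD)
  qed
  then have "s (r 0) = s (r 1)" using anti s(2) by (meson le_funI range_subsetD)
  then have "r 0 = r 1" using s(1) by (simp add: inj_eq)
  then show False using r(1) by (metis strict_mono_eq zero_neq_one)
qed

text \<open>The minimal elements form an antichain, hence a finite set, and descending in degree
  from any element reaches one of them.\<close>

lemma dickson:
  fixes A :: "(nat \<Rightarrow> nat) set"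
  assumes supp: "\<And>\<alpha> i. \<alpha> \<in> A \<Longrightarrow> i \<ge> \<mu> \<Longrightarrow> \<alpha> i = 0"
  shows "\<exists>F. finite F \<and> F \<subseteq> A \<and> (\<forall>\<alpha>\<in>A. \<exists>\<beta>\<in>F. \<beta> \<le> \<alpha>)"
proof (intro exI conjI ballI)
  let ?F = "{\<alpha>\<in>A. \<forall>\<beta>\<in>A. \<beta> \<le> \<alpha> \<longrightarrow> \<beta> = \<alpha>}"
  show "finite ?F" by (rule antichain_finite[of _ \<mu>]) (use supp in auto)
  show "?F \<subseteq> A" by blast
  fix \<alpha> assume "\<alpha> \<in> A"
  then show "\<exists>\<beta>\<in>?F. \<beta> \<le> \<alpha>"
  proof (induct "edeg \<mu> \<alpha>" arbitrary: \<alpha> rule: less_induct)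
    case less
    show ?case
    proof (cases "\<alpha> \<in> ?F")
      case False
      then obtain \<beta> where b: "\<beta> \<in> A" "\<beta> \<le> \<alpha>" "\<beta> \<noteq> \<alpha>" using less(2) by auto
      then obtain i where i: "\<beta> i \<noteq> \<alpha> i" by auto
      then have "i < \<mu>" using supp[of \<alpha> i] supp[of \<beta> i] b less(2) by force
      moreover have "\<beta> i < \<alpha> i" using i b(2) by (simp add: le_fun_def order_less_le)
      ultimately have "edeg \<mu> \<beta> < edeg \<mu> \<alpha>" unfolding edeg_def
        using b(2) by (intro sum_strict_mono_ex1) (auto simp: le_fun_def)
      then show ?thesis using less(1) b by (meson order_trans)
    qed auto
  qed
qed

section \<open>Powers of an ideal through monomials in its generators\<close>

locale generators = cring R for R (structure) +
  fixes x :: "nat \<Rightarrow> 'a" and \<mu> :: nat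
  assumes x_closed: "\<And>i. i < \<mu> \<Longrightarrow> x i \<in> carrier R"
begin

definition mon :: "(nat \<Rightarrow> nat) \<Rightarrow> 'a" where
  "mon \<alpha> = (\<Otimes>i\<in>{..<\<mu>}. x i [^] \<alpha> i)"

text \<open>The n-th power of the ideal of the \<open>x i\<close>, presented by monomials because
  leading exponents and \<open>cartier_G\<close> work on monomials. \<open>mon_in_ideal_pow\<close>
  and \<open>ideal_pow_sub_G\<close> compare it with the power of ideals used for symbolic
  powers.\<close>

definition G :: "nat \<Rightarrow> 'a set" where
  "G n = Idl (mon ` expo \<mu> n)"

lemma mon_closed [simp]: "mon \<alpha> \<in> carrier R"
  unfolding mon_def using x_closed by (intro finprod_closed) auto

lemma mon_add: "mon (\<lambda>i. \<alpha> i + \<beta> i) = mon \<alpha> \<otimes> mon \<beta>"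
proof -
  have "mon (\<lambda>i. \<alpha> i + \<beta> i) = (\<Otimes>i\<in>{..<\<mu>}. x i [^] \<alpha> i \<otimes> x i [^] \<beta> i)"
    unfolding mon_def by (rule finprod_cong') (use x_closed in \<open>auto simp: nat_pow_mult\<close>)
  then show ?thesis using x_closed by (simp add: mon_def Pi_iff)
qed

lemma mon_pow: "mon (\<lambda>i. q * \<alpha> i) = mon \<alpha> [^] (q :: nat)"
proof (induct q)
  case 0
  have "mon (\<lambda>i. 0) = \<one>" unfolding mon_def by simp
  then show ?case by simp
next
  case (Suc q)
  then show ?case using mon_add[of "\<lambda>i. q * \<alpha> i" \<alpha>] by (simp add: add.commute)
qed

lemma mon_single: "i < \<mu> \<Longrightarrow> mon (\<lambda>j. if j = i then 1 else 0) = x i"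
proof -
  assume i: "i < \<mu>"
  have "mon (\<lambda>j. if j = i then 1 else 0) = (\<Otimes>j\<in>{..<\<mu>}. if i = j then x j else \<one>)"
    unfolding mon_def by (rule finprod_cong') (use x_closed in auto)
  also have "\<dots> = x i" using i x_closed by (intro finprod_singleton) auto
  finally show ?thesis .
qed

lemma G_ideal: "ideal (G n) R"
  unfolding G_def by (rule genideal_ideal) auto

lemmas G_sub = ideal_subD[OF G_ideal]

lemma mon_in_G: "\<alpha> \<in> expo \<mu> n \<Longrightarrow> mon \<alpha> \<in> G n"
  unfolding G_def by (rule subsetD[OF genideal_self]) auto

lemma G_least: "ideal J R \<Longrightarrow> (\<And>\<alpha>. \<alpha> \<in> expo \<mu> n \<Longrightarrow> mon \<alpha> \<in> J) \<Longrightarrow> G n \<subseteq> J"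
  unfolding G_def by (rule genideal_minimal) auto

lemma G_0: "G 0 = carrier R"
proof -
  have "(\<lambda>i. 0) \<in> expo \<mu> 0" unfolding expo_def edeg_def by auto
  moreover have "mon (\<lambda>i. 0) = \<one>" unfolding mon_def by simp
  ultimately have "\<one> \<in> G 0" using mon_in_G by force
  then show ?thesis by (rule ideal.one_imp_carrier[OF G_ideal])
qed

lemma G_mult: "a \<in> G m \<Longrightarrow> b \<in> G n \<Longrightarrow> a \<otimes> b \<in> G (m + n)"
proof -
  assume ab: "a \<in> G m" "b \<in> G n"
  show ?thesis
    by (rule genideal_mult[OF _ _ G_ideal _ ab[unfolded G_def]])
      (auto simp: mon_add[symmetric] intro!: mon_in_G expo_add)
qed

lemma G_Suc: "G (Suc n) \<subseteq> G n"
proof (rule G_least[OF G_ideal])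
  fix \<alpha> assume "\<alpha> \<in> expo \<mu> (Suc n)"
  then obtain i \<beta> where *: "i < \<mu>" "\<beta> \<in> expo \<mu> n" "\<alpha> = (\<lambda>j. \<beta> j + (if j = i then 1 else 0))"
    by (rule expo_Suc_cases)
  then show "mon \<alpha> \<in> G n" unfolding *(3) mon_add
    by (intro ideal.I_r_closed[OF G_ideal] mon_in_G) auto
qed

lemma G_mono: "m \<le> n \<Longrightarrow> G n \<subseteq> G m"
  by (rule lift_Suc_antimono_le[of G]) (use G_Suc in auto)

lemma G_pow: "a \<in> G n \<Longrightarrow> a [^] (k::nat) \<in> G (k * n)"
proof (induct k)
  case (Suc k)
  then show ?case using G_mult[of "a [^] k" "k * n" a n] by (simp add: add.commute)
qed (simp add: G_0)

lemma genideal_x_G: "Idl (x ` {..<\<mu>}) \<subseteq> G 1"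
proof (rule genideal_minimal[OF G_ideal])
  have "x i \<in> G 1" if "i < \<mu>" for i
  proof -
    have "(\<lambda>j. if j = i then 1 else 0) \<in> expo \<mu> 1" unfolding expo_def edeg_def using that by auto
    then show ?thesis using mon_in_G mon_single[OF that] by force
  qed
  then show "x ` {..<\<mu>} \<subseteq> G 1" by auto
qed

text \<open>The terms beyond \<open>mon \<alpha>\<close> in the local order, by degree first and
  lexicographically within a degree: terms of high degree are the negligible ones. One further
  degree is enough, as \<open>G (Suc d)\<close> contains all higher powers.\<close>

definition above :: "(nat \<Rightarrow> nat) \<Rightarrow> 'a set" where
  "above \<alpha> = Idl (mon ` {\<beta> \<in> expo \<mu> (edeg \<mu> \<alpha>). lexlt \<alpha> \<beta>} \<union> mon ` expo \<mu> (Suc (edeg \<mu> \<alpha>)))"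

definition leads :: "'a set \<Rightarrow> (nat \<Rightarrow> nat) set" where
  "leads J = {\<alpha>. (\<forall>i\<ge>\<mu>. \<alpha> i = 0) \<and> (\<exists>f\<in>J. f \<ominus> mon \<alpha> \<in> above \<alpha>)}"

lemma above_ideal: "ideal (above \<alpha>) R"
  unfolding above_def by (rule genideal_ideal) auto

lemma above_gen:
  "\<beta> \<in> expo \<mu> (edeg \<mu> \<alpha>) \<Longrightarrow> lexlt \<alpha> \<beta> \<Longrightarrow> mon \<beta> \<in> above \<alpha>"
  "\<beta> \<in> expo \<mu> (Suc (edeg \<mu> \<alpha>)) \<Longrightarrow> mon \<beta> \<in> above \<alpha>"
  unfolding above_def by (rule subsetD[OF genideal_self]; auto)+

lemma G_above: "G (Suc (edeg \<mu> \<alpha>)) \<subseteq> above \<alpha>"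
  by (rule G_least[OF above_ideal]) (rule above_gen(2))

lemma above_mult:
  assumes "f \<in> above \<alpha>" "\<forall>i\<ge>\<mu>. \<alpha> i = 0" "\<forall>i\<ge>\<mu>. \<gamma> i = 0"
  shows "mon \<gamma> \<otimes> f \<in> above (\<lambda>i. \<gamma> i + \<alpha> i)"
proof -
  let ?J = "{y \<in> carrier R. \<forall>s\<in>{mon \<gamma>}. s \<otimes> y \<in> above (\<lambda>i. \<gamma> i + \<alpha> i)}"
  have d: "edeg \<mu> (\<lambda>i. \<gamma> i + \<alpha> i) = edeg \<mu> \<gamma> + edeg \<mu> \<alpha>" unfolding edeg_def by (simp add: sum.distrib)
  have g: "\<gamma> \<in> expo \<mu> (edeg \<mu> \<gamma>)" using assms(3) unfolding expo_def by simp
  have "above \<alpha> \<subseteq> ?J" unfolding above_def[of \<alpha>]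
  proof (rule genideal_minimal)
    show "ideal ?J R" by (rule ideal_colon[OF above_ideal]) auto
    show "mon ` {\<beta> \<in> expo \<mu> (edeg \<mu> \<alpha>). lexlt \<alpha> \<beta>} \<union> mon ` expo \<mu> (Suc (edeg \<mu> \<alpha>)) \<subseteq> ?J"
    proof safe
      fix \<beta> assume b: "\<beta> \<in> expo \<mu> (edeg \<mu> \<alpha>)" "lexlt \<alpha> \<beta>"
      show "mon \<gamma> \<otimes> mon \<beta> \<in> above (\<lambda>i. \<gamma> i + \<alpha> i)"
        unfolding mon_add[symmetric] using expo_add[OF g b(1)] lexlt_add[OF b(2)] by (intro above_gen(1)) (simp_all add: d)
    next
      fix \<beta> assume b: "\<beta> \<in> expo \<mu> (Suc (edeg \<mu> \<alpha>))"
      show "mon \<gamma> \<otimes> mon \<beta> \<in> above (\<lambda>i. \<gamma> i + \<alpha> i)"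
        unfolding mon_add[symmetric] using expo_add[OF g b] by (intro above_gen(2)) (simp add: d)
    qed auto
  qed
  then show ?thesis using assms(1) by auto
qed

text \<open>Adding \<open>\<gamma>\<close> respects both degree and lexicographic comparison. The
  leading exponents thus form an upward closed set of multi-indices, which Dickson's lemma describes
  by finitely many elements.\<close>

lemma leads_mult:
  assumes "ideal J R" "\<alpha> \<in> leads J" "\<forall>i\<ge>\<mu>. \<gamma> i = 0"
  shows "(\<lambda>i. \<gamma> i + \<alpha> i) \<in> leads J"
proof -
  obtain f where f: "f \<in> J" "f \<ominus> mon \<alpha> \<in> above \<alpha>" and a: "\<forall>i\<ge>\<mu>. \<alpha> i = 0"
    using assms(2) unfolding leads_def by auto
  have fc: "f \<in> carrier R" using f(1) ideal_subD[OF assms(1)] by auto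
  have "mon \<gamma> \<otimes> (f \<ominus> mon \<alpha>) \<in> above (\<lambda>i. \<gamma> i + \<alpha> i)" by (rule above_mult[OF f(2) a assms(3)])
  moreover have "mon \<gamma> \<otimes> (f \<ominus> mon \<alpha>) = mon \<gamma> \<otimes> f \<ominus> mon (\<lambda>i. \<gamma> i + \<alpha> i)"
    using fc by (simp add: mon_add minus_eq r_distr r_minus)
  moreover have "mon \<gamma> \<otimes> f \<in> J" using f(1) assms(1) by (simp add: ideal.I_l_closed)
  ultimately show ?thesis using a assms(3) unfolding leads_def by auto
qed

lemma leads_mono: "J \<subseteq> J' \<Longrightarrow> leads J \<subseteq> leads J'"
  unfolding leads_def by auto

end

section \<open>Elimination and orders in local rings\<close>

text \<open>The ideal L f_1 + ... + L f_k + N, defined along the list so that one generator can be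
  removed at a time.\<close>

primrec (in cring) elim_set :: "'a set \<Rightarrow> 'a set \<Rightarrow> 'a list \<Rightarrow> 'a set" where
  "elim_set L N [] = N"
| "elim_set L N (f # fs) = {l \<otimes> f \<oplus> y | l y. l \<in> L \<and> y \<in> elim_set L N fs}"

lemma (in cring) elim_set_ideal:
  assumes "ideal L R" "ideal N R" "set fs \<subseteq> carrier R"
  shows "ideal (elim_set L N fs) R"
  using assms(3)
proof (induct fs)
  case (Cons f fs)
  then have E: "ideal (elim_set L N fs) R" and f: "f \<in> carrier R" by auto
  note sub = ideal_subD[OF E] ideal_subD[OF assms(1)]
  have mem: "l \<in> L \<Longrightarrow> y \<in> elim_set L N fs \<Longrightarrow> l \<otimes> f \<oplus> y \<in> elim_set L N (f # fs)" for l y by auto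
  show ?case
  proof (rule cring_idealI)
    show "elim_set L N (f # fs) \<subseteq> carrier R" using sub f by auto
    have "\<zero> = \<zero> \<otimes> f \<oplus> \<zero>" using f by simp
    then show "\<zero> \<in> elim_set L N (f # fs)" using ideal_zeroD[OF E] ideal_zeroD[OF assms(1)] by auto
  next
    fix a b assume "a \<in> elim_set L N (f # fs)" "b \<in> elim_set L N (f # fs)"
    then obtain l y l' y' where *: "a = l \<otimes> f \<oplus> y" "b = l' \<otimes> f \<oplus> y'" "l \<in> L" "l' \<in> L"
      "y \<in> elim_set L N fs" "y' \<in> elim_set L N fs" by auto
    have c: "l \<in> carrier R" "l' \<in> carrier R" "y \<in> carrier R" "y' \<in> carrier R" using * sub by auto
    have "a \<oplus> b = (l \<oplus> l') \<otimes> f \<oplus> (y \<oplus> y')" using * c f by (simp add: l_distr a_ac)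
    then show "a \<oplus> b \<in> elim_set L N (f # fs)"
      using mem[OF ideal_addD[OF assms(1) *(3,4)] ideal_addD[OF E *(5,6)]] by simp
  next
    fix r a assume r: "r \<in> carrier R" and "a \<in> elim_set L N (f # fs)"
    then obtain l y where *: "a = l \<otimes> f \<oplus> y" "l \<in> L" "y \<in> elim_set L N fs" by auto
    have c: "l \<in> carrier R" "y \<in> carrier R" using * sub by auto
    have "r \<otimes> a = (r \<otimes> l) \<otimes> f \<oplus> r \<otimes> y" using * c f r by (simp add: r_distr m_assoc)
    then show "r \<otimes> a \<in> elim_set L N (f # fs)"
      using mem[OF ideal.I_l_closed[OF assms(1) *(2) r] ideal.I_l_closed[OF E *(3) r]] by simp
  qed
qed (use assms(2) in simp)

lemma (in cring) elim_set_gen: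
  assumes "ideal L R" "ideal N R" "set fs \<subseteq> carrier R" "l \<in> L"
  shows "f \<in> set fs \<Longrightarrow> l \<otimes> f \<in> elim_set L N fs" and "N \<subseteq> elim_set L N fs"
proof -
  have z: "\<zero> \<in> L" by (rule ideal_zeroD[OF assms(1)])
  have sub: "\<And>fs. set fs \<subseteq> carrier R \<Longrightarrow> elim_set L N fs \<subseteq> carrier R"
    using elim_set_ideal[OF assms(1,2)] ideal_subD by blast
  have l: "l \<in> carrier R" using assms(4) ideal_subD[OF assms(1)] by auto
  show "f \<in> set fs \<Longrightarrow> l \<otimes> f \<in> elim_set L N fs"
    using assms(3)
  proof (induct fs)
    case (Cons g fs)
    show ?case
    proof (cases "f = g")
      case True
      have "l \<otimes> f = l \<otimes> g \<oplus> \<zero>" using True l Cons by simp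
      then show ?thesis using assms(4) ideal_zeroD[OF elim_set_ideal[OF assms(1,2), of fs]] Cons by auto
    next
      case False
      then have "l \<otimes> f \<in> elim_set L N fs" using Cons by auto
      moreover have "l \<otimes> f = \<zero> \<otimes> g \<oplus> l \<otimes> f" using l Cons by auto
      ultimately show ?thesis using z by auto
    qed
  qed simp
  show "N \<subseteq> elim_set L N fs" using assms(3)
  proof (induct fs)
    case (Cons g fs)
    show ?case
    proof
      fix n assume n: "n \<in> N"
      then have "n \<in> elim_set L N fs" using Cons by auto
      moreover from this have "n = \<zero> \<otimes> g \<oplus> n" using sub[of fs] Cons by auto
      ultimately show "n \<in> elim_set L N (g # fs)" using z by auto
    qed
  qed simp
qed

lemma (in cring) elim_set_annihilate:
  assumes "ideal L R" "ideal N R" "set fs \<subseteq> carrier R" "d \<in> carrier R"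
    and "\<And>f. f \<in> set fs \<Longrightarrow> d \<otimes> f \<in> N" "y \<in> elim_set L N fs"
  shows "d \<otimes> y \<in> N"
  using assms(3,5,6)
proof (induct fs arbitrary: y)
  case Nil
  then show ?case using ideal.I_l_closed[OF assms(2)] assms(4) by simp
next
  case (Cons f fs)
  then obtain l z where *: "y = l \<otimes> f \<oplus> z" "l \<in> L" "z \<in> elim_set L N fs" by auto
  have c: "l \<in> carrier R" "z \<in> carrier R" "f \<in> carrier R"
    using * ideal_subD[OF assms(1)] ideal_subD[OF elim_set_ideal[OF assms(1,2), of fs]] Cons by auto
  have "d \<otimes> y = l \<otimes> (d \<otimes> f) \<oplus> d \<otimes> z" using * c assms(4) by (simp add: r_distr m_lcomm)
  then show ?case using Cons * c ideal.I_l_closed[OF assms(2)] ideal_addD[OF assms(2)] by auto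
qed

lemma (in cring) cong_mult:
  assumes "ideal L R" "a \<in> carrier R" "b \<in> carrier R" "a' \<in> carrier R" "b' \<in> carrier R"
    "a \<ominus> b \<in> L" "a' \<ominus> b' \<in> L"
  shows "a \<otimes> a' \<ominus> b \<otimes> b' \<in> L"
proof -
  have "a \<otimes> a' \<ominus> b \<otimes> b' = a \<otimes> (a' \<ominus> b') \<oplus> (a \<ominus> b) \<otimes> b'"
    using assms(2-5) by algebra
  then show ?thesis using assms by (simp add: ideal_addD ideal.I_l_closed ideal.I_r_closed)
qed

text \<open>Gaussian elimination in place of the determinant trick: each relation \<open>z f \<in> L f + \<dots>\<close> is
  used to remove one generator, at the cost of doubling the exponent of \<open>c\<close>.\<close>

lemma (in cring) elimination:
  fixes s :: nat
  assumes L: "ideal L R" and N: "ideal N R" and c: "c \<in> carrier R"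
    and "set fs \<subseteq> carrier R" "z \<in> carrier R" "z \<ominus> c [^] s \<in> L"
    and "\<And>f. f \<in> set fs \<Longrightarrow> z \<otimes> f \<in> elim_set L N fs"
  shows "\<exists>d\<in>carrier R. d \<ominus> c [^] (s * (2 ^ length fs - 1)) \<in> L \<and> (\<forall>f\<in>set fs. d \<otimes> f \<in> N)"
  using assms(4-7)
proof (induct fs arbitrary: z s)
  case Nil
  show ?case using ideal_zeroD[OF L] by (intro bexI[of _ \<one>]) (auto simp: r_neg minus_eq)
next
  case (Cons f fs)
  have f: "f \<in> carrier R" and fs: "set fs \<subseteq> carrier R" using Cons(2) by auto
  note E = elim_set_ideal[OF L N fs]
  obtain l y where ly: "z \<otimes> f = l \<otimes> f \<oplus> y" "l \<in> L" "y \<in> elim_set L N fs" using Cons(5)[of f] by auto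
  have car: "l \<in> carrier R" "y \<in> carrier R" using ly ideal_subD[OF L] ideal_subD[OF E] by auto
  \<comment> \<open>Moving l f to the left makes \<open>?u\<close> send f into the span of the other
    generators; as l is in L, \<open>?u\<close> still represents c^s modulo L.\<close>
  let ?u = "z \<ominus> l"
  have u: "?u \<in> carrier R" using Cons(3) car by simp
  have "?u \<otimes> f = z \<otimes> f \<ominus> l \<otimes> f" using Cons(3) car f by algebra
  also have "\<dots> = y" unfolding ly(1) using car f by algebra
  finally have uf: "?u \<otimes> f = y" .
  have "?u \<ominus> c [^] s = (z \<ominus> c [^] s) \<ominus> l" using Cons(3) car c
    by (simp add: minus_eq a_ac)
  then have uc: "?u \<ominus> c [^] s \<in> L" using Cons(4) ly(2) ideal_minusD[OF L] by simp
  have zc: "?u \<otimes> z \<ominus> c [^] (2 * s) \<in> L"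
    using cong_mult[OF L u _ Cons(3) _ uc Cons(4)] c by (simp add: nat_pow_mult mult_2)
  \<comment> \<open>Multiplication by \<open>?u\<close> also removes f from the relation of any
    other g; the multiplier becomes \<open>?u\<close> z, which represents c^(2 s).\<close>
  have "?u \<otimes> z \<otimes> g \<in> elim_set L N fs" if g: "g \<in> set fs" for g
  proof -
    have gc: "g \<in> carrier R" using g fs by auto
    obtain l' y' where ly': "z \<otimes> g = l' \<otimes> f \<oplus> y'" "l' \<in> L" "y' \<in> elim_set L N fs" using Cons(5)[of g] g by auto
    have car': "l' \<in> carrier R" "y' \<in> carrier R" using ly' ideal_subD[OF L] ideal_subD[OF E] by auto
    have "?u \<otimes> z \<otimes> g = ?u \<otimes> (l' \<otimes> f \<oplus> y')" using u Cons(3) gc by (simp add: m_assoc ly'(1))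
    also have "\<dots> = l' \<otimes> (?u \<otimes> f) \<oplus> ?u \<otimes> y'" using u car' f by (simp add: r_distr m_lcomm)
    also have "\<dots> = l' \<otimes> y \<oplus> ?u \<otimes> y'" by (simp only: uf)
    finally show ?thesis using ly(3) ly'(3) car' u ideal_addD[OF E] ideal.I_l_closed[OF E] by simp
  qed
  then obtain d where d: "d \<in> carrier R" "d \<ominus> c [^] (2 * s * (2 ^ length fs - 1)) \<in> L" "\<forall>f\<in>set fs. d \<otimes> f \<in> N"
    using Cons(1)[OF fs _ zc] u Cons(3) by auto
  show ?case
  proof (intro bexI[of _ "d \<otimes> ?u"] conjI ballI)
    \<comment> \<open>The exponents obey E(k+1) = 2 E(k) + 1 in units of s, with E(0) = 0.\<close>
    have "2 * s * (2 ^ length fs - 1) + s = s * (2 ^ length (f # fs) - 1)"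
      by (cases "(2::nat) ^ length fs") (auto simp: algebra_simps)
    then show "d \<otimes> ?u \<ominus> c [^] (s * (2 ^ length (f # fs) - 1)) \<in> L"
      using cong_mult[OF L d(1) _ u _ d(2) uc] c by (simp add: nat_pow_mult)
    have dy: "d \<otimes> y \<in> N" by (rule elim_set_annihilate[OF L N fs d(1) _ ly(3)]) (use d(3) in auto)
    fix g assume "g \<in> set (f # fs)"
    then consider "g = f" | "g \<in> set fs" by auto
    then show "d \<otimes> ?u \<otimes> g \<in> N"
    proof cases
      case 1
      then have "d \<otimes> ?u \<otimes> g = d \<otimes> y" using d(1) u f by (simp add: m_assoc uf)
      then show ?thesis using dy by simp
    next
      case 2
      then have "d \<otimes> ?u \<otimes> g = ?u \<otimes> (d \<otimes> g)" using d(1) u fs by (simp add: m_ac subset_iff)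
      then show ?thesis using d(3) 2 u ideal.I_l_closed[OF N] by simp
    qed
  qed (use d(1) u in simp)
qed

text \<open>\<open>x\<close> is any finite generating family of the maximal ideal; orders and
  leading exponents are taken with respect to it.\<close>

locale char_p_local = char_p_cring R p + generators R x \<mu>
  for R :: "('a, 'b) ring_scheme" (structure) and p :: nat and x :: "nat \<Rightarrow> 'a" and \<mu> :: nat +
  assumes unit: "a \<in> carrier R \<Longrightarrow> a \<notin> Idl (x ` {..<\<mu>}) \<Longrightarrow> a \<in> Units R"
    and proper: "\<one> \<notin> Idl (x ` {..<\<mu>})"
begin

abbreviation M :: "'a set" where "M \<equiv> Idl (x ` {..<\<mu>})"

lemma M_ideal: "ideal M R"
  by (rule genideal_ideal) (use x_closed in auto)

text \<open>One degree is cleared by treating its exponents in increasing lexicographic order, A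
  being those still to be treated. If the coefficient r of the least \<open>\<alpha>\<close> in A is
  in M, its term lies in degree d + 1 and is absorbed. Otherwise r is a unit,
  \<open>\<alpha>\<close> is a leading exponent of J, hence of J', and a multiple of its witness in
  J' cancels the term.\<close>

lemma upper_reduce:
  assumes J: "ideal J R" "ideal J' R" "J' \<subseteq> J"
    and leads: "\<And>\<alpha>. \<alpha> \<in> leads J \<Longrightarrow> edeg \<mu> \<alpha> = d \<Longrightarrow> \<alpha> \<in> leads J'"
    and "A \<subseteq> expo \<mu> d" "\<And>\<alpha> \<beta>. \<alpha> \<in> A \<Longrightarrow> \<beta> \<in> expo \<mu> d \<Longrightarrow> lexlt \<alpha> \<beta> \<Longrightarrow> \<beta> \<in> A"
    and "f \<in> J" "f \<in> Idl (mon ` A \<union> mon ` expo \<mu> (Suc d))"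
  shows "\<exists>j\<in>J'. f \<ominus> j \<in> G (Suc d)"
  using assms(5-8)
proof (induct "card A" arbitrary: A f)
  case 0
  then have "A = {}" using finite_subset[OF 0(2) finite_expo] by simp
  then have "f \<in> G (Suc d)" using 0 unfolding G_def by simp
  moreover from this have "f \<ominus> \<zero> = f" using subsetD[OF G_sub] by (simp add: minus_eq)
  ultimately show ?case using ideal_zeroD[OF J(2)] by metis
next
  case (Suc n)
  have finA: "finite A" using finite_subset[OF Suc(3) finite_expo] .
  then obtain \<alpha> where a: "\<alpha> \<in> A" "\<forall>\<beta>\<in>A. \<beta> = \<alpha> \<or> lexlt \<alpha> \<beta>" using ex_lex_min[of A] Suc(2) by fastforce
  define A' where "A' = A - {\<alpha>}"
  have deg: "edeg \<mu> \<alpha> = d" "\<forall>i\<ge>\<mu>. \<alpha> i = 0" using a Suc(3) unfolding expo_def by auto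
  have A'_eq: "A' = {\<beta> \<in> expo \<mu> d. lexlt \<alpha> \<beta>}"
    using a Suc(3,4) lexlt_irrefl unfolding A'_def by blast
  let ?W = "Idl (mon ` A' \<union> mon ` expo \<mu> (Suc d))"
  have W: "?W = above \<alpha>" unfolding above_def deg A'_eq ..
  have fc: "f \<in> carrier R" using Suc(5) ideal_subD[OF J(1)] by auto
  have IH: "\<exists>j\<in>J'. g \<ominus> j \<in> G (Suc d)" if "g \<in> J" "g \<in> above \<alpha>" for g
  proof (rule Suc(1)[of A'])
    show "n = card A'" using Suc(2) finA a(1) unfolding A'_def by simp
    show "A' \<subseteq> expo \<mu> d" using A'_eq by auto
    show "\<And>\<beta> \<gamma>. \<beta> \<in> A' \<Longrightarrow> \<gamma> \<in> expo \<mu> d \<Longrightarrow> lexlt \<beta> \<gamma> \<Longrightarrow> \<gamma> \<in> A'" using A'_eq lexlt_trans by auto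
  qed (use that W in auto)
  have "insert (mon \<alpha>) (mon ` A' \<union> mon ` expo \<mu> (Suc d)) = mon ` A \<union> mon ` expo \<mu> (Suc d)"
    using a(1) unfolding A'_def by auto
  then have "f \<in> Idl (insert (mon \<alpha>) (mon ` A' \<union> mon ` expo \<mu> (Suc d)))" using Suc(6) by simp
  then obtain r s where rs: "r \<in> carrier R" "s \<in> ?W" "f = r \<otimes> mon \<alpha> \<oplus> s"
    by (rule genideal_insertE[rotated 2]) auto
  have s: "s \<in> above \<alpha>" using rs(2) W by simp
  have sc: "s \<in> carrier R" using s ideal_subD[OF above_ideal] by auto
  show ?case
  proof (cases "r \<in> M")
    case True
    then have "r \<in> G 1" using genideal_x_G by auto
    moreover have "mon \<alpha> \<in> G d" using mon_in_G a(1) Suc(3) by auto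
    ultimately have "r \<otimes> mon \<alpha> \<in> G (Suc d)" using G_mult by fastforce
    then have "r \<otimes> mon \<alpha> \<in> above \<alpha>" using G_above deg(1) by auto
    then show ?thesis using IH Suc(5) rs(3) s ideal_addD[OF above_ideal] by auto
  next
    case False
    then have r: "r \<in> Units R" using unit rs(1) by auto
    define b where "b = inv r"
    have b: "b \<in> carrier R" "b \<otimes> r = \<one>" using r by (auto simp: b_def)
    have "b \<otimes> f = b \<otimes> r \<otimes> mon \<alpha> \<oplus> b \<otimes> s" using b(1) rs sc by (simp add: r_distr m_assoc)
    then have "b \<otimes> f \<ominus> mon \<alpha> = b \<otimes> s" using b sc by (simp add: minus_eq a_ac r_neg)
    then have "b \<otimes> f \<ominus> mon \<alpha> \<in> above \<alpha>" using s b ideal.I_l_closed[OF above_ideal] by simp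
    then have "\<alpha> \<in> leads J" unfolding leads_def using deg(2) ideal.I_l_closed[OF J(1) Suc(5) b(1)] by auto
    then obtain h where h: "h \<in> J'" "h \<ominus> mon \<alpha> \<in> above \<alpha>" using leads deg(1) unfolding leads_def by auto
    have hc: "h \<in> carrier R" using h(1) ideal_subD[OF J(2)] by auto
    have "f \<ominus> r \<otimes> h = s \<ominus> r \<otimes> (h \<ominus> mon \<alpha>)"
    proof -
      have m: "mon \<alpha> \<in> carrier R" by simp
      show ?thesis unfolding rs(3) using sc rs(1) hc m by algebra
    qed
    then have *: "f \<ominus> r \<otimes> h \<in> above \<alpha>" using s h(2) rs(1) by (simp add: ideal_simps above_ideal)
    have rh: "r \<otimes> h \<in> J'" using h(1) rs(1) J(2) by (simp add: ideal_simps)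
    then have "f \<ominus> r \<otimes> h \<in> J" using Suc(5) J by (auto simp: ideal_simps)
    then obtain j where j: "j \<in> J'" "f \<ominus> r \<otimes> h \<ominus> j \<in> G (Suc d)" using IH * by blast
    have jc: "j \<in> carrier R" using j(1) ideal_subD[OF J(2)] by auto
    have "f \<ominus> (r \<otimes> h \<oplus> j) = f \<ominus> r \<otimes> h \<ominus> j" using fc rs(1) hc jc by algebra
    then show ?thesis using j rh ideal_addD[OF J(2)] by metis
  qed
qed

text \<open>The degrees 0, ..., n-1 are cleared one after the other. The process stops there and
  leaves an error in \<open>G n\<close>, instead of passing to a limit in a completion.\<close>

lemma leads_division:
  assumes J: "ideal J R" "ideal J' R" "J' \<subseteq> J"
    and leads: "\<And>\<alpha>. \<alpha> \<in> leads J \<Longrightarrow> edeg \<mu> \<alpha> < n \<Longrightarrow> \<alpha> \<in> leads J'"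
    and f: "f \<in> J"
  shows "\<exists>j\<in>J'. f \<ominus> j \<in> G n"
proof -
  have fc: "f \<in> carrier R" using f ideal_subD[OF J(1)] by auto
  have "d \<le> n \<Longrightarrow> \<exists>j\<in>J'. f \<ominus> j \<in> G d" for d
  proof (induct d)
    case 0
    show ?case using ideal_zeroD[OF J(2)] fc G_0 by auto
  next
    case (Suc d)
    then obtain j where j: "j \<in> J'" "f \<ominus> j \<in> G d" by auto
    have jc: "j \<in> carrier R" using j(1) ideal_subD[OF J(2)] by auto
    have "G d \<subseteq> Idl (mon ` expo \<mu> d \<union> mon ` expo \<mu> (Suc d))"
      unfolding G_def by (rule subset_Idl_subset) (auto intro!: subset_trans[OF _ genideal_self])
    then have "\<exists>j'\<in>J'. f \<ominus> j \<ominus> j' \<in> G (Suc d)"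
      using j J f Suc(2) by (intro upper_reduce[OF J, of d "expo \<mu> d"] leads) (auto simp: ideal_simps)
    then obtain j' where j': "j' \<in> J'" "f \<ominus> j \<ominus> j' \<in> G (Suc d)" by blast
    have jc': "j' \<in> carrier R" using j'(1) ideal_subD[OF J(2)] by auto
    have "f \<ominus> (j \<oplus> j') = f \<ominus> j \<ominus> j'" using fc jc jc' by algebra
    then show ?case using j(1) j' ideal_addD[OF J(2)] by metis
  qed
  then show ?thesis by simp
qed

text \<open>Divide each exponent by q with remainder. The quotient part is a q-th power and leaves
  \<open>\<phi>\<close> as \<open>mon \<beta>\<close>, while the remainders have total degree at
  most \<mu> q; so order s becomes at least s/q - \<mu>.\<close>

lemma cartier_G:
  assumes "\<phi> \<in> cartier e" "y \<in> G s"
  shows "\<phi> y \<in> G (s div p ^ e - \<mu>)"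
proof -
  let ?q = "p ^ e" and ?k = "s div p ^ e - \<mu>"
  let ?J = "{y \<in> carrier R. \<forall>a\<in>carrier R. \<phi> (a \<otimes> y) \<in> G ?k}"
  have "G s \<subseteq> ?J"
  proof (rule G_least)
    show "ideal ?J R" by (rule cartier_ideal[OF assms(1) G_ideal])
    fix \<alpha> assume \<alpha>: "\<alpha> \<in> expo \<mu> s"
    define \<beta> \<gamma> where "\<beta> = (\<lambda>i. \<alpha> i div ?q)" and "\<gamma> = (\<lambda>i. \<alpha> i mod ?q)"
    have "\<alpha> = (\<lambda>i. ?q * \<beta> i + \<gamma> i)" unfolding \<beta>_def \<gamma>_def by simp
    then have m: "mon \<alpha> = mon \<beta> [^] ?q \<otimes> mon \<gamma>" by (metis mon_add mon_pow)
    have "s = (\<Sum>i<\<mu>. ?q * \<beta> i + \<gamma> i)" using \<alpha> unfolding expo_def edeg_def \<beta>_def \<gamma>_def by simp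
    also have "\<dots> = ?q * edeg \<mu> \<beta> + edeg \<mu> \<gamma>" unfolding edeg_def by (simp add: sum.distrib sum_distrib_left)
    also have "edeg \<mu> \<gamma> \<le> \<mu> * ?q" unfolding edeg_def
      using sum_bounded_above[of "{..<\<mu>}" \<gamma> ?q] unfolding \<gamma>_def by (simp add: less_imp_le)
    finally have "s \<le> ?q * (edeg \<mu> \<beta> + \<mu>)" by (simp add: algebra_simps)
    then have "s div ?q \<le> edeg \<mu> \<beta> + \<mu>" by (metis div_le_mono nonzero_mult_div_cancel_left q_gt_0 less_not_refl2)
    then have k: "?k \<le> edeg \<mu> \<beta>" by simp
    have "\<beta> \<in> expo \<mu> (edeg \<mu> \<beta>)" using \<alpha> unfolding expo_def \<beta>_def by auto
    then have mb: "mon \<beta> \<in> G ?k" using mon_in_G G_mono[OF k] by auto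
    have "\<phi> (a \<otimes> mon \<alpha>) \<in> G ?k" if a: "a \<in> carrier R" for a
    proof -
      have "a \<otimes> mon \<alpha> = mon \<beta> [^] ?q \<otimes> (a \<otimes> mon \<gamma>)" using a by (simp add: m m_ac)
      then have "\<phi> (a \<otimes> mon \<alpha>) = mon \<beta> \<otimes> \<phi> (a \<otimes> mon \<gamma>)" using cartierD(3)[OF assms(1)] a by simp
      then show ?thesis using mb cartierD(1)[OF assms(1)] a by (simp add: ideal_simps G_ideal)
    qed
    then show "mon \<alpha> \<in> ?J" by simp
  qed
  then have "\<phi> (\<one> \<otimes> y) \<in> G ?k" using assms(2) by auto
  then show ?thesis using subsetD[OF G_sub assms(2)] by simp
qed

text \<open>The order drops by a bounded amount, uniformly in \<open>d\<close>: applying \<open>\<phi>\<close> to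
  \<open>d f\<^bsup>q\<^esup> = (d f) f\<^bsup>q-1\<^esup>\<close> gives back \<open>f\<close>, and improves the known order of \<open>f\<close> as long as it is far from \<open>j\<close>.\<close>

lemma order_bound:
  assumes "\<phi> \<in> cartier e" "\<phi> d = \<one>" "d \<in> carrier R" "f \<in> carrier R" "d \<otimes> f \<in> G j"
  shows "f \<in> G (j - p ^ e * (\<mu> + 2))"
proof -
  let ?q = "p ^ e"
  have q: "?q > 0" by simp
  have "i \<le> j - ?q * (\<mu> + 2) \<Longrightarrow> f \<in> G i" for i
  proof (induct i)
    case 0
    then show ?case using G_0 assms(4) by simp
  next
    case (Suc i)
    then have fi: "f \<in> G i" by simp
    obtain k where k: "?q = Suc k" using q gr0_implies_Suc by blast
    have "f [^] ?q \<otimes> d = (d \<otimes> f) \<otimes> f [^] k" unfolding k using assms(3,4) by (simp add: m_ac)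
    then have "f [^] ?q \<otimes> d \<in> G (j + k * i)" using G_mult[OF assms(5) G_pow[OF fi, of k]] by simp
    then have "\<phi> (f [^] ?q \<otimes> d) \<in> G ((j + k * i) div ?q - \<mu>)" by (rule cartier_G[OF assms(1)])
    then have f: "f \<in> G ((j + k * i) div ?q - \<mu>)" using cartierD(3)[OF assms(1,4,3)] assms(2,4) by simp
    \<comment> \<open>This inequality amounts to i + q(\<mu>+2) \<le> j, whence the constant of the
      lemma. A quotient of at least i + \<mu> + 2 stays above i after the loss of \<mu> in
      \<open>cartier_G\<close>.\<close>
    have "?q * (i + \<mu> + 2) \<le> j + k * i" using Suc(2) unfolding k by (simp add: algebra_simps)
    then have "i + \<mu> + 2 \<le> (j + k * i) div ?q" using q by (simp add: less_eq_div_iff_mult_less_eq mult.commute)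
    then have "Suc i \<le> (j + k * i) div ?q - \<mu>" by simp
    then show ?case using f G_mono by blast
  qed
  then show ?thesis by simp
qed

end

section \<open>Linear growth of the non-splitting ideals\<close>

context char_p_local
begin

text \<open>These are the ideals \<open>I_e\<close>. An element f of R lies outside exactly when
  some p^-e-linear map takes the value 1 at f, that is, when \<open>F^e_*f\<close> spans a free
  summand.\<close>

definition nonsplit :: "nat \<Rightarrow> 'a set" where
  "nonsplit e = {f \<in> carrier R. \<forall>\<phi>\<in>cartier e. \<phi> f \<in> M}"

lemma nonsplit_ideal: "ideal (nonsplit e) R"
proof (rule cring_idealI)
  have "\<phi> \<zero> \<in> M" if "\<phi> \<in> cartier e" for \<phi>
    using cartierD(3)[OF that, of \<zero> \<zero>] cartierD(1)[OF that, of \<zero>] ideal_zeroD[OF M_ideal] by simp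
  then show "\<zero> \<in> nonsplit e" unfolding nonsplit_def by simp
next
  fix r a assume r: "r \<in> carrier R" and a: "a \<in> nonsplit e"
  have "\<phi> (r \<otimes> a) \<in> M" if "\<phi> \<in> cartier e" for \<phi>
    using cartier_premult[OF that r] a unfolding nonsplit_def by auto
  then show "r \<otimes> a \<in> nonsplit e" using r a unfolding nonsplit_def by auto
qed (auto simp: nonsplit_def cartierD(2) ideal_addD M_ideal)

lemmas nonsplit_sub = ideal_subD[OF nonsplit_ideal]

lemma nonsplit_unit:
  assumes "f \<in> carrier R" "f \<notin> nonsplit e"
  shows "\<exists>\<phi>\<in>cartier e. \<phi> f = \<one>"
proof -
  obtain \<phi> where \<phi>: "\<phi> \<in> cartier e" "\<phi> f \<notin> M" using assms unfolding nonsplit_def by auto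
  then have u: "\<phi> f \<in> Units R" using unit cartierD(1)[OF \<phi>(1) assms(1)] by auto
  have "(\<lambda>x. inv (\<phi> f) \<otimes> \<phi> x) \<in> cartier e" by (rule cartier_postmult[OF \<phi>(1)]) (use u in simp)
  then show ?thesis using u by (intro bexI[of _ "\<lambda>x. inv (\<phi> f) \<otimes> \<phi> x"]) auto
qed

lemma nonsplit_cartier:
  assumes "f \<in> nonsplit (Suc e)" "\<phi> \<in> cartier 1"
  shows "\<phi> f \<in> nonsplit e"
proof -
  have "f \<in> carrier R" using assms(1) unfolding nonsplit_def by simp
  moreover have "\<psi> (\<phi> f) \<in> M" if "\<psi> \<in> cartier e" for \<psi>
    using cartier_comp[OF that assms(2)] assms(1) unfolding nonsplit_def by auto
  ultimately show ?thesis using cartierD(1)[OF assms(2)] unfolding nonsplit_def by simp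
qed

end

text \<open>What the growth estimate uses of strong F-regularity: every power of c is split off at
  some level (\<open>c_pow\<close>). The condition \<open>c_root\<close> is the outcome of
  \<open>frob_coordinates\<close>, and \<open>\<sigma>\<close> splits Frobenius.\<close>

locale strongly_split_local = char_p_local R p x \<mu>
  for R :: "('a, 'b) ring_scheme" (structure) and p :: nat and x :: "nat \<Rightarrow> 'a" and \<mu> :: nat +
  fixes \<sigma> :: "'a \<Rightarrow> 'a" and c :: 'a
  assumes \<sigma>: "\<sigma> \<in> cartier 1" "\<sigma> \<one> = \<one>"
    and c: "c \<in> carrier R"
    and c_root: "\<And>J f. ideal J R \<Longrightarrow> f \<in> carrier R \<Longrightarrow> (\<And>\<phi>. \<phi> \<in> cartier 1 \<Longrightarrow> \<phi> f \<in> J)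
      \<Longrightarrow> c [^] p \<otimes> f \<in> Idl ((\<lambda>g. g [^] p) ` J)"
    and c_pow: "\<And>s::nat. \<exists>e. c [^] s \<notin> nonsplit e"
begin

text \<open>A map with value 1 at f on level e, followed by \<open>\<sigma>\<close>, has value 1 at
  f on level e + 1.\<close>

lemma nonsplit_Suc: "nonsplit (Suc e) \<subseteq> nonsplit e"
proof
  fix f assume f: "f \<in> nonsplit (Suc e)"
  then have fc: "f \<in> carrier R" unfolding nonsplit_def by simp
  show "f \<in> nonsplit e"
  proof (rule ccontr)
    assume "f \<notin> nonsplit e"
    then obtain \<phi> where "\<phi> \<in> cartier e" "\<phi> f = \<one>" using nonsplit_unit fc by blast
    moreover from this have "\<sigma> (\<phi> f) \<in> M" using cartier_comp[OF \<sigma>(1), of \<phi> e] f unfolding nonsplit_def by auto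
    ultimately show False using \<sigma>(2) proper by simp
  qed
qed

lemma nonsplit_antimono: "d \<le> e \<Longrightarrow> nonsplit e \<subseteq> nonsplit d"
  by (rule lift_Suc_antimono_le[of nonsplit]) (use nonsplit_Suc in auto)

text \<open>Every p^-1-linear map carries \<open>nonsplit (Suc e)\<close> into
  \<open>nonsplit e\<close>, which is the hypothesis of \<open>c_root\<close>.\<close>

lemma nonsplit_root: "f \<in> nonsplit (Suc e) \<Longrightarrow> c [^] p \<otimes> f \<in> Idl ((\<lambda>g. g [^] p) ` nonsplit e)"
  by (rule c_root[OF nonsplit_ideal subsetD[OF nonsplit_sub]]) (auto intro: nonsplit_cartier)

lemma nonsplit_step:
  assumes "\<psi> \<in> cartier d" "\<psi> (c [^] p) = \<one>" "nonsplit e \<subseteq> G N"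
  shows "nonsplit (Suc e) \<subseteq> G (p * N - p ^ d * (\<mu> + 2))"
proof
  fix f assume f: "f \<in> nonsplit (Suc e)"
  have "Idl ((\<lambda>g. g [^] p) ` nonsplit e) \<subseteq> G (p * N)"
    by (rule genideal_minimal[OF G_ideal]) (use assms(3) G_pow in auto)
  then have "c [^] p \<otimes> f \<in> G (p * N)" using nonsplit_root[OF f] by auto
  then show "f \<in> G (p * N - p ^ d * (\<mu> + 2))"
    using order_bound[OF assms(1,2)] c f nonsplit_sub by auto
qed

text \<open>The sets of leading exponents decrease with E, and only finitely many exponents have
  degree below n; in that range they reach their intersection.\<close>

lemma ex_stable_leads:
  "\<exists>E\<ge>e. \<forall>\<alpha>\<in>leads (nonsplit E). edeg \<mu> \<alpha> < n \<longrightarrow> \<alpha> \<in> (\<Inter>E. leads (nonsplit E))"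
proof -
  let ?\<Lambda> = "\<Inter>E. leads (nonsplit E)"
  have "finite B \<Longrightarrow> \<exists>E\<ge>e. \<forall>\<alpha>\<in>B. \<alpha> \<in> leads (nonsplit E) \<longrightarrow> \<alpha> \<in> ?\<Lambda>" for B
  proof (induct B rule: finite_induct)
    case (insert a B)
    then obtain E where E: "E \<ge> e" "\<forall>\<alpha>\<in>B. \<alpha> \<in> leads (nonsplit E) \<longrightarrow> \<alpha> \<in> ?\<Lambda>" by blast
    obtain E' where E': "a \<in> leads (nonsplit E') \<Longrightarrow> a \<in> ?\<Lambda>" by blast
    have "leads (nonsplit (max E E')) \<subseteq> leads (nonsplit E)" "leads (nonsplit (max E E')) \<subseteq> leads (nonsplit E')"
      by (simp_all add: leads_mono nonsplit_antimono)
    then show ?case using E E' by (intro exI[of _ "max E E'"]) auto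
  qed auto
  moreover have "finite (\<Union>d<n. expo \<mu> d)" using finite_expo by auto
  ultimately obtain E where "E \<ge> e" "\<forall>\<alpha>\<in>(\<Union>d<n. expo \<mu> d). \<alpha> \<in> leads (nonsplit E) \<longrightarrow> \<alpha> \<in> ?\<Lambda>" by blast
  moreover have "\<alpha> \<in> expo \<mu> (edeg \<mu> \<alpha>)" if "\<alpha> \<in> leads J" for \<alpha> J
    using that unfolding leads_def expo_def by auto
  ultimately show ?thesis by (intro exI[of _ E]) blast
qed

text \<open>A replacement for Chevalley's theorem that avoids completions. By Dickson's lemma a number
  \<open>k\<close> of elements, independent of \<open>n\<close>, generates \<open>L = nonsplit E\<close> modulo order \<open>n\<close>. Elimination on
  \<open>c\<^bsup>p\<^esup> L \<subseteq> L\<^sup>2\<close> gives \<open>d\<close> with \<open>d L\<close> of order \<open>n\<close> and \<open>d\<close> congruent modulo \<open>L\<close> to a power of \<open>c\<close>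
  depending only on \<open>k\<close>; so \<open>d\<close> can be split off at a fixed level, and \<open>order_bound\<close> applies.\<close>

lemma nonsplit_deep: "\<exists>E. nonsplit E \<subseteq> G n0"
proof -
  let ?\<Lambda> = "\<Inter>E. leads (nonsplit E)"
  have "\<exists>F. finite F \<and> F \<subseteq> ?\<Lambda> \<and> (\<forall>\<alpha>\<in>?\<Lambda>. \<exists>\<beta>\<in>F. \<beta> \<le> \<alpha>)"
    by (rule dickson[of _ \<mu>]) (simp add: leads_def)
  then obtain F where F: "finite F" "F \<subseteq> ?\<Lambda>" "\<forall>\<alpha>\<in>?\<Lambda>. \<exists>\<beta>\<in>F. \<beta> \<le> \<alpha>"
    by (elim exE conjE)
  obtain as where as: "set as = F" using finite_list[OF F(1)] by blast
  \<comment> \<open>The exponent that \<open>elimination\<close> produces from c^p for this number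
    of generators. It depends on F alone, so the level e can be fixed before n and E.\<close>
  define S where "S = p * (2 ^ length as - 1)"
  obtain e where e: "c [^] S \<notin> nonsplit e" using c_pow by blast
  \<comment> \<open>The excess over n0 is the loss in \<open>order_bound\<close> at level e.\<close>
  define n where "n = n0 + p ^ e * (\<mu> + 2)"
  obtain E where E: "E \<ge> e" "\<forall>\<alpha>\<in>leads (nonsplit E). edeg \<mu> \<alpha> < n \<longrightarrow> \<alpha> \<in> ?\<Lambda>"
    using ex_stable_leads by blast
  define L where "L = nonsplit E"
  have L: "ideal L R" "L \<subseteq> nonsplit e" "nonsplit (Suc E) \<subseteq> L"
    unfolding L_def using nonsplit_ideal nonsplit_antimono[OF E(1)] nonsplit_Suc by auto
  note Lc = ideal_subD[OF L(1)]
  \<comment> \<open>The witnesses are taken one level deeper than L, so that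
    \<open>nonsplit_root\<close> puts their multiples by c^p into the Frobenius power of L.\<close>
  have "\<forall>\<alpha>\<in>F. \<exists>f. f \<in> nonsplit (Suc E) \<and> f \<ominus> mon \<alpha> \<in> above \<alpha>"
  proof
    fix \<alpha> assume "\<alpha> \<in> F"
    then have "\<alpha> \<in> leads (nonsplit (Suc E))" using F(2) by (meson INT_D UNIV_I subsetD)
    then show "\<exists>f. f \<in> nonsplit (Suc E) \<and> f \<ominus> mon \<alpha> \<in> above \<alpha>" unfolding leads_def by (simp add: Bex_def)
  qed
  from bchoice[OF this] obtain h where
    h: "\<And>\<alpha>. \<alpha> \<in> F \<Longrightarrow> h \<alpha> \<in> nonsplit (Suc E)" "\<And>\<alpha>. \<alpha> \<in> F \<Longrightarrow> h \<alpha> \<ominus> mon \<alpha> \<in> above \<alpha>" by blast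
  define fs where "fs = map h as"
  have set_fs: "set fs = h ` F" unfolding fs_def by (simp add: as)
  have fsL: "set fs \<subseteq> nonsplit (Suc E)" using h(1) set_fs by auto
  then have fsc: "set fs \<subseteq> carrier R" using nonsplit_sub by blast
  define J where "J = Idl (set fs)"
  have J: "ideal J R" unfolding J_def by (rule genideal_ideal[OF fsc])
  have JL: "J \<subseteq> L" unfolding J_def by (rule genideal_minimal[OF L(1)]) (use fsL L(3) in blast)
  have lead: "\<alpha> \<in> leads J" if "\<alpha> \<in> leads L" "edeg \<mu> \<alpha> < n" for \<alpha>
  proof -
    have "\<alpha> \<in> ?\<Lambda>" using bspec[OF E(2), of \<alpha>] that unfolding L_def by simp
    then obtain \<beta> where \<beta>: "\<beta> \<in> F" "\<beta> \<le> \<alpha>" using bspec[OF F(3)] by blast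
    have "\<beta> \<in> leads (nonsplit E)" using \<beta>(1) F(2) by (meson INT_D UNIV_I subsetD)
    then have "\<forall>i\<ge>\<mu>. \<beta> i = 0" unfolding leads_def by simp
    moreover have "h \<beta> \<in> J" unfolding J_def using genideal_self[OF fsc] \<beta>(1) set_fs by auto
    ultimately have "\<beta> \<in> leads J" using h(2)[OF \<beta>(1)] unfolding leads_def by auto
    then have "(\<lambda>i. (\<alpha> i - \<beta> i) + \<beta> i) \<in> leads J"
      by (rule leads_mult[OF J]) (use that(1) in \<open>auto simp: leads_def\<close>)
    moreover have "(\<lambda>i. (\<alpha> i - \<beta> i) + \<beta> i) = \<alpha>" using \<beta>(2) by (auto simp: le_fun_def)
    ultimately show ?thesis by simp
  qed
  have split: "\<exists>j w. j \<in> J \<and> w \<in> G n \<and> g = j \<oplus> w" if "g \<in> L" for g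
  proof -
    obtain j where j: "j \<in> J" "g \<ominus> j \<in> G n" using leads_division[OF L(1) J JL lead \<open>g \<in> L\<close>] by blast
    have "g \<in> carrier R" "j \<in> carrier R" using that Lc j(1) JL by auto
    then have "g = j \<oplus> (g \<ominus> j)" by (simp add: minus_eq a_lcomm[of j g] r_neg)
    then show ?thesis using j by blast
  qed
  have E_ideal: "ideal (elim_set L (G n) fs) R" by (rule elim_set_ideal[OF L(1) G_ideal fsc])
  have LJ: "l \<otimes> j \<in> elim_set L (G n) fs" if "l \<in> L" "j \<in> J" for l j
  proof -
    have "J \<subseteq> {y \<in> carrier R. \<forall>l\<in>L. l \<otimes> y \<in> elim_set L (G n) fs}" unfolding J_def
      by (rule genideal_minimal[OF ideal_colon[OF E_ideal Lc]])
        (use fsc elim_set_gen(1)[OF L(1) G_ideal fsc] in auto)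
    then show ?thesis using that by blast
  qed
  \<comment> \<open>Since p \<ge> 2, the factor g^(p-1) is still in L, and g^p lies in L(J + G n),
    which is inside the span used by \<open>elimination\<close>.\<close>
  obtain k where k: "p = Suc (Suc k)" using le_Suc_ex[OF p_ge_2] by auto
  have roots: "Idl ((\<lambda>g. g [^] p) ` L) \<subseteq> elim_set L (G n) fs"
  proof (rule genideal_minimal[OF E_ideal], clarify)
    fix g assume g: "g \<in> L"
    then obtain j w where jw: "j \<in> J" "w \<in> G n" "g = j \<oplus> w" using split by blast
    have car: "g \<in> carrier R" "j \<in> carrier R" "w \<in> carrier R" using g Lc jw JL G_sub by auto
    define l where "l = g [^] Suc k"
    have l: "l \<in> L" "l \<in> carrier R" unfolding l_def using g car(1) ideal.I_l_closed[OF L(1)] by auto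
    have "g [^] p = l \<otimes> g" unfolding k l_def by simp
    also have "\<dots> = l \<otimes> j \<oplus> l \<otimes> w" unfolding jw(3) using l car by (simp add: r_distr)
    finally have eq: "g [^] p = l \<otimes> j \<oplus> l \<otimes> w" .
    have "l \<otimes> w \<in> elim_set L (G n) fs"
      using elim_set_gen(2)[OF L(1) G_ideal fsc l(1), of n] ideal.I_l_closed[OF G_ideal jw(2) l(2)] by blast
    then show "g [^] p \<in> elim_set L (G n) fs" unfolding eq using LJ[OF l(1) jw(1)] ideal_addD[OF E_ideal] by blast
  qed
  have "\<exists>d\<in>carrier R. d \<ominus> c [^] (p * (2 ^ length fs - 1)) \<in> L \<and> (\<forall>f\<in>set fs. d \<otimes> f \<in> G n)"
  proof (rule elimination[OF L(1) G_ideal c fsc, of "c [^] p"])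
    show "c [^] p \<ominus> c [^] p \<in> L" using c ideal_zeroD[OF L(1)] by (simp add: minus_eq r_neg)
    show "c [^] p \<otimes> f \<in> elim_set L (G n) fs" if "f \<in> set fs" for f
      using nonsplit_root[of f E] that fsL roots unfolding L_def by blast
  qed (use c in simp)
  then obtain d where d: "d \<in> carrier R" "d \<ominus> c [^] S \<in> L" "\<forall>f\<in>set fs. d \<otimes> f \<in> G n"
    unfolding S_def fs_def by auto
  \<comment> \<open>d differs from c^S by an element of L, and L is inside
    \<open>nonsplit e\<close>, which does not contain c^S.\<close>
  have "d \<notin> nonsplit e"
  proof
    assume "d \<in> nonsplit e"
    then have "d \<ominus> (d \<ominus> c [^] S) \<in> nonsplit e" using d(2) L(2) ideal_minusD[OF nonsplit_ideal] by blast
    moreover have "d \<ominus> (d \<ominus> c [^] S) = c [^] S"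
    proof -
      have "c [^] S \<in> carrier R" using c by simp
      then show ?thesis using d(1) by algebra
    qed
    ultimately show False using e by simp
  qed
  then obtain \<psi> where \<psi>: "\<psi> \<in> cartier e" "\<psi> d = \<one>" using nonsplit_unit d(1) by blast
  have dJ: "d \<otimes> j \<in> G n" if "j \<in> J" for j
  proof -
    have "J \<subseteq> {y \<in> carrier R. \<forall>s\<in>{d}. s \<otimes> y \<in> G n}" unfolding J_def
      by (rule genideal_minimal[OF ideal_colon[OF G_ideal]]) (use d fsc in auto)
    then show ?thesis using that by blast
  qed
  have "g \<in> G n0" if g: "g \<in> L" for g
  proof -
    obtain j w where jw: "j \<in> J" "w \<in> G n" "g = j \<oplus> w" using split g by blast
    have car: "j \<in> carrier R" "w \<in> carrier R" using jw JL Lc G_sub by auto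
    have "d \<otimes> g = d \<otimes> j \<oplus> d \<otimes> w" using jw(3) car d(1) by (simp add: r_distr)
    then have "d \<otimes> g \<in> G n"
      using dJ[OF jw(1)] ideal.I_l_closed[OF G_ideal jw(2) d(1)] ideal_addD[OF G_ideal] by simp
    then have "g \<in> G (n - p ^ e * (\<mu> + 2))" using order_bound[OF \<psi> d(1)] g Lc by blast
    then show ?thesis unfolding n_def by simp
  qed
  then show ?thesis unfolding L_def by blast
qed

theorem nonsplit_linear: "\<exists>e. \<forall>k. nonsplit (e + k) \<subseteq> G (p ^ k)"
proof -
  obtain d where "c [^] p \<notin> nonsplit d" using c_pow by blast
  then obtain \<psi> where \<psi>: "\<psi> \<in> cartier d" "\<psi> (c [^] p) = \<one>" using nonsplit_unit c by blast
  define b where "b = p ^ d * (\<mu> + 2)"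
  obtain e where e: "nonsplit e \<subseteq> G (1 + b)" using nonsplit_deep by blast
  have "nonsplit (e + k) \<subseteq> G (p ^ k + b)" for k
  proof (induct k)
    case (Suc k)
    \<comment> \<open>The surplus b kept in the induction pays for the loss b of the next step:
      p(p^k + b) - b \<ge> p^(k+1) + b, because p \<ge> 2.\<close>
    have "2 * b \<le> p * b" using p_ge_2 by simp
    then have "p ^ Suc k + 2 * b \<le> p * (p ^ k + b)" by (simp add: distrib_left)
    then have "p ^ Suc k + b \<le> p * (p ^ k + b) - b" by linarith
    then have "G (p * (p ^ k + b) - b) \<subseteq> G (p ^ Suc k + b)" by (rule G_mono)
    moreover have "nonsplit (e + Suc k) \<subseteq> G (p * (p ^ k + b) - b)"
      using nonsplit_step[OF \<psi> Suc] by (simp add: b_def)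
    ultimately show ?case by blast
  qed (use e in simp)
  moreover have "G (p ^ k + b) \<subseteq> G (p ^ k)" for k by (rule G_mono) simp
  ultimately show ?thesis by blast
qed

end

section \<open>F-finite rings\<close>

lemma (in abelian_monoid) finsum_mem:
  assumes "finite B" "\<And>b. b \<in> B \<Longrightarrow> f b \<in> carrier G" "\<And>b. b \<in> B \<Longrightarrow> f b \<in> S"
    and "\<zero> \<in> S" "\<And>x y. x \<in> S \<Longrightarrow> y \<in> S \<Longrightarrow> x \<oplus> y \<in> S"
  shows "finsum G f B \<in> S"
  using assms(1-3)
proof (induct B rule: finite_induct)
  case (insert b B)
  then have "finsum G f (insert b B) = f b \<oplus> finsum G f B" by (intro finsum_insert) auto
  then show ?case using insert assms(5) by auto
qed (use assms(4) in simp)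

lemma finsum_frob: "finsum (frob R p e) f A = finsum R f A"
  unfolding finsum_def finprod_def frob_def by simp

context char_p_cring
begin

lemma zero_pow_q [simp]: "\<zero> [^] (p ^ e) = \<zero>" and zero_pow_p [simp]: "\<zero> [^] p = \<zero>"
  using q_gt_0[of e] p_gt_0 by (auto simp: nat_pow_zero)

text \<open>The elements \<open>F\<^sup>e\<^sub>*a\<close> with \<open>a \<in> A\<close> generate \<open>F\<^sup>e\<^sub>*R\<close>, stated as an induction principle.\<close>

definition frob_gen :: "nat \<Rightarrow> 'a set \<Rightarrow> bool" where
  "frob_gen e A \<longleftrightarrow> finite A \<and> A \<subseteq> carrier R \<and>
     (\<forall>S. \<zero> \<in> S \<longrightarrow> (\<forall>c\<in>carrier R. \<forall>a\<in>A. c [^] (p ^ e) \<otimes> a \<in> S) \<longrightarrow>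
        (\<forall>x\<in>S. \<forall>y\<in>S. x \<oplus> y \<in> S) \<longrightarrow> carrier R \<subseteq> S)"

lemma frob_gen_induct [consumes 2, case_names zero gen add]:
  assumes "frob_gen e A" "x \<in> carrier R"
    and "P \<zero>" "\<And>c a. c \<in> carrier R \<Longrightarrow> a \<in> A \<Longrightarrow> P (c [^] (p ^ e) \<otimes> a)"
    and "\<And>x y. x \<in> carrier R \<Longrightarrow> y \<in> carrier R \<Longrightarrow> P x \<Longrightarrow> P y \<Longrightarrow> P (x \<oplus> y)"
  shows "P x"
proof -
  have "carrier R \<subseteq> {x \<in> carrier R. P x}"
    using assms(1) unfolding frob_gen_def
    by (elim conjE allE[of _ "{x \<in> carrier R. P x}"] impE) (use assms(3-5) in auto)
  then show ?thesis using assms(2) by blast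
qed

lemma frob_genD: "frob_gen e A \<Longrightarrow> finite A" "frob_gen e A \<Longrightarrow> A \<subseteq> carrier R"
  unfolding frob_gen_def by auto

lemma F_finite_iff: "F_finite R p \<longleftrightarrow> (\<exists>A. frob_gen 1 A)"
proof
  assume "F_finite R p"
  then obtain A where A: "finite A" "A \<subseteq> carrier R"
    "\<And>x. x \<in> carrier R \<Longrightarrow> \<exists>c\<in>A \<rightarrow> carrier R. x = (\<Oplus>a\<in>A. c a [^] (p ^ 1) \<otimes> a)"
    unfolding F_finite_def finitely_generated_def finsum_frob by (auto simp: frob_def)
  have "frob_gen 1 A" unfolding frob_gen_def
  proof (intro conjI allI impI subsetI)
    fix S x assume S: "\<zero> \<in> S" "\<forall>c\<in>carrier R. \<forall>a\<in>A. c [^] (p ^ 1) \<otimes> a \<in> S" "\<forall>x\<in>S. \<forall>y\<in>S. x \<oplus> y \<in> S"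
      and "x \<in> carrier R"
    then obtain c where c: "c \<in> A \<rightarrow> carrier R" "x = (\<Oplus>a\<in>A. c a [^] (p ^ 1) \<otimes> a)" using A(3) by blast
    show "x \<in> S" unfolding c(2) by (rule finsum_mem[OF A(1)]) (use c(1) A(2) S in auto)
  qed (use A in auto)
  then show "\<exists>A. frob_gen 1 A" by blast
next
  assume "\<exists>A. frob_gen 1 A"
  then obtain A where A: "frob_gen 1 A" by blast
  note fin = frob_genD(1)[OF A] and sub = frob_genD(2)[OF A]
  have "\<exists>c\<in>A \<rightarrow> carrier R. x = (\<Oplus>a\<in>A. c a [^] p \<otimes> a)" if "x \<in> carrier R" for x
    using A that
  proof (induct x rule: frob_gen_induct)
    case zero
    have "(\<Oplus>a\<in>A. \<zero> [^] p \<otimes> a) = \<zero>" using sub by (intro add.finprod_one_eqI) auto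
    then show ?case by (intro bexI[of _ "\<lambda>_. \<zero>"]) auto
  next
    case (gen c a)
    have "(\<Oplus>b\<in>A. (if a = b then c else \<zero>) [^] p \<otimes> b) = (\<Oplus>b\<in>A. if a = b then c [^] p \<otimes> b else \<zero>)"
      using sub gen by (intro finsum_cong') auto
    also have "\<dots> = c [^] p \<otimes> a" using sub gen fin by (intro finsum_singleton) auto
    finally show ?case using gen by (intro bexI[of _ "\<lambda>b. if a = b then c else \<zero>"]) auto
  next
    case (add x y)
    then obtain c d where cd: "c \<in> A \<rightarrow> carrier R" "x = (\<Oplus>a\<in>A. c a [^] p \<otimes> a)"
      "d \<in> A \<rightarrow> carrier R" "y = (\<Oplus>a\<in>A. d a [^] p \<otimes> a)" by blast
    have "x \<oplus> y = (\<Oplus>a\<in>A. c a [^] p \<otimes> a \<oplus> d a [^] p \<otimes> a)"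
      unfolding cd using cd(1,3) sub by (intro finsum_addf[symmetric]) auto
    also have "\<dots> = (\<Oplus>a\<in>A. (c a \<oplus> d a) [^] p \<otimes> a)"
      using cd(1,3) sub by (intro finsum_cong') (auto simp: frobenius_add1 l_distr Pi_iff subset_iff)
    finally show ?case using cd by (intro bexI[of _ "\<lambda>a. c a \<oplus> d a"]) auto
  qed
  then show "F_finite R p" using fin sub
    unfolding F_finite_def finitely_generated_def finsum_frob by (auto simp: frob_def intro!: exI[of _ A])
qed

text \<open>Expanding the coefficients c of x = sum c^p a over generators b of F^e_*R gives the
  generators b^p a of the next level.\<close>

lemma frob_gen_power:
  assumes "frob_gen 1 A"
  shows "\<exists>B. frob_gen e B"
proof (induct e)
  case 0
  have "carrier R \<subseteq> S" if "\<forall>c\<in>carrier R. c \<otimes> \<one> \<in> S" for S using that by auto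
  then show ?case unfolding frob_gen_def by (intro exI[of _ "{\<one>}"]) auto
next
  case (Suc e)
  then obtain B where B: "frob_gen e B" by blast
  note Bc = frob_genD(2)[OF B] and Ac = frob_genD(2)[OF assms]
  let ?C = "(\<lambda>(a, b). b [^] p \<otimes> a) ` (A \<times> B)"
  have "carrier R \<subseteq> S" if S: "\<zero> \<in> S" "\<forall>c\<in>carrier R. \<forall>a\<in>?C. c [^] (p ^ Suc e) \<otimes> a \<in> S" "\<forall>x\<in>S. \<forall>y\<in>S. x \<oplus> y \<in> S" for S
  proof
    fix x assume "x \<in> carrier R"
    show "x \<in> S" using assms \<open>x \<in> carrier R\<close>
    proof (induct x rule: frob_gen_induct)
      case (gen c a)
      have ac: "a \<in> carrier R" using gen Ac by auto
      have "c [^] p \<otimes> a \<in> S" using B gen(1)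
      proof (induct c rule: frob_gen_induct)
        case (gen d b)
        have bc: "b \<in> carrier R" using gen Bc by auto
        have "(d [^] (p ^ e) \<otimes> b) [^] p \<otimes> a = d [^] (p ^ Suc e) \<otimes> (b [^] p \<otimes> a)"
          using gen(1) bc ac by (simp add: nat_pow_distrib nat_pow_pow m_assoc mult.commute)
        then show ?case using S(2) gen \<open>a \<in> A\<close> by auto
      qed (use S ac in \<open>auto simp: frobenius_add1 l_distr\<close>)
      then show ?case by simp
    qed (use S in auto)
  qed
  moreover have "finite ?C" using frob_genD(1)[OF B] frob_genD(1)[OF assms] by simp
  moreover have "?C \<subseteq> carrier R" using Ac Bc by auto
  ultimately show ?case unfolding frob_gen_def by blast
qed

text \<open>R is generated by A as a ring over its p^e-th powers. If S contains all p^(e+1)-th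
  powers, raising r = sum c^p a to the power p^e shows that S contains all p^e-th powers; descend to
  e = 0.\<close>

lemma frob_gen_subring:
  assumes A: "frob_gen 1 A" "A \<subseteq> S" and S: "S \<subseteq> carrier R"
    and add: "\<And>x y. x \<in> S \<Longrightarrow> y \<in> S \<Longrightarrow> x \<oplus> y \<in> S" and mult: "\<And>x y. x \<in> S \<Longrightarrow> y \<in> S \<Longrightarrow> x \<otimes> y \<in> S"
    and pow: "\<And>r. r \<in> carrier R \<Longrightarrow> r [^] (p ^ e) \<in> S"
  shows "S = carrier R"
  using pow
proof (induct e)
  case 0
  then show ?case using S by auto
next
  case (Suc e)
  have zero: "\<zero> \<in> S" using Suc(2)[of \<zero>] zero_pow_q[of "Suc e"] by (simp del: power_Suc)
  have one: "\<one> \<in> S" using Suc(2)[of \<one>] by simp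
  have "r [^] (p ^ e) \<in> S" if "r \<in> carrier R" for r
    using A(1) that
  proof (induct r rule: frob_gen_induct)
    case (gen c a)
    have a: "a \<in> carrier R" "a \<in> S" using gen A(2) S by auto
    have "a [^] (k::nat) \<in> S" for k by (induct k) (use a one mult in auto)
    moreover have "(c [^] (p ^ 1) \<otimes> a) [^] (p ^ e) = c [^] (p ^ Suc e) \<otimes> a [^] (p ^ e)"
      using a gen by (simp add: nat_pow_distrib nat_pow_pow)
    ultimately show ?case using mult Suc(2) gen(1) by (simp del: power_Suc)
  qed (use zero add in \<open>auto simp: frobenius_add\<close>)
  then show ?case by (rule Suc(1))
qed

text \<open>Deduced from additivity of Frobenius, which treats p = 2 and odd p alike.\<close>

lemma neg_pow_p:
  assumes "r \<in> carrier R"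
  shows "(\<ominus> r) [^] p = \<ominus> (r [^] p)"
proof -
  have "(\<ominus> r) [^] p \<oplus> r [^] p = (\<ominus> r \<oplus> r) [^] p" using assms by (simp add: frobenius_add1)
  also have "\<dots> = \<zero>" using assms by (simp add: l_neg)
  finally show ?thesis using assms by (intro minus_equality[symmetric]) auto
qed

text \<open>A maximal linearly independent set of generators of \<open>F\<^sub>*R\<close> spans a free module containing
  \<open>c F\<^sub>*R\<close>; its coordinates are \<open>p\<close>-inverse-linear maps.\<close>

lemma frob_coordinates:
  assumes dom: "domain R" and A: "frob_gen 1 A"
  shows "\<exists>c\<in>carrier R - {\<zero>}. \<forall>J f. f \<in> carrier R \<longrightarrow> J \<subseteq> carrier R \<longrightarrow> (\<forall>\<phi>\<in>cartier 1. \<phi> f \<in> J) \<longrightarrow>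
    c [^] p \<otimes> f \<in> Idl ((\<lambda>g. g [^] p) ` J)"
proof -
  interpret domain R by (rule dom)
  note fin = frob_genD(1)[OF A] and sub = frob_genD(2)[OF A]
  define lc where "lc = (\<lambda>B r. (\<Oplus>b\<in>B. r b [^] p \<otimes> b))"
  define indep where "indep = (\<lambda>B. \<forall>r\<in>B \<rightarrow> carrier R. lc B r = \<zero> \<longrightarrow> (\<forall>b\<in>B. r b = \<zero>))"
  have "\<exists>B. (B \<subseteq> A \<and> indep B) \<and> (\<forall>C. C \<subseteq> A \<and> indep C \<longrightarrow> card C \<le> card B)"
  proof -
    let ?P = "\<lambda>B. B \<subseteq> A \<and> indep B"
    have "?P {}" unfolding indep_def by simp
    moreover have "\<forall>B. ?P B \<longrightarrow> card B < Suc (card A)" using card_mono[OF fin] by (simp add: less_Suc_eq_le)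
    ultimately show ?thesis by (rule ex_has_greatest_nat)
  qed
  then obtain B where B: "B \<subseteq> A" "indep B" "\<And>C. C \<subseteq> A \<Longrightarrow> indep C \<Longrightarrow> card C \<le> card B" by blast
  have finB: "finite B" and Bc: "B \<subseteq> carrier R" using B(1) fin sub finite_subset by auto
  have lcc: "lc B r \<in> carrier R" if "r \<in> B \<rightarrow> carrier R" for r
    unfolding lc_def using that Bc by (intro finsum_closed) auto
  have lc_add: "lc B (\<lambda>b. r b \<oplus> s b) = lc B r \<oplus> lc B s" if "r \<in> B \<rightarrow> carrier R" "s \<in> B \<rightarrow> carrier R" for r s
  proof -
    have "lc B (\<lambda>b. r b \<oplus> s b) = (\<Oplus>b\<in>B. r b [^] p \<otimes> b \<oplus> s b [^] p \<otimes> b)" unfolding lc_def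
      using that Bc by (intro finsum_cong') (auto simp: frobenius_add1 l_distr Pi_iff subset_iff)
    also have "\<dots> = lc B r \<oplus> lc B s" unfolding lc_def using that Bc by (intro finsum_addf) auto
    finally show ?thesis .
  qed
  have lc_mult: "lc B (\<lambda>b. a \<otimes> r b) = a [^] p \<otimes> lc B r" if "r \<in> B \<rightarrow> carrier R" "a \<in> carrier R" for r a
  proof -
    have "lc B (\<lambda>b. a \<otimes> r b) = (\<Oplus>b\<in>B. a [^] p \<otimes> (r b [^] p \<otimes> b))" unfolding lc_def
      using that Bc by (intro finsum_cong') (auto simp: nat_pow_distrib m_assoc Pi_iff subset_iff)
    also have "\<dots> = a [^] p \<otimes> lc B r" unfolding lc_def
      using that Bc finB by (intro finsum_rdistr[symmetric]) auto
    finally show ?thesis .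
  qed
  let ?span = "\<lambda>x. \<exists>r\<in>B \<rightarrow> carrier R. x = lc B r"
  have span_mult: "?span (a [^] p \<otimes> x)" if "?span x" "a \<in> carrier R" for a x
  proof -
    from that(1) obtain r where r: "r \<in> B \<rightarrow> carrier R" "x = lc B r" by (elim bexE)
    show ?thesis
    proof (rule bexI)
      show "a [^] p \<otimes> x = lc B (\<lambda>b. a \<otimes> r b)" using lc_mult[OF r(1) that(2)] r(2) by simp
      show "(\<lambda>b. a \<otimes> r b) \<in> B \<rightarrow> carrier R" using r(1) that(2) by auto
    qed
  qed
  have span1: "\<exists>c\<in>carrier R - {\<zero>}. ?span (c [^] p \<otimes> a)" if a: "a \<in> A" for a
  proof (cases "a \<in> B")
    case True
    let ?r = "\<lambda>b. if a = b then \<one> else \<zero>"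
    have "lc B ?r = (\<Oplus>b\<in>B. if a = b then b else \<zero>)" unfolding lc_def
      using Bc by (intro finsum_cong') auto
    also have "\<dots> = a" using Bc finB True by (intro finsum_singleton) auto
    finally have "\<one> [^] p \<otimes> a = lc B ?r" using a sub by auto
    then show ?thesis by (intro bexI[of _ \<one>] bexI[of _ ?r]) auto
  next
    case False
    have ac: "a \<in> carrier R" using a sub by auto
    \<comment> \<open>Maximality gives a relation on \<open>insert a B\<close>. Independence of B
      forces its coefficient \<open>r a\<close> to be nonzero, so \<open>r a\<close> serves as a
      denominator for a.\<close>
    have "\<not> indep (insert a B)" using B(3)[of "insert a B"] B(1) a False finB by auto
    then obtain r where r: "r \<in> insert a B \<rightarrow> carrier R" "lc (insert a B) r = \<zero>" "\<exists>b\<in>insert a B. r b \<noteq> \<zero>"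
      unfolding indep_def by blast
    have rB: "r \<in> B \<rightarrow> carrier R" and ra: "r a \<in> carrier R" using r(1) by auto
    have "lc (insert a B) r = r a [^] p \<otimes> a \<oplus> lc B r" unfolding lc_def
      using finB False ra rB ac Bc by (intro finsum_insert) auto
    then have eq: "r a [^] p \<otimes> a \<oplus> lc B r = \<zero>" using r(2) by simp
    have "r a \<noteq> \<zero>"
    proof
      assume "r a = \<zero>"
      then have "lc B r = \<zero>" using eq ac lcc[OF rB] by simp
      then show False using B(2) rB r(3) \<open>r a = \<zero>\<close> unfolding indep_def by auto
    qed
    moreover have "r a [^] p \<otimes> a = lc B (\<lambda>b. \<ominus> r b)"
    proof -
      have "lc B (\<lambda>b. \<ominus> r b) \<oplus> lc B r = lc B (\<lambda>b. \<ominus> r b \<oplus> r b)" using rB by (subst lc_add) auto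
      also have "\<dots> = \<zero>" unfolding lc_def using rB Bc by (intro add.finprod_one_eqI) (auto simp: l_neg Pi_iff subset_iff)
      finally have "lc B (\<lambda>b. \<ominus> r b) \<oplus> lc B r = \<zero>" .
      moreover have "lc B (\<lambda>b. \<ominus> r b) \<in> carrier R" using rB by (intro lcc) auto
      ultimately show ?thesis using eq ra ac lcc[OF rB]
        by (metis (no_types, lifting) add.right_cancel m_closed nat_pow_closed)
    qed
    ultimately show ?thesis using ra rB by (intro bexI[of _ "r a"] bexI[of _ "\<lambda>b. \<ominus> r b"]) auto
  qed
  \<comment> \<open>The product of the finitely many denominators is nonzero in a domain and serves
    all generators at once.\<close>
  have "C \<subseteq> A \<Longrightarrow> \<exists>c\<in>carrier R - {\<zero>}. \<forall>a\<in>C. ?span (c [^] p \<otimes> a)" if "finite C" for C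
    using that
  proof (induct C rule: finite_induct)
    case empty
    show ?case by (intro bexI[of _ \<one>]) auto
  next
    case (insert a C)
    then obtain c where c: "c \<in> carrier R" "c \<noteq> \<zero>" "\<And>a. a \<in> C \<Longrightarrow> ?span (c [^] p \<otimes> a)" by blast
    obtain d where d: "d \<in> carrier R" "d \<noteq> \<zero>" "?span (d [^] p \<otimes> a)" using span1[of a] insert by blast
    have "?span ((c \<otimes> d) [^] p \<otimes> b)" if "b \<in> insert a C" for b
    proof -
      have b: "b \<in> carrier R" using that insert sub by auto
      have "(c \<otimes> d) [^] p \<otimes> b = c [^] p \<otimes> (d [^] p \<otimes> b)" "(c \<otimes> d) [^] p \<otimes> b = d [^] p \<otimes> (c [^] p \<otimes> b)"
        using b c(1) d(1) by (simp_all add: nat_pow_distrib m_ac)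
      moreover have "?span (c [^] p \<otimes> (d [^] p \<otimes> b))" if "b = a" using span_mult[OF d(3) c(1)] that by simp
      moreover have "?span (d [^] p \<otimes> (c [^] p \<otimes> b))" if "b \<in> C" using span_mult[OF c(3)[OF that] d(1)] .
      ultimately show ?thesis using that by (cases "b = a") auto
    qed
    moreover have "c \<otimes> d \<in> carrier R - {\<zero>}" using c(1,2) d(1,2) integral[of c d] by auto
    ultimately show ?case by (intro bexI[of _ "c \<otimes> d"] ballI)
  qed
  from this[OF fin subset_refl] obtain c where cA: "c \<in> carrier R - {\<zero>}" "\<forall>a\<in>A. ?span (c [^] p \<otimes> a)"
    by (elim bexE)
  have c: "c \<in> carrier R" "c \<noteq> \<zero>" using cA(1) by auto
  have ex: "?span (c [^] p \<otimes> x)" if "x \<in> carrier R" for x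
    using A that
  proof (induct x rule: frob_gen_induct)
    case zero
    have "lc B (\<lambda>_. \<zero>) = \<zero>" unfolding lc_def using Bc by (intro add.finprod_one_eqI) auto
    then show ?case using c(1) by (intro bexI[of _ "\<lambda>_. \<zero>"]) auto
  next
    case (gen d a)
    have "c [^] p \<otimes> (d [^] (p ^ 1) \<otimes> a) = d [^] p \<otimes> (c [^] p \<otimes> a)" using gen c(1) sub by (auto simp: m_lcomm subset_iff)
    then show ?case using span_mult[OF bspec[OF cA(2) gen(2)] gen(1)] by simp
  next
    case (add x y)
    then obtain r s where "r \<in> B \<rightarrow> carrier R" "c [^] p \<otimes> x = lc B r" "s \<in> B \<rightarrow> carrier R" "c [^] p \<otimes> y = lc B s" by blast
    then have "c [^] p \<otimes> (x \<oplus> y) = lc B (\<lambda>b. r b \<oplus> s b)" using c(1) add lc_add by (simp add: r_distr)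
    then show ?case using \<open>r \<in> B \<rightarrow> carrier R\<close> \<open>s \<in> B \<rightarrow> carrier R\<close> by (intro bexI[of _ "\<lambda>b. r b \<oplus> s b"]) auto
  qed
  have uniq: "r b = s b" if "r \<in> B \<rightarrow> carrier R" "s \<in> B \<rightarrow> carrier R" "lc B r = lc B s" "b \<in> B" for r s b
  proof -
    have neg: "(\<lambda>b. \<ominus> s b) \<in> B \<rightarrow> carrier R" using that by auto
    have "lc B (\<lambda>b. r b \<oplus> \<ominus> s b) = lc B r \<oplus> lc B (\<lambda>b. \<ominus> s b)" by (rule lc_add[OF that(1) neg])
    also have "\<dots> = lc B (\<lambda>b. s b \<oplus> \<ominus> s b)" using lc_add[OF that(2) neg] that(3) by simp
    also have "\<dots> = \<zero>" unfolding lc_def using that Bc by (intro add.finprod_one_eqI) (auto simp: r_neg Pi_iff subset_iff)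
    finally have "lc B (\<lambda>b. r b \<oplus> \<ominus> s b) = \<zero>" .
    then have "r b \<oplus> \<ominus> s b = \<zero>" using B(2) that unfolding indep_def by (auto simp: Pi_iff)
    moreover have "r b \<in> carrier R" "s b \<in> carrier R" using that by auto
    ultimately show ?thesis by (simp add: minus_eq[symmetric] r_right_minus_eq)
  qed
  \<comment> \<open>Coordinates of c^p x in the independent set B; their uniqueness makes each of
    them p^-1-linear.\<close>
  define co where "co = (\<lambda>x. SOME r. r \<in> B \<rightarrow> carrier R \<and> c [^] p \<otimes> x = lc B r)"
  have co: "co x \<in> B \<rightarrow> carrier R" "c [^] p \<otimes> x = lc B (co x)" if "x \<in> carrier R" for x
    using someI_ex[of "\<lambda>r. r \<in> B \<rightarrow> carrier R \<and> c [^] p \<otimes> x = lc B r"] ex[OF that] unfolding co_def by blast+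
  have cart: "(\<lambda>x. co x b) \<in> cartier 1" if b: "b \<in> B" for b
  proof (rule cartierI)
    fix x assume "x \<in> carrier R"
    then show "co x b \<in> carrier R" using co(1) b by auto
  next
    fix x y assume xy: "x \<in> carrier R" "y \<in> carrier R"
    have "lc B (co (x \<oplus> y)) = lc B (\<lambda>b. co x b \<oplus> co y b)"
      using xy c(1) lc_add[OF co(1) co(1), of x y] by (simp add: r_distr flip: co(2))
    then show "co (x \<oplus> y) b = co x b \<oplus> co y b"
      using uniq[OF co(1) _ _ b, of "x \<oplus> y" "\<lambda>b. co x b \<oplus> co y b"] co(1)[OF xy(1)] co(1)[OF xy(2)] xy by auto
  next
    fix a x assume ax: "a \<in> carrier R" "x \<in> carrier R"
    have "lc B (co (a [^] p \<otimes> x)) = lc B (\<lambda>b. a \<otimes> co x b)"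
      using ax c(1) lc_mult[OF co(1), of x a] by (simp add: m_lcomm flip: co(2))
    then show "co (a [^] (p ^ 1) \<otimes> x) b = a \<otimes> co x b"
      using uniq[OF co(1) _ _ b, of "a [^] p \<otimes> x" "\<lambda>b. a \<otimes> co x b"] co(1)[OF ax(2)] ax by auto
  qed
  have "c [^] p \<otimes> f \<in> Idl ((\<lambda>g. g [^] p) ` J)" if f: "f \<in> carrier R" and Jc: "J \<subseteq> carrier R" and J: "\<forall>\<phi>\<in>cartier 1. \<phi> f \<in> J" for J f
  proof -
    have I: "ideal (Idl ((\<lambda>g. g [^] p) ` J)) R" by (rule genideal_ideal) (use Jc in auto)
    have gen: "(\<lambda>g. g [^] p) ` J \<subseteq> Idl ((\<lambda>g. g [^] p) ` J)" by (rule genideal_self) (use Jc in auto)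
    show ?thesis unfolding co(2)[OF f] lc_def
    proof (rule finsum_mem[OF finB])
      fix b assume b: "b \<in> B"
      show "co f b [^] p \<otimes> b \<in> carrier R" using co(1)[OF f] b Bc by auto
      have "co f b \<in> J" using bspec[OF J cart[OF b]] by simp
      then show "co f b [^] p \<otimes> b \<in> Idl ((\<lambda>g. g [^] p) ` J)" using gen b Bc ideal.I_r_closed[OF I] by blast
    qed (use I in \<open>auto simp: ideal_zeroD ideal_addD\<close>)
  qed
  then show ?thesis using c(1,2) by blast
qed

end

section \<open>Localization at a prime\<close>

locale char_p_prime = char_p_cring R p + primeideal P R
  for R :: "('a, 'b) ring_scheme" (structure) and p :: nat and P :: "'a set"
begin

abbreviation T :: "('a \<times> 'a) set ring" where "T \<equiv> localization R P"
abbreviation frac :: "'a \<Rightarrow> 'a \<Rightarrow> ('a \<times> 'a) set" where "frac a s \<equiv> fraction R P a s"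
abbreviation \<iota> :: "'a \<Rightarrow> ('a \<times> 'a) set" where "\<iota> a \<equiv> fraction R P a \<one>"
abbreviation Q :: "'a set" where "Q \<equiv> carrier R - P"

lemma one_Q: "\<one> \<in> Q" using one_notin by simp

lemma Q_carrier: "s \<in> Q \<Longrightarrow> s \<in> carrier R" by simp

lemma pow_Q: "s \<in> Q \<Longrightarrow> s [^] (n::nat) \<in> Q"
proof (induct n)
  case 0
  then show ?case using one_Q by simp
next
  case (Suc n)
  then show ?case using compl_mult[of "s [^] n" s] by simp
qed

lemma pow_P: "a \<in> carrier R \<Longrightarrow> a [^] (n::nat) \<in> P \<Longrightarrow> a \<in> P"
  using pow_Q[of a n] by auto

lemma iota_eq_frac:
  assumes "a \<in> carrier R" "b \<in> carrier R" "s \<in> Q"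
  shows "\<iota> a = frac b s \<longleftrightarrow> (\<exists>u\<in>Q. u \<otimes> (a \<otimes> s) = u \<otimes> b)"
  using fraction_eq_iff[OF assms(1,2) one_Q assms(3)] assms(2) by simp

lemma iota_zero_iff:
  assumes "a \<in> carrier R"
  shows "\<iota> a = \<zero>\<^bsub>T\<^esub> \<longleftrightarrow> (\<exists>u\<in>Q. u \<otimes> a = \<zero>)"
  unfolding zero_loc using fraction_eq_iff[OF assms _ one_Q one_Q, of \<zero>] assms by auto

lemma frac_cancel:
  assumes "a \<in> carrier R" "s \<in> Q" "u \<in> Q"
  shows "frac (u \<otimes> a) (u \<otimes> s) = frac a s"
  by (rule fraction_eqI) (use assms compl_mult[OF assms(3,2)] in \<open>auto simp: m_ac\<close>)

lemma frac_decomp: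
  assumes "a \<in> carrier R" "s \<in> Q"
  shows "frac a s = \<iota> a \<otimes>\<^bsub>T\<^esub> frac \<one> s"
  using mult_fraction[OF assms(1) one_closed one_Q assms(2)] assms by simp

lemma frac_inv:
  assumes "s \<in> Q" "t \<in> Q"
  shows "frac t s \<otimes>\<^bsub>T\<^esub> frac s t = \<one>\<^bsub>T\<^esub>"
proof -
  have "frac (t \<otimes> s) (s \<otimes> t) = frac \<one> \<one>"
    by (rule fraction_eqI) (use assms compl_mult[OF assms] one_Q in \<open>auto simp: m_ac\<close>)
  then show ?thesis using mult_fraction[of t s s t] assms by (simp add: one_loc)
qed

lemma frac_add_same:
  assumes "a \<in> carrier R" "b \<in> carrier R" "s \<in> Q"
  shows "frac a s \<oplus>\<^bsub>T\<^esub> frac b s = frac (a \<oplus> b) s"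
proof -
  have "a \<otimes> s \<oplus> b \<otimes> s = s \<otimes> (a \<oplus> b)" using assms by (simp add: r_distr m_comm)
  then show ?thesis using add_fraction[OF assms(1,2,3,3)] frac_cancel[of "a \<oplus> b" s s] assms by simp
qed

lemma frac_common:
  assumes "a \<in> carrier R" "b \<in> carrier R" "s \<in> Q" "t \<in> Q"
  shows "frac a s = frac (t \<otimes> a) (t \<otimes> s)" "frac b t = frac (s \<otimes> b) (t \<otimes> s)" "t \<otimes> s \<in> Q"
  using frac_cancel[OF assms(1,3,4)] frac_cancel[OF assms(2,4,3)] compl_mult[OF assms(4,3)] assms m_comm[of s t] by auto

lemma iota_closed: "a \<in> carrier R \<Longrightarrow> \<iota> a \<in> carrier T"
  using one_Q by blast

lemma frac_cases:
  assumes "x \<in> carrier T"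
  obtains a s where "x = frac a s" "a \<in> carrier R" "s \<in> Q" "s \<in> carrier R"
  using assms unfolding carrier_localization by auto

lemma iota_add: "a \<in> carrier R \<Longrightarrow> b \<in> carrier R \<Longrightarrow> \<iota> (a \<oplus> b) = \<iota> a \<oplus>\<^bsub>T\<^esub> \<iota> b"
  using frac_add_same[OF _ _ one_Q] by simp

lemma iota_mult: "a \<in> carrier R \<Longrightarrow> b \<in> carrier R \<Longrightarrow> \<iota> (a \<otimes> b) = \<iota> a \<otimes>\<^bsub>T\<^esub> \<iota> b"
  using mult_fraction[OF _ _ one_Q one_Q] by simp

lemma iota_hom: "ring_hom_cring R T \<iota>"
proof -
  have "\<iota> \<in> ring_hom R T"
    by (rule ring_hom_memI) (auto simp: iota_closed iota_add iota_mult one_loc)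
  then show ?thesis
    by (intro ring_hom_cring.intro is_cring cring_localization) (simp add: ring_hom_cring_axioms_def)
qed

lemma frac_pow:
  assumes "a \<in> carrier R" "s \<in> Q"
  shows "(frac a s) [^]\<^bsub>T\<^esub> (n::nat) = frac (a [^] n) (s [^] n)"
proof (induct n)
  case (Suc n)
  then show ?case using mult_fraction[of "a [^] n" a "s [^] n" s] assms pow_Q[OF assms(2)] by simp
qed (use assms in \<open>auto simp: one_loc\<close>)

lemma iota_pow: "a \<in> carrier R \<Longrightarrow> \<iota> (a [^] (n::nat)) = \<iota> a [^]\<^bsub>T\<^esub> n"
  using frac_pow[OF _ one_Q] by simp

lemma char_p_T: "char_p_cring T p"
proof -
  interpret T: cring T by (rule cring_localization)
  interpret h: ring_hom_cring R T \<iota> by (rule iota_hom)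
  have "\<iota> (add_pow R n \<one>) = add_pow T n \<one>\<^bsub>T\<^esub>" for n :: nat
    by (induct n) (auto simp: add.nat_pow_Suc T.add.nat_pow_Suc)
  then have "add_pow T p \<one>\<^bsub>T\<^esub> = \<zero>\<^bsub>T\<^esub>" using p_one h.hom_zero by metis
  then show ?thesis using prime by unfold_locales auto
qed

sublocale T: char_p_cring T p
  by (rule char_p_T)

lemma frac_in_max_iff:
  assumes "a \<in> carrier R" "s \<in> Q"
  shows "frac a s \<in> {frac b t | b t. b \<in> P \<and> t \<in> Q} \<longleftrightarrow> a \<in> P"
proof
  assume "frac a s \<in> {frac b t | b t. b \<in> P \<and> t \<in> Q}"
  then obtain b t where bt: "frac a s = frac b t" "b \<in> P" "t \<in> Q" by blast
  have b: "b \<in> carrier R" using bt(2) a_Hcarr by blast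
  obtain u where u: "u \<in> Q" "u \<otimes> (a \<otimes> t) = u \<otimes> (b \<otimes> s)"
    using bt(1) fraction_eq_iff[OF assms(1) b assms(2) bt(3)] by blast
  have "u \<otimes> (b \<otimes> s) \<in> P" using bt(2) u(1) assms(2) by (simp add: I_l_closed I_r_closed)
  then have "u \<otimes> (a \<otimes> t) \<in> P" using u(2) by simp
  then show "a \<in> P" using compl_mult[OF compl_mult[OF _ bt(3)], of a] compl_mult[OF u(1), of "a \<otimes> t"] assms bt(3)
    by (metis DiffD1 DiffD2 DiffI compl_mult m_closed u(1))
qed (use assms in blast)

lemma ideal_frac:
  assumes J: "ideal J R"
  shows "ideal {frac a s | a s. a \<in> J \<and> s \<in> Q} T"
proof (rule T.cring_idealI)
  note Jc = ideal.Icarr[OF J]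
  show "{frac a s | a s. a \<in> J \<and> s \<in> Q} \<subseteq> carrier T" using Jc by auto
  show "\<zero>\<^bsub>T\<^esub> \<in> {frac a s | a s. a \<in> J \<and> s \<in> Q}" unfolding zero_loc using ideal_zeroD[OF J] one_Q by blast
next
  fix x y assume "x \<in> {frac a s | a s. a \<in> J \<and> s \<in> Q}" "y \<in> {frac a s | a s. a \<in> J \<and> s \<in> Q}"
  then obtain a s b t where *: "x = frac a s" "a \<in> J" "s \<in> Q" "y = frac b t" "b \<in> J" "t \<in> Q" by blast
  have "a \<otimes> t \<oplus> b \<otimes> s \<in> J" using * by (simp add: ideal_simps J)
  moreover have "x \<oplus>\<^bsub>T\<^esub> y = frac (a \<otimes> t \<oplus> b \<otimes> s) (s \<otimes> t)"
    using add_fraction[of a b s t] * ideal.Icarr[OF J] by auto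
  ultimately show "x \<oplus>\<^bsub>T\<^esub> y \<in> {frac a s | a s. a \<in> J \<and> s \<in> Q}" using compl_mult[OF *(3,6)] by blast
next
  fix r x assume "r \<in> carrier T" "x \<in> {frac a s | a s. a \<in> J \<and> s \<in> Q}"
  then obtain a s b t where *: "x = frac a s" "a \<in> J" "s \<in> Q" "r = frac b t" "b \<in> carrier R" "t \<in> Q"
    using frac_cases by (smt (verit) mem_Collect_eq)
  have "b \<otimes> a \<in> J" using * by (simp add: ideal_simps J)
  moreover have "r \<otimes>\<^bsub>T\<^esub> x = frac (b \<otimes> a) (t \<otimes> s)" using mult_fraction[of b a t s] * ideal.Icarr[OF J] by auto
  ultimately show "r \<otimes>\<^bsub>T\<^esub> x \<in> {frac a s | a s. a \<in> J \<and> s \<in> Q}" using compl_mult[OF *(6,3)] by blast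
qed

lemma genideal_iota:
  assumes J: "ideal J R"
  shows "Idl\<^bsub>T\<^esub> (\<iota> ` J) = {frac a s | a s. a \<in> J \<and> s \<in> Q}"
proof
  have sub: "\<iota> ` J \<subseteq> carrier T" using iota_closed ideal.Icarr[OF J] by blast
  show "Idl\<^bsub>T\<^esub> (\<iota> ` J) \<subseteq> {frac a s | a s. a \<in> J \<and> s \<in> Q}"
    by (rule T.genideal_minimal[OF ideal_frac[OF J]]) (use one_Q in blast)
  show "{frac a s | a s. a \<in> J \<and> s \<in> Q} \<subseteq> Idl\<^bsub>T\<^esub> (\<iota> ` J)"
  proof clarify
    fix a s assume *: "a \<in> J" "s \<in> carrier R" "s \<notin> P"
    then have ac: "a \<in> carrier R" and s: "s \<in> Q" using ideal.Icarr[OF J] by auto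
    have "\<iota> a \<in> Idl\<^bsub>T\<^esub> (\<iota> ` J)" using subsetD[OF T.genideal_self[OF sub]] *(1) by simp
    then have "\<iota> a \<otimes>\<^bsub>T\<^esub> frac \<one> s \<in> Idl\<^bsub>T\<^esub> (\<iota> ` J)"
      by (rule ideal.I_r_closed[OF T.genideal_ideal[OF sub]]) (rule fraction_closed[OF one_closed s])
    then show "frac a s \<in> Idl\<^bsub>T\<^esub> (\<iota> ` J)" by (simp only: frac_decomp[OF ac s])
  qed
qed

lemma genideal_iota_gen:
  assumes "A \<subseteq> carrier R"
  shows "Idl\<^bsub>T\<^esub> (\<iota> ` A) = {frac a s | a s. a \<in> Idl A \<and> s \<in> Q}"
proof -
  interpret h: ring_hom_cring R T \<iota> by (rule iota_hom)
  have J: "ideal (Idl A) R" by (rule genideal_ideal[OF assms])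
  have sub: "\<iota> ` A \<subseteq> carrier T" using iota_closed assms by blast
  have I: "ideal (Idl\<^bsub>T\<^esub> (\<iota> ` A)) T" by (rule T.genideal_ideal[OF sub])
  have "ideal {a \<in> carrier R. \<iota> a \<in> Idl\<^bsub>T\<^esub> (\<iota> ` A)} R"
  proof (rule cring_idealI)
    fix a b assume "a \<in> {a \<in> carrier R. \<iota> a \<in> Idl\<^bsub>T\<^esub> (\<iota> ` A)}" "b \<in> {a \<in> carrier R. \<iota> a \<in> Idl\<^bsub>T\<^esub> (\<iota> ` A)}"
    then show "a \<oplus> b \<in> {a \<in> carrier R. \<iota> a \<in> Idl\<^bsub>T\<^esub> (\<iota> ` A)}" by (simp add: h.hom_add ideal_addD[OF I])
  next
    fix r a assume "r \<in> carrier R" "a \<in> {a \<in> carrier R. \<iota> a \<in> Idl\<^bsub>T\<^esub> (\<iota> ` A)}"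
    then show "r \<otimes> a \<in> {a \<in> carrier R. \<iota> a \<in> Idl\<^bsub>T\<^esub> (\<iota> ` A)}" by (simp add: h.hom_mult ideal.I_l_closed[OF I])
  qed (simp_all add: ideal_zeroD[OF I])
  then have "Idl A \<subseteq> {a \<in> carrier R. \<iota> a \<in> Idl\<^bsub>T\<^esub> (\<iota> ` A)}"
  proof (rule genideal_minimal)
    show "A \<subseteq> {a \<in> carrier R. \<iota> a \<in> Idl\<^bsub>T\<^esub> (\<iota> ` A)}"
      using assms T.genideal_self[OF sub] by (simp add: subset_iff)
  qed
  then have "Idl\<^bsub>T\<^esub> (\<iota> ` (Idl A)) \<subseteq> Idl\<^bsub>T\<^esub> (\<iota> ` A)"
    by (intro T.genideal_minimal[OF I] image_subsetI) (simp add: subset_iff)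
  moreover have "Idl\<^bsub>T\<^esub> (\<iota> ` A) \<subseteq> Idl\<^bsub>T\<^esub> (\<iota> ` (Idl A))"
  proof (rule T.subset_Idl_subset)
    show "\<iota> ` (Idl A) \<subseteq> carrier T" by (intro image_subsetI iota_closed ideal.Icarr[OF J])
    show "\<iota> ` A \<subseteq> \<iota> ` (Idl A)" by (rule image_mono[OF genideal_self[OF assms]])
  qed
  ultimately show ?thesis unfolding genideal_iota[OF J] by (rule equalityI[rotated])
qed

lemma unit_T:
  assumes "x \<in> carrier T" "x \<notin> {frac b t | b t. b \<in> P \<and> t \<in> Q}"
  shows "x \<in> Units T"
proof -
  obtain a s where as: "x = frac a s" "a \<in> carrier R" "s \<in> Q" using assms(1) by (rule frac_cases)
  have "a \<notin> P" using assms(2) unfolding as(1) frac_in_max_iff[OF as(2,3)] .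
  then have a: "a \<in> Q" using as(2) by simp
  have y: "frac s a \<in> carrier T" using fraction_closed[OF Q_carrier[OF as(3)] a] .
  have xy: "x \<otimes>\<^bsub>T\<^esub> frac s a = \<one>\<^bsub>T\<^esub>" unfolding as(1) by (rule frac_inv[OF as(3) a])
  then have "frac s a \<otimes>\<^bsub>T\<^esub> x = \<one>\<^bsub>T\<^esub>" using T.m_comm[OF y assms(1)] by simp
  then show ?thesis unfolding Units_def using assms(1) y xy by blast
qed

lemma max_proper: "\<one>\<^bsub>T\<^esub> \<notin> {frac b t | b t. b \<in> P \<and> t \<in> Q}"
  by (simp only: one_loc frac_in_max_iff[OF one_closed one_Q] one_notin not_False_eq_True)

lemma local_ring_T: "local_ring T"
proof -
  let ?M = "{frac b t | b t. b \<in> P \<and> t \<in> Q}"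
  have M: "ideal ?M T" by (rule ideal_frac) (rule is_ideal)
  have top: "J = carrier T" if J: "ideal J T" and u: "x \<in> J" "x \<notin> ?M" for J x
  proof -
    have "x \<in> Units T" using unit_T[of x] u ideal.Icarr[OF J] by blast
    then have "inv\<^bsub>T\<^esub> x \<otimes>\<^bsub>T\<^esub> x \<in> J" using u(1) by (intro ideal.I_l_closed[OF J]) auto
    then show ?thesis using ideal.one_imp_carrier[OF J] \<open>x \<in> Units T\<close> by simp
  qed
  have "maximalideal ?M T"
  proof (rule maximalidealI[OF M])
    show "carrier T \<noteq> ?M" using max_proper by (metis T.one_closed)
    fix J assume "ideal J T" "?M \<subseteq> J" "J \<subseteq> carrier T"
    then show "J = ?M \<or> J = carrier T" using top by blast
  qed
  moreover have "J = ?M" if J: "maximalideal J T" for J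
  proof -
    interpret J: maximalideal J T by (rule J)
    have "J \<subseteq> ?M" using top[OF J.is_ideal] J.I_notcarr by blast
    moreover have "?M \<noteq> carrier T" using max_proper by (metis T.one_closed)
    ultimately show ?thesis using J.I_maximal[OF M] ideal_subD[OF M] by blast
  qed
  ultimately show ?thesis unfolding local_ring_def using cring_localization by blast
qed

text \<open>Denominators can be taken to be p-th powers: a/s = (1/s)^p s^(p-1) a.\<close>

lemma frob_gen_T:
  assumes A: "frob_gen 1 A"
  shows "T.frob_gen 1 (\<iota> ` A)"
  unfolding T.frob_gen_def
proof (intro conjI allI impI subsetI)
  show "finite (\<iota> ` A)" using frob_genD(1)[OF A] by simp
  show "\<And>x. x \<in> \<iota> ` A \<Longrightarrow> x \<in> carrier T" using frob_genD(2)[OF A] iota_closed by blast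
next
  interpret h: ring_hom_cring R T \<iota> by (rule iota_hom)
  fix S x assume S: "\<zero>\<^bsub>T\<^esub> \<in> S" "\<forall>c\<in>carrier T. \<forall>a\<in>\<iota> ` A. c [^]\<^bsub>T\<^esub> (p ^ 1) \<otimes>\<^bsub>T\<^esub> a \<in> S" "\<forall>x\<in>S. \<forall>y\<in>S. x \<oplus>\<^bsub>T\<^esub> y \<in> S"
    and x: "x \<in> carrier T"
  have *: "w [^]\<^bsub>T\<^esub> p \<otimes>\<^bsub>T\<^esub> \<iota> y \<in> S" if "y \<in> carrier R" "w \<in> carrier T" for y w
    using A that(1)
  proof (induct y rule: frob_gen_induct)
    case zero
    then show ?case using S(1) that(2) by simp
  next
    case (gen c a)
    have a: "a \<in> carrier R" using gen frob_genD(2)[OF A] by auto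
    have "w [^]\<^bsub>T\<^esub> p \<otimes>\<^bsub>T\<^esub> \<iota> (c [^] (p ^ 1) \<otimes> a) = (w \<otimes>\<^bsub>T\<^esub> \<iota> c) [^]\<^bsub>T\<^esub> p \<otimes>\<^bsub>T\<^esub> \<iota> a"
      using a gen(1) that(2) by (simp add: iota_mult iota_pow iota_closed T.nat_pow_distrib T.m_assoc)
    moreover have "w \<otimes>\<^bsub>T\<^esub> \<iota> c \<in> carrier T" using gen(1) that(2) by simp
    ultimately show ?case using S(2) gen(2) by simp
  next
    case (add x y)
    then show ?case using S(3) that(2) by (simp add: iota_add T.r_distr iota_closed)
  qed
  obtain a s where as: "x = frac a s" "a \<in> carrier R" "s \<in> Q" using x by (rule frac_cases)
  obtain k where k: "p = Suc k" using p_gt_0 gr0_implies_Suc by blast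
  have "frac \<one> s [^]\<^bsub>T\<^esub> p \<otimes>\<^bsub>T\<^esub> \<iota> (s [^] k \<otimes> a) = frac (s [^] k \<otimes> a) (s [^] k \<otimes> s)"
    using frac_pow[OF one_closed as(3), of p] mult_fraction[of \<one> "s [^] k \<otimes> a" "s [^] p" \<one>] pow_Q[OF as(3), of p] as one_Q
    by (simp add: k)
  also have "\<dots> = x" unfolding as(1) by (rule frac_cancel[OF as(2,3) pow_Q[OF as(3)]])
  finally have "x = frac \<one> s [^]\<^bsub>T\<^esub> p \<otimes>\<^bsub>T\<^esub> \<iota> (s [^] k \<otimes> a)" by simp
  moreover have "frac \<one> s \<in> carrier T" using as(3) by blast
  ultimately show "x \<in> S" using *[of "s [^] k \<otimes> a" "frac \<one> s"] as by simp
qed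

text \<open>Since a/s = s^(q-1) a / s^q, a localized map must send a/s to \<phi>(s^(q-1) a)/s.
  Independence of the representative follows by moving u t into \<open>\<phi>\<close> as a q-th
  power, using the relation, and moving u s out.\<close>

lemma cartier_frac:
  assumes \<phi>: "\<phi> \<in> cartier e" and "a \<in> carrier R" "b \<in> carrier R" "s \<in> Q" "t \<in> Q" "frac a s = frac b t"
  shows "frac (\<phi> (s [^] (p ^ e - 1) \<otimes> a)) s = frac (\<phi> (t [^] (p ^ e - 1) \<otimes> b)) t"
proof -
  obtain k where k: "p ^ e = Suc k" using q_gt_0[of e] gr0_implies_Suc by blast
  obtain u where u: "u \<in> Q" "u \<otimes> (a \<otimes> t) = u \<otimes> (b \<otimes> s)"
    using assms(6) fraction_eq_iff[OF assms(2-5)] by blast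
  have c: "u \<in> carrier R" "s \<in> carrier R" "t \<in> carrier R" using u assms by auto
  note lin = cartierD(3)[OF \<phi>, unfolded k] and cl = cartierD(1)[OF \<phi>]
  have "u \<otimes> (\<phi> (s [^] k \<otimes> a) \<otimes> t) = (u \<otimes> t) \<otimes> \<phi> (s [^] k \<otimes> a)" using c assms(2) cl by (simp add: m_ac)
  also have "\<dots> = \<phi> ((u \<otimes> t) [^] Suc k \<otimes> (s [^] k \<otimes> a))" using c assms(2) by (intro lin[symmetric]) auto
  also have "(u \<otimes> t) [^] Suc k \<otimes> (s [^] k \<otimes> a) = (u [^] k \<otimes> t [^] k \<otimes> s [^] k) \<otimes> (u \<otimes> (a \<otimes> t))"
    using c assms(2) by (simp add: nat_pow_distrib m_ac)
  also have "\<dots> = (u \<otimes> s) [^] Suc k \<otimes> (t [^] k \<otimes> b)"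
    unfolding u(2) using c assms(3) by (simp add: nat_pow_distrib m_ac)
  also have "\<phi> \<dots> = (u \<otimes> s) \<otimes> \<phi> (t [^] k \<otimes> b)" using c assms(3) by (intro lin) auto
  also have "\<dots> = u \<otimes> (\<phi> (t [^] k \<otimes> b) \<otimes> s)" using c assms(3) cl by (simp add: m_ac)
  finally have "u \<otimes> (\<phi> (s [^] k \<otimes> a) \<otimes> t) = u \<otimes> (\<phi> (t [^] k \<otimes> b) \<otimes> s)" .
  then show ?thesis using u(1) fraction_eq_iff[of "\<phi> (s [^] k \<otimes> a)" "\<phi> (t [^] k \<otimes> b)" s t] cl c assms
    by (simp add: k) blast
qed

text \<open>The formula of \<open>cartier_frac\<close> is evaluated at a chosen representative;
  additivity and linearity are then checked on convenient ones.\<close>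

lemma cartier_extend:
  assumes \<phi>: "\<phi> \<in> cartier e"
  shows "\<exists>\<Phi>\<in>T.cartier e. \<forall>a\<in>carrier R. \<Phi> (\<iota> a) = \<iota> (\<phi> a)"
proof -
  define rep where "rep = (\<lambda>x. SOME y. x = frac (fst y) (snd y) \<and> fst y \<in> carrier R \<and> snd y \<in> Q)"
  define \<Phi> where "\<Phi> = (\<lambda>x. frac (\<phi> (snd (rep x) [^] (p ^ e - 1) \<otimes> fst (rep x))) (snd (rep x)))"
  note cl = cartierD(1)[OF \<phi>]
  have \<Phi>: "\<Phi> (frac a s) = frac (\<phi> (s [^] (p ^ e - 1) \<otimes> a)) s" if "a \<in> carrier R" "s \<in> Q" for a s
  proof -
    have "frac a s = frac (fst (rep (frac a s))) (snd (rep (frac a s))) \<and>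
      fst (rep (frac a s)) \<in> carrier R \<and> snd (rep (frac a s)) \<in> Q"
      unfolding rep_def by (rule someI[of _ "(a, s)"]) (use that in simp)
    then show ?thesis unfolding \<Phi>_def using cartier_frac[OF \<phi> that(1) _ that(2)] by metis
  qed
  obtain k where k: "p ^ e = Suc k" using q_gt_0[of e] gr0_implies_Suc by blast
  have "\<Phi> \<in> T.cartier e"
  proof (rule T.cartierI)
    fix x assume "x \<in> carrier T"
    then obtain a s where "x = frac a s" "a \<in> carrier R" "s \<in> Q" "s \<in> carrier R" by (rule frac_cases)
    then show "\<Phi> x \<in> carrier T" using \<Phi>[of a s] cl[of "s [^] (p ^ e - 1) \<otimes> a"] by auto
  next
    fix x y assume "x \<in> carrier T" "y \<in> carrier T"
    then obtain a s b t where "x = frac a s" "a \<in> carrier R" "s \<in> Q" "s \<in> carrier R"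
      "y = frac b t" "b \<in> carrier R" "t \<in> Q" "t \<in> carrier R" by (meson frac_cases)
    then obtain a' b' r where *: "x = frac a' r" "y = frac b' r" "a' \<in> carrier R" "b' \<in> carrier R" "r \<in> Q" "r \<in> carrier R"
      using frac_common[of a b s t] by (metis DiffD1 m_closed)
    have "\<Phi> (x \<oplus>\<^bsub>T\<^esub> y) = frac (\<phi> (r [^] (p ^ e - 1) \<otimes> (a' \<oplus> b'))) r"
      using * \<Phi>[of "a' \<oplus> b'" r] frac_add_same[of a' b' r] by simp
    also have "\<dots> = \<Phi> x \<oplus>\<^bsub>T\<^esub> \<Phi> y"
      unfolding *(1,2) \<Phi>[OF *(3,5)] \<Phi>[OF *(4,5)] using * frac_add_same[of "\<phi> (r [^] (p ^ e - 1) \<otimes> a')" _ r] cl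
      by (simp add: r_distr cartierD(2)[OF \<phi>])
    finally show "\<Phi> (x \<oplus>\<^bsub>T\<^esub> y) = \<Phi> x \<oplus>\<^bsub>T\<^esub> \<Phi> y" .
  next
    fix x y assume "x \<in> carrier T" "y \<in> carrier T"
    then obtain a s b t where *: "x = frac b t" "b \<in> carrier R" "t \<in> Q" "t \<in> carrier R"
      "y = frac a s" "a \<in> carrier R" "s \<in> Q" "s \<in> carrier R" by (meson frac_cases)
    have ts: "t [^] Suc k \<otimes> s \<in> Q" using compl_mult[OF pow_Q[OF *(3), of "Suc k"] *(7)] .
    have "x [^]\<^bsub>T\<^esub> Suc k \<otimes>\<^bsub>T\<^esub> y = frac (b [^] Suc k \<otimes> a) (t [^] Suc k \<otimes> s)"
      unfolding *(1,5) frac_pow[OF *(2,3)] by (rule mult_fraction) (use * pow_Q[OF *(3), of "Suc k"] in auto)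
    then have "\<Phi> (x [^]\<^bsub>T\<^esub> Suc k \<otimes>\<^bsub>T\<^esub> y) = frac (\<phi> ((t [^] Suc k \<otimes> s) [^] k \<otimes> (b [^] Suc k \<otimes> a))) (t [^] Suc k \<otimes> s)"
      using \<Phi>[of "b [^] Suc k \<otimes> a" "t [^] Suc k \<otimes> s"] * ts by (simp add: k)
    also have "(t [^] Suc k \<otimes> s) [^] k \<otimes> (b [^] Suc k \<otimes> a) = (t [^] k \<otimes> b) [^] Suc k \<otimes> (s [^] k \<otimes> a)"
    proof -
      have "(t [^] Suc k) [^] k = (t [^] k) [^] Suc k" using *(4) by (simp only: nat_pow_pow mult.commute)
      then have "(t [^] Suc k \<otimes> s) [^] k = (t [^] k) [^] Suc k \<otimes> s [^] k" using * by (simp only: nat_pow_distrib nat_pow_closed)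
      moreover have "(t [^] k \<otimes> b) [^] Suc k = (t [^] k) [^] Suc k \<otimes> b [^] Suc k" using * by (simp only: nat_pow_distrib nat_pow_closed)
      ultimately show ?thesis using * by (simp add: m_ac del: nat_pow_Suc)
    qed
    also have "\<phi> \<dots> = t [^] k \<otimes> b \<otimes> \<phi> (s [^] k \<otimes> a)" using * by (intro cartierD(3)[OF \<phi>, unfolded k]) auto
    also have "frac \<dots> (t [^] Suc k \<otimes> s) = frac (t [^] k \<otimes> (b \<otimes> \<phi> (s [^] k \<otimes> a))) (t [^] k \<otimes> (t \<otimes> s))"
      using * cl by (simp add: m_assoc)
    also have "\<dots> = frac (b \<otimes> \<phi> (s [^] k \<otimes> a)) (t \<otimes> s)"
      by (rule frac_cancel) (use * cl pow_Q[OF *(3)] compl_mult[OF *(3,7)] in auto)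
    also have "\<dots> = x \<otimes>\<^bsub>T\<^esub> \<Phi> y"
      unfolding *(1,5) \<Phi>[OF *(6,7)] using mult_fraction[of b "\<phi> (s [^] k \<otimes> a)" t s] * cl by (simp add: k)
    finally show "\<Phi> (x [^]\<^bsub>T\<^esub> (p ^ e) \<otimes>\<^bsub>T\<^esub> y) = x \<otimes>\<^bsub>T\<^esub> \<Phi> y" by (simp only: k)
  qed
  moreover have "\<Phi> (\<iota> a) = \<iota> (\<phi> a)" if "a \<in> carrier R" for a using \<Phi>[OF that one_Q] that by simp
  ultimately show ?thesis by blast
qed

text \<open>Each kernel element is killed by something outside P; multiplying these over finitely
  many generators of the kernel gives one u for all.\<close>

lemma kernel_annihilator:
  assumes "noetherian_ring R"
  shows "\<exists>u\<in>Q. \<forall>r\<in>carrier R. \<iota> r = \<zero>\<^bsub>T\<^esub> \<longrightarrow> u \<otimes> r = \<zero>"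
proof -
  interpret h: ring_hom_cring R T \<iota> by (rule iota_hom)
  let ?N = "{r \<in> carrier R. \<iota> r = \<zero>\<^bsub>T\<^esub>}"
  have N: "ideal ?N R"
  proof (rule cring_idealI)
    fix a b assume "a \<in> ?N" "b \<in> ?N"
    then show "a \<oplus> b \<in> ?N" by (simp add: h.hom_add)
  next
    fix r a assume "r \<in> carrier R" "a \<in> ?N"
    then show "r \<otimes> a \<in> ?N" by (simp add: h.hom_mult)
  qed simp_all
  from noetherian_ring.finetely_gen[OF assms N] obtain A where A: "A \<subseteq> carrier R" "finite A" "?N = Idl A"
    by (elim exE conjE)
  have AN: "A \<subseteq> ?N" unfolding A(3) by (rule genideal_self[OF A(1)])
  have "B \<subseteq> ?N \<Longrightarrow> \<exists>u\<in>Q. \<forall>r\<in>B. u \<otimes> r = \<zero>" if "finite B" for B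
    using that
  proof (induct B rule: finite_induct)
    case empty
    show ?case using one_Q by blast
  next
    case (insert b B)
    then obtain u where u: "u \<in> Q" "\<forall>r\<in>B. u \<otimes> r = \<zero>" by auto
    have b: "b \<in> carrier R" "\<iota> b = \<zero>\<^bsub>T\<^esub>" using insert by auto
    then obtain v where v: "v \<in> Q" "v \<otimes> b = \<zero>" using iota_zero_iff by blast
    have "u \<otimes> v \<otimes> r = \<zero>" if "r \<in> insert b B" for r
    proof -
      have r: "r \<in> carrier R" using that insert by auto
      have "u \<otimes> v \<otimes> r = u \<otimes> (v \<otimes> r)" "u \<otimes> v \<otimes> r = v \<otimes> (u \<otimes> r)" using u(1) v(1) r by (auto simp: m_ac)
      then show ?thesis using that u v by auto
    qed
    then show ?case using compl_mult[OF u(1) v(1)] by blast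
  qed
  from this[OF A(2) AN] obtain u where u: "u \<in> Q" "\<forall>r\<in>A. u \<otimes> r = \<zero>" by (elim bexE)
  have "Idl A \<subseteq> {y \<in> carrier R. \<forall>s\<in>{u}. s \<otimes> y \<in> {\<zero>}}"
    by (rule genideal_minimal[OF ideal_colon[OF zeroideal]]) (use u A(1) in auto)
  then have "\<forall>r\<in>?N. u \<otimes> r = \<zero>" unfolding A(3) by auto
  then show ?thesis using u(1) by (intro bexI[of _ u]) auto
qed

text \<open>A common denominator s for the values on a finite generating set works for all values,
  since coefficients leave \<open>\<Phi>\<close> as images of elements of R. Chosen lifts to R are
  linear only modulo the kernel of \<open>\<iota>\<close>; the factor u from
  \<open>kernel_annihilator\<close> removes this defect.\<close>

lemma cartier_descend:
  assumes noeth: "noetherian_ring R" and A: "frob_gen e A" and \<Phi>: "\<Phi> \<in> T.cartier e"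
  shows "\<exists>\<psi>\<in>cartier e. \<exists>v\<in>Q. \<forall>x\<in>carrier R. \<iota> (\<psi> x) = \<iota> v \<otimes>\<^bsub>T\<^esub> \<Phi> (\<iota> x)"
proof -
  interpret h: ring_hom_cring R T \<iota> by (rule iota_hom)
  note cl = T.cartierD(1)[OF \<Phi>]
  have "B \<subseteq> carrier R \<Longrightarrow> \<exists>s\<in>Q. \<forall>a\<in>B. \<exists>r\<in>carrier R. \<iota> s \<otimes>\<^bsub>T\<^esub> \<Phi> (\<iota> a) = \<iota> r" if "finite B" for B
    using that
  proof (induct B rule: finite_induct)
    case empty
    show ?case using one_Q by blast
  next
    case (insert b B)
    then have "B \<subseteq> carrier R" by simp
    from insert(3)[OF this] obtain s where s: "s \<in> Q" "\<forall>a\<in>B. \<exists>r\<in>carrier R. \<iota> s \<otimes>\<^bsub>T\<^esub> \<Phi> (\<iota> a) = \<iota> r"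
      by (elim bexE)
    have "\<Phi> (\<iota> b) \<in> carrier T" using insert cl by auto
    then obtain c t where ct: "\<Phi> (\<iota> b) = frac c t" "c \<in> carrier R" "t \<in> Q" "t \<in> carrier R" by (rule frac_cases)
    have "\<iota> t \<otimes>\<^bsub>T\<^esub> frac c t = frac (t \<otimes> c) (t \<otimes> \<one>)" using mult_fraction[of t c \<one> t] ct one_Q by simp
    also have "\<dots> = \<iota> c" by (rule frac_cancel[OF ct(2) one_Q ct(3)])
    finally have t: "\<iota> t \<otimes>\<^bsub>T\<^esub> \<Phi> (\<iota> b) = \<iota> c" using ct by simp
    have "\<exists>r\<in>carrier R. \<iota> (s \<otimes> t) \<otimes>\<^bsub>T\<^esub> \<Phi> (\<iota> a) = \<iota> r" if "a \<in> insert b B" for a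
    proof -
      have ac: "\<Phi> (\<iota> a) \<in> carrier T" using that insert cl by auto
      have e: "\<iota> (s \<otimes> t) \<otimes>\<^bsub>T\<^esub> \<Phi> (\<iota> a) = \<iota> s \<otimes>\<^bsub>T\<^esub> (\<iota> t \<otimes>\<^bsub>T\<^esub> \<Phi> (\<iota> a))"
        "\<iota> (s \<otimes> t) \<otimes>\<^bsub>T\<^esub> \<Phi> (\<iota> a) = \<iota> t \<otimes>\<^bsub>T\<^esub> (\<iota> s \<otimes>\<^bsub>T\<^esub> \<Phi> (\<iota> a))"
        using s(1) ct(4) ac by (auto simp: T.m_ac)
      show ?thesis
      proof (cases "a = b")
        case True
        then have "\<iota> (s \<otimes> t) \<otimes>\<^bsub>T\<^esub> \<Phi> (\<iota> a) = \<iota> (s \<otimes> c)" using e(1) t s(1) ct(2) by simp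
        then show ?thesis using s(1) ct(2) by blast
      next
        case False
        then obtain r where r: "r \<in> carrier R" "\<iota> s \<otimes>\<^bsub>T\<^esub> \<Phi> (\<iota> a) = \<iota> r" using s(2) \<open>a \<in> insert b B\<close> by auto
        then have "\<iota> (s \<otimes> t) \<otimes>\<^bsub>T\<^esub> \<Phi> (\<iota> a) = \<iota> (t \<otimes> r)" using e(2) ct(4) by simp
        then show ?thesis using r(1) ct(4) by blast
      qed
    qed
    then show ?case using compl_mult[OF s(1) ct(3)] by blast
  qed
  from this[OF frob_genD[OF A]] obtain s where s: "s \<in> Q" "\<forall>a\<in>A. \<exists>r\<in>carrier R. \<iota> s \<otimes>\<^bsub>T\<^esub> \<Phi> (\<iota> a) = \<iota> r"
    by (elim bexE)
  have sc: "s \<in> carrier R" using s(1) by simp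
  have ex: "\<exists>r\<in>carrier R. \<iota> s \<otimes>\<^bsub>T\<^esub> \<Phi> (\<iota> x) = \<iota> r" if "x \<in> carrier R" for x
    using A that
  proof (induct x rule: frob_gen_induct)
    case zero
    have "\<Phi> \<zero>\<^bsub>T\<^esub> = \<zero>\<^bsub>T\<^esub>" using T.cartierD(3)[OF \<Phi>, of "\<zero>\<^bsub>T\<^esub>" "\<zero>\<^bsub>T\<^esub>"] cl by simp
    then show ?case using sc by (intro bexI[of _ \<zero>]) auto
  next
    case (gen c a)
    have a: "a \<in> carrier R" using gen frob_genD(2)[OF A] by auto
    obtain r where r: "r \<in> carrier R" "\<iota> s \<otimes>\<^bsub>T\<^esub> \<Phi> (\<iota> a) = \<iota> r" using s(2) gen by blast
    have "\<Phi> (\<iota> (c [^] (p ^ e) \<otimes> a)) = \<iota> c \<otimes>\<^bsub>T\<^esub> \<Phi> (\<iota> a)"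
      using T.cartierD(3)[OF \<Phi>, of "\<iota> c" "\<iota> a"] a gen by (simp add: iota_pow)
    then have "\<iota> s \<otimes>\<^bsub>T\<^esub> \<Phi> (\<iota> (c [^] (p ^ e) \<otimes> a)) = \<iota> c \<otimes>\<^bsub>T\<^esub> (\<iota> s \<otimes>\<^bsub>T\<^esub> \<Phi> (\<iota> a))"
      using sc a gen cl by (simp add: T.m_lcomm)
    also have "\<dots> = \<iota> (c \<otimes> r)" using r gen by simp
    finally show ?case using gen(1) r(1) by blast
  next
    case (add x y)
    then obtain r r' where "r \<in> carrier R" "\<iota> s \<otimes>\<^bsub>T\<^esub> \<Phi> (\<iota> x) = \<iota> r" "r' \<in> carrier R" "\<iota> s \<otimes>\<^bsub>T\<^esub> \<Phi> (\<iota> y) = \<iota> r'" by blast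
    then have "\<iota> s \<otimes>\<^bsub>T\<^esub> \<Phi> (\<iota> (x \<oplus> y)) = \<iota> (r \<oplus> r')" using add(1,2) sc cl by (simp add: T.cartierD(2)[OF \<Phi>] T.r_distr)
    then show ?case using \<open>r \<in> carrier R\<close> \<open>r' \<in> carrier R\<close> by blast
  qed
  define \<theta> where "\<theta> = (\<lambda>x. SOME r. r \<in> carrier R \<and> \<iota> s \<otimes>\<^bsub>T\<^esub> \<Phi> (\<iota> x) = \<iota> r)"
  have \<theta>: "\<theta> x \<in> carrier R" "\<iota> s \<otimes>\<^bsub>T\<^esub> \<Phi> (\<iota> x) = \<iota> (\<theta> x)" if "x \<in> carrier R" for x
    using someI_ex[of "\<lambda>r. r \<in> carrier R \<and> \<iota> s \<otimes>\<^bsub>T\<^esub> \<Phi> (\<iota> x) = \<iota> r"] ex[OF that] unfolding \<theta>_def by blast+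
  obtain u where u: "u \<in> Q" "\<forall>r\<in>carrier R. \<iota> r = \<zero>\<^bsub>T\<^esub> \<longrightarrow> u \<otimes> r = \<zero>" using kernel_annihilator[OF noeth] by blast
  have uc: "u \<in> carrier R" using u(1) by simp
  have eq: "u \<otimes> r = u \<otimes> r'" if "r \<in> carrier R" "r' \<in> carrier R" "\<iota> r = \<iota> r'" for r r'
  proof -
    have "\<iota> (r \<oplus> \<ominus> r') = \<zero>\<^bsub>T\<^esub>" using that by (simp add: T.r_neg)
    then have "u \<otimes> (r \<oplus> \<ominus> r') = \<zero>" using u(2) that by simp
    then have "u \<otimes> r \<ominus> u \<otimes> r' = \<zero>" using that uc by (simp add: r_distr r_minus minus_eq)
    then show ?thesis using that uc by (simp add: r_right_minus_eq)
  qed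
  have "(\<lambda>x. u \<otimes> \<theta> x) \<in> cartier e"
  proof (rule cartierI)
    fix x assume "x \<in> carrier R"
    then show "u \<otimes> \<theta> x \<in> carrier R" using \<theta> uc by simp
  next
    fix x y assume xy: "x \<in> carrier R" "y \<in> carrier R"
    have "\<iota> (\<theta> (x \<oplus> y)) = \<iota> s \<otimes>\<^bsub>T\<^esub> \<Phi> (\<iota> (x \<oplus> y))" by (rule \<theta>(2)[symmetric]) (use xy in simp)
    also have "\<dots> = \<iota> s \<otimes>\<^bsub>T\<^esub> \<Phi> (\<iota> x) \<oplus>\<^bsub>T\<^esub> \<iota> s \<otimes>\<^bsub>T\<^esub> \<Phi> (\<iota> y)"
      using xy sc cl by (simp add: T.cartierD(2)[OF \<Phi>] T.r_distr)
    also have "\<dots> = \<iota> (\<theta> x \<oplus> \<theta> y)" using xy \<theta> by simp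
    finally have "u \<otimes> \<theta> (x \<oplus> y) = u \<otimes> (\<theta> x \<oplus> \<theta> y)" using xy \<theta>(1) by (intro eq) auto
    then show "u \<otimes> \<theta> (x \<oplus> y) = u \<otimes> \<theta> x \<oplus> u \<otimes> \<theta> y" using xy \<theta>(1) uc by (simp add: r_distr)
  next
    fix a x assume ax: "a \<in> carrier R" "x \<in> carrier R"
    have "\<iota> (\<theta> (a [^] (p ^ e) \<otimes> x)) = \<iota> s \<otimes>\<^bsub>T\<^esub> \<Phi> (\<iota> (a [^] (p ^ e) \<otimes> x))" by (rule \<theta>(2)[symmetric]) (use ax in simp)
    also have "\<Phi> (\<iota> (a [^] (p ^ e) \<otimes> x)) = \<iota> a \<otimes>\<^bsub>T\<^esub> \<Phi> (\<iota> x)"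
      using T.cartierD(3)[OF \<Phi>, of "\<iota> a" "\<iota> x"] ax by (simp add: iota_pow)
    also have "\<iota> s \<otimes>\<^bsub>T\<^esub> (\<iota> a \<otimes>\<^bsub>T\<^esub> \<Phi> (\<iota> x)) = \<iota> a \<otimes>\<^bsub>T\<^esub> (\<iota> s \<otimes>\<^bsub>T\<^esub> \<Phi> (\<iota> x))" using sc ax cl by (simp add: T.m_lcomm)
    also have "\<dots> = \<iota> (a \<otimes> \<theta> x)" using ax \<theta> by simp
    finally have "u \<otimes> \<theta> (a [^] (p ^ e) \<otimes> x) = u \<otimes> (a \<otimes> \<theta> x)" using ax \<theta>(1) by (intro eq) auto
    then show "u \<otimes> \<theta> (a [^] (p ^ e) \<otimes> x) = a \<otimes> (u \<otimes> \<theta> x)" using ax \<theta>(1) uc by (simp add: m_lcomm)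
  qed
  moreover have "\<iota> (u \<otimes> \<theta> x) = \<iota> (u \<otimes> s) \<otimes>\<^bsub>T\<^esub> \<Phi> (\<iota> x)" if x: "x \<in> carrier R" for x
  proof -
    have "\<iota> (u \<otimes> \<theta> x) = \<iota> u \<otimes>\<^bsub>T\<^esub> (\<iota> s \<otimes>\<^bsub>T\<^esub> \<Phi> (\<iota> x))" using uc \<theta>[OF x] by simp
    then show ?thesis using uc sc cl x by (simp add: T.m_assoc)
  qed
  ultimately show ?thesis
    by (intro bexI[of _ "\<lambda>x. u \<otimes> \<theta> x"] bexI[of _ "u \<otimes> s"] ballI compl_mult[OF u(1) s(1)])
qed

end

section \<open>Differential operators and Frobenius\<close>

context char_p_cring
begin

text \<open>Endomorphisms of R over its subring of p^e-th powers.\<close>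

definition frob_linear :: "nat \<Rightarrow> ('a \<Rightarrow> 'a) set" where
  "frob_linear e = {\<delta> \<in> carrier R \<rightarrow> carrier R.
     (\<forall>x\<in>carrier R. \<forall>y\<in>carrier R. \<delta> (x \<oplus> y) = \<delta> x \<oplus> \<delta> y) \<and>
     (\<forall>a\<in>carrier R. \<forall>x\<in>carrier R. \<delta> (a [^] (p ^ e) \<otimes> x) = a [^] (p ^ e) \<otimes> \<delta> x)}"

lemma frob_linearD:
  assumes "\<delta> \<in> frob_linear e"
  shows "x \<in> carrier R \<Longrightarrow> \<delta> x \<in> carrier R"
    and "x \<in> carrier R \<Longrightarrow> y \<in> carrier R \<Longrightarrow> \<delta> (x \<oplus> y) = \<delta> x \<oplus> \<delta> y"
    and "a \<in> carrier R \<Longrightarrow> x \<in> carrier R \<Longrightarrow> \<delta> (a [^] (p ^ e) \<otimes> x) = a [^] (p ^ e) \<otimes> \<delta> x"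
  using assms unfolding frob_linear_def by auto

lemma frob_linearI:
  assumes "\<And>x. x \<in> carrier R \<Longrightarrow> \<delta> x \<in> carrier R"
    and "\<And>x y. x \<in> carrier R \<Longrightarrow> y \<in> carrier R \<Longrightarrow> \<delta> (x \<oplus> y) = \<delta> x \<oplus> \<delta> y"
    and "\<And>a x. a \<in> carrier R \<Longrightarrow> x \<in> carrier R \<Longrightarrow> \<delta> (a [^] (p ^ e) \<otimes> x) = a [^] (p ^ e) \<otimes> \<delta> x"
  shows "\<delta> \<in> frob_linear e"
  using assms unfolding frob_linear_def by auto

text \<open>Following \<open>\<phi>\<close> by the e-th Frobenius yields an operator on R. For a
  prime P it detects \<phi> f \<in> P just as well, since it only raises the value to a
  power.\<close>

lemma cartier_frob_linear:
  assumes "\<phi> \<in> cartier e"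
  shows "(\<lambda>x. \<phi> x [^] (p ^ e)) \<in> frob_linear e"
  by (rule frob_linearI) (use cartierD[OF assms] in \<open>auto simp: frobenius_add nat_pow_distrib\<close>)

text \<open>With u = \<delta> t, the map x |-> \<sigma>^e(u^(q-1) \<delta> x) sends t to
  \<sigma>^e(u^q) = u. Without the factor u^(q-1) the value would be \<sigma>^e(\<delta> t), which
  may lie in P although \<delta> t does not.\<close>

lemma frob_linear_cartier:
  assumes \<sigma>: "\<sigma> \<in> cartier 1" "\<sigma> \<one> = \<one>" and \<delta>: "\<delta> \<in> frob_linear e" and t: "t \<in> carrier R"
  shows "\<exists>\<phi>\<in>cartier e. \<phi> t = \<delta> t"
proof -
  obtain k where k: "p ^ e = Suc k" using q_gt_0[of e] gr0_implies_Suc by blast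
  have \<sigma>e: "(\<sigma> ^^ e) \<in> cartier e" by (rule cartier_iterate[OF \<sigma>(1)])
  have one: "(\<sigma> ^^ e) \<one> = \<one>" by (induct e) (use \<sigma>(2) in auto)
  note cl = frob_linearD(1)[OF \<delta>]
  let ?u = "\<delta> t"
  have u: "?u \<in> carrier R" using cl t .
  have "(\<lambda>x. (\<sigma> ^^ e) (?u [^] k \<otimes> \<delta> x)) \<in> cartier e"
  proof (rule cartierI)
    fix a x assume ax: "a \<in> carrier R" "x \<in> carrier R"
    have "?u [^] k \<otimes> \<delta> (a [^] (p ^ e) \<otimes> x) = a [^] (p ^ e) \<otimes> (?u [^] k \<otimes> \<delta> x)"
      using ax u cl by (simp add: frob_linearD(3)[OF \<delta>] m_lcomm)
    then show "(\<sigma> ^^ e) (?u [^] k \<otimes> \<delta> (a [^] (p ^ e) \<otimes> x)) = a \<otimes> (\<sigma> ^^ e) (?u [^] k \<otimes> \<delta> x)"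
      using cartierD(3)[OF \<sigma>e, of a "?u [^] k \<otimes> \<delta> x"] ax u cl by simp
  qed (use cartierD[OF \<sigma>e] u cl in \<open>simp_all add: frob_linearD(2)[OF \<delta>] r_distr\<close>)
  moreover have "(\<sigma> ^^ e) (?u [^] k \<otimes> \<delta> t) = ?u"
    using cartierD(3)[OF \<sigma>e u one_closed] u by (simp add: one k)
  ultimately show ?thesis by (intro bexI[of _ "\<lambda>x. (\<sigma> ^^ e) (?u [^] k \<otimes> \<delta> x)"])
qed

lemma F_pure_splitting:
  assumes "F_pure R p"
  shows "\<exists>\<sigma>\<in>cartier 1. \<sigma> \<one> = \<one>"
proof -
  obtain g where g: "g \<in> linear_maps R (frob R p 1) (self_module R)"
    "\<forall>x\<in>carrier (self_module R). g (x [^] p) = x"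
    using assms unfolding F_pure_def splits_def by blast
  have "g \<one> = \<one>" using bspec[OF g(2), of \<one>] by (simp add: self_module_def)
  then show ?thesis using g(1) unfolding linear_maps_frob by (intro bexI[of _ g])
qed

section \<open>Iterated commutators and the order of Frobenius-linear maps\<close>

abbreviation ad :: "'a \<Rightarrow> ('a \<Rightarrow> 'a) \<Rightarrow> 'a \<Rightarrow> 'a" where
  "ad a \<delta> \<equiv> commutator R \<delta> a"

lemma minus_mult_distrib:
  assumes "x \<in> carrier R" "y \<in> carrier R" "z \<in> carrier R" "w \<in> carrier R" "a \<in> carrier R"
  shows "(x \<oplus> y) \<ominus> a \<otimes> (z \<oplus> w) = (x \<ominus> a \<otimes> z) \<oplus> (y \<ominus> a \<otimes> w)"
    and "y \<otimes> x \<ominus> a \<otimes> (y \<otimes> z) = y \<otimes> (x \<ominus> a \<otimes> z)"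
  using assms by algebra+

lemma ad_closed: "\<delta> \<in> carrier R \<rightarrow> carrier R \<Longrightarrow> a \<in> carrier R \<Longrightarrow> ad a \<delta> \<in> carrier R \<rightarrow> carrier R"
  unfolding commutator_def by auto

lemma ad_cong: "(\<And>x. x \<in> carrier R \<Longrightarrow> \<delta> x = \<epsilon> x) \<Longrightarrow> a \<in> carrier R \<Longrightarrow> x \<in> carrier R \<Longrightarrow> ad a \<delta> x = ad a \<epsilon> x"
  unfolding commutator_def by simp

lemma ad_pow_closed: "\<delta> \<in> carrier R \<rightarrow> carrier R \<Longrightarrow> a \<in> carrier R \<Longrightarrow> (ad a ^^ n) \<delta> \<in> carrier R \<rightarrow> carrier R"
proof (induct n)
  case (Suc n)
  then show ?case using ad_closed[of "(ad a ^^ n) \<delta>" a] by simp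
qed simp

lemma ad_pow_cong:
  assumes "\<And>x. x \<in> carrier R \<Longrightarrow> \<delta> x = \<epsilon> x" "a \<in> carrier R" "x \<in> carrier R"
  shows "(ad a ^^ n) \<delta> x = (ad a ^^ n) \<epsilon> x"
  using assms(3)
proof (induct n arbitrary: x)
  case (Suc n)
  then show ?case using ad_cong[OF _ assms(2), of "(ad a ^^ n) \<delta>" "(ad a ^^ n) \<epsilon>" x] by simp
qed (use assms(1) in simp)

text \<open>In characteristic \<open>p\<close> the freshman's dream applies to \<open>ad a\<close>, the difference of the commuting
  operators \<open>\<delta> \<mapsto> \<delta> \<circ> a\<close> and \<open>\<delta> \<mapsto> a \<delta>\<close> on the additive group of functions into \<open>R\<close>.\<close>

lemma ad_prime_power1:
  assumes \<delta>: "\<delta> \<in> carrier R \<rightarrow> carrier R" and a: "a \<in> carrier R" and x: "x \<in> carrier R"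
  shows "(ad a ^^ p) \<delta> x = ad (a [^] p) \<delta> x"
proof -
  \<comment> \<open>Only the additive group matters, so multiplication and unit are placeholders.
    Total functions with values in R make equality in \<open>FG\<close> plain equality of
    functions.\<close>
  define FG :: "('a \<Rightarrow> 'a) ring" where
    "FG = \<lparr>carrier = {f. \<forall>x. f x \<in> carrier R}, mult = (\<lambda>f g. f), one = (\<lambda>_. \<zero>),
      zero = (\<lambda>_. \<zero>), add = (\<lambda>f g x. f x \<oplus> g x)\<rparr>"
  interpret FG: abelian_group FG
  proof (rule abelian_groupI)
    fix f assume "f \<in> carrier FG"
    then show "\<exists>g\<in>carrier FG. g \<oplus>\<^bsub>FG\<^esub> f = \<zero>\<^bsub>FG\<^esub>"
      by (intro bexI[of _ "\<lambda>x. \<ominus> f x"]) (auto simp: FG_def l_neg)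
  qed (auto simp: FG_def a_ac)
  define U where "U = (\<lambda>f x :: 'a. f (a \<otimes> x) :: 'a)"
  define V where "V = (\<lambda>f x :: 'a. (\<ominus> a) \<otimes> f x)"
  \<comment> \<open>\<open>\<delta>\<close> is uncontrolled outside the carrier, so it is replaced
    there by zero.\<close>
  define d where "d = (\<lambda>x. if x \<in> carrier R then \<delta> x else \<zero>)"
  have dF: "d \<in> carrier FG" using \<delta> unfolding d_def FG_def by auto
  have tors: "add_pow FG p f = \<zero>\<^bsub>FG\<^esub>" if "f \<in> carrier FG" for f
  proof -
    have "add_pow FG n f = (\<lambda>x. add_pow R n (f x))" for n :: nat
      by (induct n) (auto simp: FG.add.nat_pow_Suc add.nat_pow_Suc, auto simp: FG_def)
    then show ?thesis using that p_torsion by (auto simp: FG_def)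
  qed
  have "(ad a ^^ p) d = (U ^^ p) d \<oplus>\<^bsub>FG\<^esub> (V ^^ p) d"
  proof (rule FG.prime_funpow_add[OF _ _ _ _ _ _ dF prime tors])
    fix f assume "f \<in> carrier FG"
    then show "ad a f = U f \<oplus>\<^bsub>FG\<^esub> V f" using a unfolding commutator_def U_def V_def FG_def
      by (auto simp: minus_eq l_minus)
  qed (use a in \<open>auto simp: U_def V_def FG_def r_distr\<close>)
  then have "(ad a ^^ p) d x = (U ^^ p) d x \<oplus> (V ^^ p) d x" unfolding FG_def by simp
  moreover have "(U ^^ n) d y = d (a [^] n \<otimes> y)" if "y \<in> carrier R" for n y
    using that by (induct n arbitrary: y) (use a in \<open>auto simp: U_def m_assoc\<close>)
  moreover have "(V ^^ n) d x = (\<ominus> a) [^] n \<otimes> d x" for n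
    using dF by (induct n) (use a in \<open>auto simp: V_def FG_def m_ac\<close>)
  ultimately have "(ad a ^^ p) d x = ad (a [^] p) d x"
    using a x dF unfolding commutator_def by (simp add: neg_pow_p l_minus minus_eq FG_def)
  moreover have "(ad a ^^ p) d x = (ad a ^^ p) \<delta> x" "ad (a [^] p) d x = ad (a [^] p) \<delta> x"
    by (rule ad_pow_cong ad_cong; use a x in \<open>simp add: d_def\<close>)+
  ultimately show ?thesis by simp
qed

lemma ad_prime_power:
  assumes a: "a \<in> carrier R"
  shows "\<delta> \<in> carrier R \<rightarrow> carrier R \<Longrightarrow> x \<in> carrier R \<Longrightarrow> (ad a ^^ (p ^ e)) \<delta> x = ad (a [^] (p ^ e)) \<delta> x"
proof (induct e arbitrary: \<delta> x)
  case 0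
  then show ?case using a by simp
next
  case (Suc e)
  let ?b = "a [^] (p ^ e)"
  have b: "?b \<in> carrier R" using a by simp
  have *: "((ad a ^^ (p ^ e)) ^^ n) \<delta> y = (ad ?b ^^ n) \<delta> y" if "y \<in> carrier R" for n y
    using that
  proof (induct n arbitrary: y)
    case (Suc n)
    have cl: "((ad a ^^ (p ^ e)) ^^ n) \<delta> \<in> carrier R \<rightarrow> carrier R"
      unfolding Nat.funpow_mult by (rule ad_pow_closed[OF \<open>\<delta> \<in> carrier R \<rightarrow> carrier R\<close> a])
    have "((ad a ^^ (p ^ e)) ^^ Suc n) \<delta> y = ad ?b (((ad a ^^ (p ^ e)) ^^ n) \<delta>) y"
      using Suc.hyps \<open>\<And>\<delta> x. \<delta> \<in> carrier R \<rightarrow> carrier R \<Longrightarrow> x \<in> carrier R \<Longrightarrow> (ad a ^^ (p ^ e)) \<delta> x = ad ?b \<delta> x\<close>[OF cl Suc.prems] by simp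
    also have "\<dots> = ad ?b ((ad ?b ^^ n) \<delta>) y" by (rule ad_cong[OF Suc.hyps b Suc.prems])
    finally show ?case by simp
  qed simp
  have "(ad a ^^ (p ^ Suc e)) \<delta> x = ((ad a ^^ (p ^ e)) ^^ p) \<delta> x" by (simp add: Nat.funpow_mult mult.commute)
  also have "\<dots> = (ad ?b ^^ p) \<delta> x" using * Suc.prems by simp
  also have "\<dots> = ad (?b [^] p) \<delta> x" by (rule ad_prime_power1[OF Suc.prems(1) b Suc.prems(2)])
  finally show ?case using a by (simp add: nat_pow_pow mult.commute)
qed

definition adw :: "'a list \<Rightarrow> ('a \<Rightarrow> 'a) \<Rightarrow> 'a \<Rightarrow> 'a" where
  "adw w \<delta> = foldr ad w \<delta>"

lemma adw_simps: "adw [] \<delta> = \<delta>" "adw (a # w) \<delta> = ad a (adw w \<delta>)" "adw (w @ [a]) \<delta> = adw w (ad a \<delta>)"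
  unfolding adw_def by auto

lemma adw_closed: "set w \<subseteq> carrier R \<Longrightarrow> \<delta> \<in> carrier R \<rightarrow> carrier R \<Longrightarrow> adw w \<delta> \<in> carrier R \<rightarrow> carrier R"
  by (induct w) (simp_all add: adw_simps ad_closed del: Pi_iff)

lemma adw_cong:
  assumes "\<And>x. x \<in> carrier R \<Longrightarrow> \<delta> x = \<epsilon> x"
  shows "set w \<subseteq> carrier R \<Longrightarrow> x \<in> carrier R \<Longrightarrow> adw w \<delta> x = adw w \<epsilon> x"
proof (induct w arbitrary: x)
  case (Cons a w)
  then show ?case using ad_cong[of "adw w \<delta>" "adw w \<epsilon>" a x] by (simp add: adw_simps)
qed (use assms in \<open>simp add: adw_simps\<close>)

lemma ad_commute:
  assumes \<delta>: "\<delta> \<in> carrier R \<rightarrow> carrier R" and ab: "a \<in> carrier R" "b \<in> carrier R" and x: "x \<in> carrier R"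
  shows "ad a (ad b \<delta>) x = ad b (ad a \<delta>) x"
proof -
  have "\<delta> (b \<otimes> (a \<otimes> x)) = \<delta> (a \<otimes> (b \<otimes> x))" using ab x by (simp add: m_lcomm)
  moreover have "\<delta> (a \<otimes> (b \<otimes> x)) \<in> carrier R" "\<delta> (a \<otimes> x) \<in> carrier R" "\<delta> (b \<otimes> x) \<in> carrier R" "\<delta> x \<in> carrier R"
    using \<delta> ab x by auto
  ultimately show ?thesis unfolding commutator_def using ab by simp algebra
qed

lemma ad_adw_commute:
  assumes a: "a \<in> carrier R" and \<delta>: "\<delta> \<in> carrier R \<rightarrow> carrier R"
  shows "set w \<subseteq> carrier R \<Longrightarrow> x \<in> carrier R \<Longrightarrow> ad a (adw w \<delta>) x = adw w (ad a \<delta>) x"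
proof (induct w arbitrary: x)
  case (Cons b w)
  then have b: "b \<in> carrier R" and w: "set w \<subseteq> carrier R" by auto
  have "ad a (ad b (adw w \<delta>)) x = ad b (ad a (adw w \<delta>)) x"
    by (rule ad_commute[OF adw_closed[OF w \<delta>] a b Cons(3)])
  also have "\<dots> = ad b (adw w (ad a \<delta>)) x" by (rule ad_cong[OF Cons(1)[OF w] b Cons(3)])
  finally show ?case by (simp add: adw_simps)
qed (simp add: adw_simps)

text \<open>Commutators with different elements commute, so all letters a can be moved to the
  innermost place, where \<open>ad_prime_power\<close> acts on them together.\<close>

lemma adw_collect:
  assumes \<delta>: "\<delta> \<in> carrier R \<rightarrow> carrier R" and a: "a \<in> carrier R"
  shows "set w \<subseteq> carrier R \<Longrightarrow> \<exists>w'. set w' \<subseteq> carrier R \<and> (\<forall>x\<in>carrier R. adw w \<delta> x = adw w' ((ad a ^^ count_list w a) \<delta>) x)"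
proof (induct w)
  case Nil
  show ?case by (intro exI[of _ "[]"]) (simp add: adw_simps)
next
  case (Cons b w)
  then have b: "b \<in> carrier R" by simp
  obtain w' where w': "set w' \<subseteq> carrier R" "\<forall>x\<in>carrier R. adw w \<delta> x = adw w' ((ad a ^^ count_list w a) \<delta>) x"
    using Cons by auto
  let ?\<epsilon> = "(ad a ^^ count_list w a) \<delta>"
  have \<epsilon>: "?\<epsilon> \<in> carrier R \<rightarrow> carrier R" by (rule ad_pow_closed[OF \<delta> a])
  have eq: "adw (b # w) \<delta> x = ad b (adw w' ?\<epsilon>) x" if "x \<in> carrier R" for x
    unfolding adw_simps by (rule ad_cong[OF bspec[OF w'(2)] b that])
  show ?case
  proof (cases "b = a")
    case True
    have "adw (b # w) \<delta> x = adw w' (ad a ?\<epsilon>) x" if "x \<in> carrier R" for x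
      using eq[OF that] ad_adw_commute[OF a \<epsilon> w'(1) that] True by simp
    then show ?thesis using w'(1) True by (intro exI[of _ w']) simp
  next
    case False
    then show ?thesis using w'(1) b eq by (intro exI[of _ "b # w'"]) (simp add: adw_simps)
  qed
qed

lemma adw_zero: "set w \<subseteq> carrier R \<Longrightarrow> x \<in> carrier R \<Longrightarrow> adw w (\<lambda>_. \<zero>) x = \<zero>"
proof (induct w arbitrary: x)
  case (Cons a w)
  then have "ad a (adw w (\<lambda>_. \<zero>)) x = ad a (\<lambda>_. \<zero>) x" by (intro ad_cong) auto
  then show ?case using Cons(2) by (simp add: adw_simps commutator_def minus_eq)
qed (simp add: adw_simps)

text \<open>Order at most n, tested only on words in A: over a finite alphabet a long word must
  repeat a letter often. By \<open>ad_order_filt\<close> this test controls commutators with all of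
  R when A generates F_*R.\<close>

definition order_filt :: "nat \<Rightarrow> 'a set \<Rightarrow> nat \<Rightarrow> ('a \<Rightarrow> 'a) set" where
  "order_filt e A n = {\<delta> \<in> frob_linear e. \<forall>w. set w \<subseteq> A \<longrightarrow> n < length w \<longrightarrow> (\<forall>x\<in>carrier R. adw w \<delta> x = \<zero>)}"

text \<open>In a word longer than |A|(q-1) some letter a occurs at least q times, and q-fold
  application of \<open>ad a\<close> is \<open>ad (a^q)\<close>, which kills
  \<open>R^q\<close>-linear maps.\<close>

lemma frob_linear_order_filt:
  assumes A: "finite A" "A \<subseteq> carrier R" and \<delta>: "\<delta> \<in> frob_linear e"
  shows "\<delta> \<in> order_filt e A (card A * (p ^ e - 1))"
  unfolding order_filt_def
proof (clarify, intro conjI \<delta> allI impI ballI)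
  fix w x assume w: "set w \<subseteq> A" "card A * (p ^ e - 1) < length w" and x: "x \<in> carrier R"
  have \<delta>c: "\<delta> \<in> carrier R \<rightarrow> carrier R" using frob_linearD(1)[OF \<delta>] by auto
  have wc: "set w \<subseteq> carrier R" using w(1) A(2) by auto
  have "\<exists>a\<in>A. p ^ e \<le> count_list w a"
  proof (rule ccontr)
    assume "\<not> ?thesis"
    then have "\<And>a. a \<in> A \<Longrightarrow> count_list w a \<le> p ^ e - 1" by force
    then have "sum (count_list w) A \<le> of_nat (card A) * (p ^ e - 1)" by (rule sum_bounded_above)
    then show False using sum_count_set[OF w(1) A(1)] w(2) by simp
  qed
  then obtain a where a: "a \<in> A" "p ^ e \<le> count_list w a" by blast
  have ac: "a \<in> carrier R" using a(1) A(2) by auto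
  obtain k where k: "count_list w a = k + p ^ e" using a(2) le_Suc_ex by (metis add.commute)
  have "ad (a [^] (p ^ e)) \<delta> y = \<zero>" if "y \<in> carrier R" for y
    unfolding commutator_def using that ac frob_linearD[OF \<delta>] by (simp add: minus_eq r_neg)
  then have z: "(ad a ^^ (p ^ e)) \<delta> y = (\<lambda>_. \<zero>) y" if "y \<in> carrier R" for y
    using ad_prime_power[OF ac \<delta>c that] that by simp
  have rep: "(ad a ^^ n) f = adw (replicate n a) f" for n f
    by (induct n) (simp_all add: adw_simps)
  have z': "(ad a ^^ (k + p ^ e)) \<delta> y = (\<lambda>_. \<zero>) y" if "y \<in> carrier R" for y
  proof -
    have "(ad a ^^ (k + p ^ e)) \<delta> y = (ad a ^^ k) ((ad a ^^ (p ^ e)) \<delta>) y" by (simp add: funpow_add)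
    also have "\<dots> = (ad a ^^ k) (\<lambda>_. \<zero>) y" by (rule ad_pow_cong[OF z ac that])
    also have "\<dots> = \<zero>" unfolding rep by (rule adw_zero) (use ac that in auto)
    finally show ?thesis .
  qed
  obtain w' where w': "set w' \<subseteq> carrier R" "\<forall>x\<in>carrier R. adw w \<delta> x = adw w' ((ad a ^^ count_list w a) \<delta>) x"
    using adw_collect[OF \<delta>c ac wc] by blast
  have "adw w \<delta> x = adw w' ((ad a ^^ (k + p ^ e)) \<delta>) x" using w'(2) x k by simp
  also have "\<dots> = adw w' (\<lambda>_. \<zero>) x" by (rule adw_cong[OF z' w'(1) x])
  also have "\<dots> = \<zero>" by (rule adw_zero[OF w'(1) x])
  finally show "adw w \<delta> x = \<zero>" .
qed

lemma ad_frob_linear: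
  assumes \<delta>: "\<delta> \<in> frob_linear e" and r: "r \<in> carrier R"
  shows "ad r \<delta> \<in> frob_linear e"
proof (rule frob_linearI)
  note cl = frob_linearD(1)[OF \<delta>]
  fix x assume x: "x \<in> carrier R"
  then show "ad r \<delta> x \<in> carrier R" using r cl by (simp add: commutator_def)
  fix y assume y: "y \<in> carrier R"
  have c: "\<delta> (r \<otimes> x) \<in> carrier R" "\<delta> (r \<otimes> y) \<in> carrier R" "\<delta> x \<in> carrier R" "\<delta> y \<in> carrier R" using cl x y r by auto
  have "\<delta> (r \<otimes> (x \<oplus> y)) = \<delta> (r \<otimes> x) \<oplus> \<delta> (r \<otimes> y)" "\<delta> (x \<oplus> y) = \<delta> x \<oplus> \<delta> y"
    using x y r by (simp_all add: r_distr frob_linearD(2)[OF \<delta>])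
  then show "ad r \<delta> (x \<oplus> y) = ad r \<delta> x \<oplus> ad r \<delta> y" unfolding commutator_def using c r by simp algebra
next
  note cl = frob_linearD(1)[OF \<delta>]
  fix a x assume ax: "a \<in> carrier R" "x \<in> carrier R"
  let ?q = "a [^] (p ^ e)"
  have c: "\<delta> (r \<otimes> x) \<in> carrier R" "\<delta> x \<in> carrier R" "?q \<in> carrier R" using cl ax r by auto
  have "r \<otimes> (?q \<otimes> x) = ?q \<otimes> (r \<otimes> x)" using ax r by (simp add: m_lcomm)
  then have "\<delta> (r \<otimes> (?q \<otimes> x)) = ?q \<otimes> \<delta> (r \<otimes> x)" "\<delta> (?q \<otimes> x) = ?q \<otimes> \<delta> x"
    using ax r by (simp_all add: frob_linearD(3)[OF \<delta>])
  then show "ad r \<delta> (?q \<otimes> x) = ?q \<otimes> ad r \<delta> x" unfolding commutator_def using c r by simp algebra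
qed

lemma adw_add:
  assumes "\<delta> \<in> carrier R \<rightarrow> carrier R" "\<epsilon> \<in> carrier R \<rightarrow> carrier R"
  shows "set w \<subseteq> carrier R \<Longrightarrow> x \<in> carrier R \<Longrightarrow> adw w (\<lambda>x. \<delta> x \<oplus> \<epsilon> x) x = adw w \<delta> x \<oplus> adw w \<epsilon> x"
proof (induct w arbitrary: x)
  case (Cons a w)
  then have a: "a \<in> carrier R" and w: "set w \<subseteq> carrier R" by auto
  have "ad a (adw w (\<lambda>x. \<delta> x \<oplus> \<epsilon> x)) x = ad a (\<lambda>x. adw w \<delta> x \<oplus> adw w \<epsilon> x) x"
    by (rule ad_cong[OF Cons(1)[OF w] a Cons(3)])
  moreover have "adw w \<delta> (a \<otimes> x) \<in> carrier R" "adw w \<epsilon> (a \<otimes> x) \<in> carrier R" "adw w \<delta> x \<in> carrier R" "adw w \<epsilon> x \<in> carrier R"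
    using adw_closed[OF w assms(1)] adw_closed[OF w assms(2)] a Cons(3) by auto
  ultimately show ?case unfolding adw_simps commutator_def using a by (simp add: minus_mult_distrib(1))
qed (simp add: adw_simps)

lemma adw_premult:
  assumes "s \<in> carrier R"
  shows "set w \<subseteq> carrier R \<Longrightarrow> x \<in> carrier R \<Longrightarrow> adw w (\<lambda>x. \<delta> (s \<otimes> x)) x = adw w \<delta> (s \<otimes> x)"
proof (induct w arbitrary: x)
  case (Cons a w)
  then have a: "a \<in> carrier R" and w: "set w \<subseteq> carrier R" by auto
  have "ad a (adw w (\<lambda>x. \<delta> (s \<otimes> x))) x = ad a (\<lambda>x. adw w \<delta> (s \<otimes> x)) x"
    by (rule ad_cong[OF Cons(1)[OF w] a Cons(3)])
  then show ?case unfolding adw_simps commutator_def using a assms Cons(3) by (simp add: m_lcomm[of s a x])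
qed (simp add: adw_simps)

lemma adw_postmult:
  assumes "s \<in> carrier R" "\<delta> \<in> carrier R \<rightarrow> carrier R"
  shows "set w \<subseteq> carrier R \<Longrightarrow> x \<in> carrier R \<Longrightarrow> adw w (\<lambda>x. s \<otimes> \<delta> x) x = s \<otimes> adw w \<delta> x"
proof (induct w arbitrary: x)
  case (Cons a w)
  then have a: "a \<in> carrier R" and w: "set w \<subseteq> carrier R" by auto
  have "ad a (adw w (\<lambda>x. s \<otimes> \<delta> x)) x = ad a (\<lambda>x. s \<otimes> adw w \<delta> x) x"
    by (rule ad_cong[OF Cons(1)[OF w] a Cons(3)])
  moreover have "adw w \<delta> (a \<otimes> x) \<in> carrier R" "adw w \<delta> x \<in> carrier R"
    using adw_closed[OF w assms(2)] a Cons(3) by auto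
  ultimately show ?case unfolding adw_simps commutator_def using a assms(1) by (simp add: minus_mult_distrib(2))
qed (simp add: adw_simps)

text \<open>The r that satisfy the claim are closed under sums, and under products by
  [\<delta>, r s](x) = [\<delta>, r](s x) + r [\<delta>, s](x). They include A by the definition of
  the filtration, and the p^e-th powers because these commute with \<delta>; so
  \<open>frob_gen_subring\<close> gives all of R.\<close>

lemma ad_order_filt:
  assumes A: "frob_gen 1 A" and \<delta>: "\<delta> \<in> order_filt e A (Suc n)" and r: "r \<in> carrier R"
  shows "ad r \<delta> \<in> order_filt e A n"
proof -
  note Ac = frob_genD(2)[OF A]
  have \<delta>l: "\<delta> \<in> frob_linear e" using \<delta> unfolding order_filt_def by simp
  have \<delta>c: "\<delta> \<in> carrier R \<rightarrow> carrier R" using frob_linearD(1)[OF \<delta>l] by auto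
  let ?S = "{r \<in> carrier R. \<forall>w. set w \<subseteq> A \<longrightarrow> n < length w \<longrightarrow> (\<forall>x\<in>carrier R. adw w (ad r \<delta>) x = \<zero>)}"
  have "?S = carrier R"
  proof (rule frob_gen_subring[OF A])
    show "A \<subseteq> ?S"
    proof (intro subsetI CollectI conjI allI impI ballI)
      fix a w x assume *: "a \<in> A" "set w \<subseteq> A" "n < length w" "x \<in> carrier R"
      then have "set (w @ [a]) \<subseteq> A" "Suc n < length (w @ [a])" by auto
      then show "adw w (ad a \<delta>) x = \<zero>" using \<delta> *(4) unfolding order_filt_def adw_simps(3)[symmetric] by blast
    qed (use Ac in auto)
    show "?S \<subseteq> carrier R" by auto
  next
    fix r s assume r: "r \<in> ?S" and s: "s \<in> ?S"
    then have rc: "r \<in> carrier R" and sc: "s \<in> carrier R" by auto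
    note adc = ad_closed[OF \<delta>c rc] ad_closed[OF \<delta>c sc]
    have cl: "\<delta> x \<in> carrier R" if "x \<in> carrier R" for x using \<delta>c that by auto
    have "ad (r \<oplus> s) \<delta> x = ad r \<delta> x \<oplus> ad s \<delta> x" if x: "x \<in> carrier R" for x
    proof -
      have "\<delta> ((r \<oplus> s) \<otimes> x) = \<delta> (r \<otimes> x) \<oplus> \<delta> (s \<otimes> x)" using rc sc x by (simp add: l_distr frob_linearD(2)[OF \<delta>l])
      moreover have "\<delta> (r \<otimes> x) \<in> carrier R" "\<delta> (s \<otimes> x) \<in> carrier R" "\<delta> x \<in> carrier R" using cl rc sc x by auto
      ultimately show ?thesis unfolding commutator_def using rc sc by simp algebra
    qed
    then have "adw w (ad (r \<oplus> s) \<delta>) x = adw w (ad r \<delta>) x \<oplus> adw w (ad s \<delta>) x" if "set w \<subseteq> carrier R" "x \<in> carrier R" for w x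
      using adw_cong[of "ad (r \<oplus> s) \<delta>" "\<lambda>x. ad r \<delta> x \<oplus> ad s \<delta> x" w x] adw_add[OF adc that] that by simp
    then show "r \<oplus> s \<in> ?S" using r s Ac by (simp add: subset_trans)
    have "ad (r \<otimes> s) \<delta> x = ad r \<delta> (s \<otimes> x) \<oplus> r \<otimes> ad s \<delta> x" if x: "x \<in> carrier R" for x
    proof -
      have "\<delta> (r \<otimes> s \<otimes> x) = \<delta> (r \<otimes> (s \<otimes> x))" using rc sc x by (simp add: m_assoc)
      moreover have "\<delta> (r \<otimes> (s \<otimes> x)) \<in> carrier R" "\<delta> (s \<otimes> x) \<in> carrier R" "\<delta> x \<in> carrier R" using cl rc sc x by auto
      ultimately show ?thesis unfolding commutator_def using rc sc by simp algebra
    qed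
    then have "adw w (ad (r \<otimes> s) \<delta>) x = adw w (ad r \<delta>) (s \<otimes> x) \<oplus> r \<otimes> adw w (ad s \<delta>) x"
      if w: "set w \<subseteq> carrier R" "x \<in> carrier R" for w x
    proof -
      have "adw w (ad (r \<otimes> s) \<delta>) x = adw w (\<lambda>x. ad r \<delta> (s \<otimes> x) \<oplus> r \<otimes> ad s \<delta> x) x"
        by (rule adw_cong[OF _ w]) fact
      also have "\<dots> = adw w (\<lambda>x. ad r \<delta> (s \<otimes> x)) x \<oplus> adw w (\<lambda>x. r \<otimes> ad s \<delta> x) x"
        by (rule adw_add[OF _ _ w]) (use adc rc sc in auto)
      finally show ?thesis using adw_premult[OF sc w, of "ad r \<delta>"] adw_postmult[OF rc adc(2) w] by simp
    qed
    then show "r \<otimes> s \<in> ?S" using r s Ac rc sc by (simp add: subset_trans)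
  next
    fix r assume r: "r \<in> carrier R"
    have "ad (r [^] (p ^ e)) \<delta> x = (\<lambda>_. \<zero>) x" if "x \<in> carrier R" for x
      using that r frob_linearD[OF \<delta>l] by (simp add: commutator_def minus_eq r_neg)
    then have "adw w (ad (r [^] (p ^ e)) \<delta>) x = \<zero>" if "set w \<subseteq> carrier R" "x \<in> carrier R" for w x
      using adw_cong[of "ad (r [^] (p ^ e)) \<delta>" "\<lambda>_. \<zero>" w x] adw_zero[OF that] that by simp
    then show "r [^] (p ^ e) \<in> ?S" using r Ac by (simp add: subset_trans)
  qed
  then show ?thesis using r ad_frob_linear[OF \<delta>l r] unfolding order_filt_def by auto
qed

text \<open>The elements whose multiplication commutes with \<delta> again form a subring containing
  A and all p^e-th powers.\<close>

lemma order_filt_0: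
  assumes A: "frob_gen 1 A" and \<delta>: "\<delta> \<in> order_filt e A 0"
  shows "\<delta> \<in> linear_maps R (self_module R) (self_module R)"
proof -
  note Ac = frob_genD(2)[OF A]
  have \<delta>l: "\<delta> \<in> frob_linear e" using \<delta> unfolding order_filt_def by simp
  note cl = frob_linearD(1)[OF \<delta>l]
  let ?S = "{r \<in> carrier R. \<forall>x\<in>carrier R. \<delta> (r \<otimes> x) = r \<otimes> \<delta> x}"
  have "?S = carrier R"
  proof (rule frob_gen_subring[OF A])
    show "A \<subseteq> ?S"
    proof (intro subsetI CollectI conjI ballI)
      fix a x assume *: "a \<in> A" "x \<in> carrier R"
      then have "adw [a] \<delta> x = \<zero>" using \<delta> unfolding order_filt_def by auto
      then show "\<delta> (a \<otimes> x) = a \<otimes> \<delta> x" using * Ac cl by (auto simp: adw_simps commutator_def r_right_minus_eq subset_iff)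
    qed (use Ac in auto)
  next
    fix r s assume "r \<in> ?S" "s \<in> ?S"
    then show "r \<oplus> s \<in> ?S" "r \<otimes> s \<in> ?S" using cl by (auto simp: l_distr frob_linearD(2)[OF \<delta>l] m_assoc)
  next
    fix r assume "r \<in> carrier R"
    then show "r [^] (p ^ e) \<in> ?S" by (simp add: frob_linearD(3)[OF \<delta>l])
  qed auto
  then show ?thesis using cl frob_linearD(2)[OF \<delta>l] unfolding linear_maps_def self_module_def by auto
qed

end

section \<open>Algebras over a perfect field\<close>

locale char_p_algebra = char_p_cring R p for K :: "('k, 'c) ring_scheme" and R :: "('k, 'a, 'm) module_scheme" (structure) and p :: nat +
  assumes perfect: "perfect_field K p" and alg: "algebra K R"
begin

lemma perfect_root: "k \<in> carrier K \<Longrightarrow> \<exists>b\<in>carrier K. b [^]\<^bsub>K\<^esub> (p ^ e) = k"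
proof (induct e)
  case 0
  interpret K: cring K by (rule module.axioms(1)[OF algebra.axioms(1)[OF alg]])
  show ?case using 0 by (intro bexI[of _ k]) auto
next
  case (Suc e)
  interpret K: cring K by (rule module.axioms(1)[OF algebra.axioms(1)[OF alg]])
  obtain b where b: "b \<in> carrier K" "b [^]\<^bsub>K\<^esub> (p ^ e) = k" using Suc by blast
  obtain c where c: "c \<in> carrier K" "c [^]\<^bsub>K\<^esub> p = b" using b(1) perfect unfolding perfect_field_def by blast
  then show ?case using b by (intro bexI[of _ c]) (auto simp: K.nat_pow_pow)
qed

text \<open>Perfectness enters here: a scalar has a p^e-th root in K, so it acts as multiplication
  by a p^e-th power of R. Hence Frobenius-linear maps are K-linear.\<close>

lemma smult_eq_pow:
  assumes "k \<in> carrier K"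
  shows "\<exists>r\<in>carrier R. \<forall>x\<in>carrier R. k \<odot> x = r [^] (p ^ e) \<otimes> x"
proof -
  interpret A: algebra K R by (rule alg)
  obtain b where b: "b \<in> carrier K" "b [^]\<^bsub>K\<^esub> (p ^ e) = k" using perfect_root[OF assms] by blast
  have pow: "(b \<odot> \<one>) [^] n = (b [^]\<^bsub>K\<^esub> n) \<odot> \<one>" for n :: nat
  proof (induct n)
    case (Suc n)
    have "(b \<odot> \<one>) [^] Suc n = (b [^]\<^bsub>K\<^esub> n \<odot> \<one>) \<otimes> (b \<odot> \<one>)" using Suc by simp
    also have "\<dots> = b [^]\<^bsub>K\<^esub> n \<odot> (b \<odot> \<one>)" using b(1) by (simp add: A.smult_assoc2)
    also have "\<dots> = (b [^]\<^bsub>K\<^esub> Suc n) \<odot> \<one>" using b(1) by (simp add: A.smult_assoc1)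
    finally show ?case .
  qed simp
  have "k \<odot> x = (b \<odot> \<one>) [^] (p ^ e) \<otimes> x" if "x \<in> carrier R" for x
    unfolding pow b(2) using that assms by (simp add: A.smult_assoc2)
  then show ?thesis using b(1) by (intro bexI[of _ "b \<odot> \<one>"]) auto
qed

lemma frob_linear_K_linear:
  assumes \<delta>: "\<delta> \<in> frob_linear e"
  shows "\<delta> \<in> linear_maps K R R"
proof -
  have "\<delta> (k \<odot> x) = k \<odot> \<delta> x" if kx: "k \<in> carrier K" "x \<in> carrier R" for k x
  proof -
    obtain r where r: "r \<in> carrier R" "\<forall>x\<in>carrier R. k \<odot> x = r [^] (p ^ e) \<otimes> x" using smult_eq_pow[OF kx(1)] by blast
    then show ?thesis using frob_linearD[OF \<delta>] kx(2) by simp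
  qed
  then show ?thesis using frob_linearD[OF \<delta>] unfolding linear_maps_def by auto
qed

lemma order_filt_diff_ops:
  assumes A: "frob_gen 1 A"
  shows "order_filt e A n \<subseteq> diff_ops K R n"
proof (induct n)
  case 0
  show ?case using order_filt_0[OF A] by auto
next
  case (Suc n)
  show ?case
  proof
    fix \<delta> assume \<delta>: "\<delta> \<in> order_filt e A (Suc n)"
    then have "\<delta> \<in> linear_maps K R R" using frob_linear_K_linear unfolding order_filt_def by blast
    then show "\<delta> \<in> diff_ops K R (Suc n)" using ad_order_filt[OF A \<delta>] Suc by auto
  qed
qed

lemma frob_linear_diff_ops:
  assumes A: "frob_gen 1 A" and "card A * (p ^ e - 1) \<le> n" and \<delta>: "\<delta> \<in> frob_linear e"
  shows "\<delta> \<in> diff_ops K R n"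
proof -
  have "\<delta> \<in> order_filt e A (card A * (p ^ e - 1))" by (rule frob_linear_order_filt[OF frob_genD[OF A] \<delta>])
  then have "\<delta> \<in> order_filt e A n" using assms(2) unfolding order_filt_def by auto
  then show ?thesis using order_filt_diff_ops[OF A] by blast
qed

text \<open>If \<open>\<eta> = [\<delta>, s]\<close> commutes with \<open>s\<close>, then \<open>[\<delta>, s\<^bsup>p\<^esup>] = p s\<^bsup>p-1\<^esup> \<eta> = 0\<close>.\<close>

lemma diff_ops_frob_linear: "\<delta> \<in> diff_ops K R n \<Longrightarrow> \<delta> \<in> frob_linear n"
proof (induct n arbitrary: \<delta>)
  case 0
  then show ?case unfolding frob_linear_def by (auto simp: linear_maps_def self_module_def)
next
  case (Suc n)
  have lin: "\<delta> \<in> carrier R \<rightarrow> carrier R" "\<And>x y. x \<in> carrier R \<Longrightarrow> y \<in> carrier R \<Longrightarrow> \<delta> (x \<oplus> y) = \<delta> x \<oplus> \<delta> y"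
    using Suc(2) by (auto simp: linear_maps_def)
  show ?case
  proof (rule frob_linearI)
    fix r x assume r: "r \<in> carrier R" and x: "x \<in> carrier R"
    \<comment> \<open>By induction the commutator with s is linear over p^n-th powers, hence
      commutes with multiplication by every power of s. The resulting exponent p^(n+1) is crude, but
      the application asks only for some level.\<close>
    define s where "s = r [^] (p ^ n)"
    have s: "s \<in> carrier R" unfolding s_def using r by simp
    define \<eta> where "\<eta> = ad s \<delta>"
    have \<eta>: "\<eta> \<in> frob_linear n" unfolding \<eta>_def using Suc s by auto
    note \<eta>c = frob_linearD(1)[OF \<eta>]
    have \<delta>c: "\<And>y. y \<in> carrier R \<Longrightarrow> \<delta> y \<in> carrier R" using lin(1) by auto
    have \<delta>s: "\<delta> (s \<otimes> y) = s \<otimes> \<delta> y \<oplus> \<eta> y" if "y \<in> carrier R" for y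
    proof -
      have "\<delta> (s \<otimes> y) \<in> carrier R" "\<delta> y \<in> carrier R" using \<delta>c s that by auto
      then show ?thesis unfolding \<eta>_def commutator_def using s by algebra
    qed
    have "\<delta> (s [^] Suc j \<otimes> x) = s [^] Suc j \<otimes> \<delta> x \<oplus> add_pow R (Suc j) (s [^] j \<otimes> \<eta> x)" for j
    proof (induct j)
      case 0
      show ?case using \<delta>s[OF x] s \<eta>c[OF x] by (simp add: add.nat_pow_Suc)
    next
      case (Suc j)
      have "\<eta> (s [^] Suc j \<otimes> x) = s [^] Suc j \<otimes> \<eta> x"
      proof -
        have "s [^] Suc j = (r [^] Suc j) [^] (p ^ n)" unfolding s_def using r by (simp only: nat_pow_pow mult.commute)
        then show ?thesis using frob_linearD(3)[OF \<eta>, of "r [^] Suc j" x] r x by simp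
      qed
      moreover have "s [^] Suc (Suc j) \<otimes> x = s \<otimes> (s [^] Suc j \<otimes> x)" using s x by (simp add: m_ac)
      ultimately have "\<delta> (s [^] Suc (Suc j) \<otimes> x) = s \<otimes> \<delta> (s [^] Suc j \<otimes> x) \<oplus> s [^] Suc j \<otimes> \<eta> x"
        using \<delta>s[of "s [^] Suc j \<otimes> x"] s x by (simp only: m_closed nat_pow_closed)
      also have "\<dots> = s \<otimes> (s [^] Suc j \<otimes> \<delta> x) \<oplus> (s \<otimes> add_pow R (Suc j) (s [^] j \<otimes> \<eta> x) \<oplus> s [^] Suc j \<otimes> \<eta> x)"
        unfolding Suc using s x \<delta>c[OF x] \<eta>c[OF x] by (simp add: r_distr a_assoc del: nat_pow_Suc add.nat_pow_Suc)
      also have "s \<otimes> add_pow R (Suc j) (s [^] j \<otimes> \<eta> x) = add_pow R (Suc j) (s [^] Suc j \<otimes> \<eta> x)"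
        using s \<eta>c[OF x] add_pow_rdistr[of s "s [^] j \<otimes> \<eta> x" "Suc j"] by (simp add: m_ac del: add.nat_pow_Suc)
      also have "add_pow R (Suc j) (s [^] Suc j \<otimes> \<eta> x) \<oplus> s [^] Suc j \<otimes> \<eta> x = add_pow R (Suc (Suc j)) (s [^] Suc j \<otimes> \<eta> x)"
        by simp
      also have "s \<otimes> (s [^] Suc j \<otimes> \<delta> x) = s [^] Suc (Suc j) \<otimes> \<delta> x" using s \<delta>c[OF x] by (simp add: m_ac)
      finally show ?case .
    qed
    moreover obtain k where k: "p = Suc k" using p_gt_0 gr0_implies_Suc by blast
    ultimately have "\<delta> (s [^] p \<otimes> x) = s [^] p \<otimes> \<delta> x \<oplus> add_pow R p (s [^] k \<otimes> \<eta> x)" by simp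
    then have "\<delta> (s [^] p \<otimes> x) = s [^] p \<otimes> \<delta> x" using p_torsion s \<eta>c[OF x] \<delta>c[OF x] by simp
    then show "\<delta> (r [^] (p ^ Suc n) \<otimes> x) = r [^] (p ^ Suc n) \<otimes> \<delta> x"
      unfolding s_def using r by (simp add: nat_pow_pow mult.commute)
  qed (use lin in auto)
qed

end

section \<open>Symbolic powers and the theorem\<close>

lemma (in cring) ideal_pow_Suc: "J [^]\<^bsub>ideals_set R\<^esub> Suc n = (J [^]\<^bsub>ideals_set R\<^esub> n) \<cdot> J"
  by (simp add: nat_pow_def ideals_set_def)

lemma (in cring) ideal_pow_0: "J [^]\<^bsub>ideals_set R\<^esub> (0::nat) = carrier R"
  by (simp add: nat_pow_def ideals_set_def)

lemma (in cring) ideal_pow_ideal: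
  assumes "ideal J R"
  shows "ideal (J [^]\<^bsub>ideals_set R\<^esub> (n::nat)) R"
  by (induct n) (simp_all only: ideal_pow_0 ideal_pow_Suc oneideal ideal_prod_is_ideal assms)

text \<open>Estimates hold along powers of p; rounding n up costs at most a factor p and so keeps
  the comparison linear.\<close>

lemma (in char_p_cring) ex_power_between:
  assumes "n > 0"
  shows "\<exists>k. n \<le> p ^ k \<and> p ^ k \<le> p * n"
proof -
  have "n < p ^ n" by (rule power_gt_expt) (use p_ge_2 in simp)
  then have ex: "\<exists>k. n \<le> p ^ k" by (intro exI[of _ n]) simp
  define k where "k = (LEAST k. n \<le> p ^ k)"
  have k: "n \<le> p ^ k" unfolding k_def by (rule LeastI_ex[OF ex])
  have "p ^ k \<le> p * n"
  proof (cases k)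
    case 0
    have "1 \<le> p * n" using assms p_gt_0 by (metis Suc_leI nat_0_less_mult_iff One_nat_def)
    then show ?thesis using 0 by simp
  next
    case (Suc j)
    then have "\<not> n \<le> p ^ j" using not_less_Least[of j "\<lambda>k. n \<le> p ^ k"] unfolding k_def[symmetric] by simp
    then have "p ^ j \<le> n" by simp
    then show ?thesis unfolding Suc power_Suc by (rule mult_le_mono2)
  qed
  then show ?thesis using k by blast
qed

context generators
begin

lemma mon_in_ideal_pow: "\<alpha> \<in> expo \<mu> n \<Longrightarrow> mon \<alpha> \<in> Idl (x ` {..<\<mu>}) [^]\<^bsub>ideals_set R\<^esub> n"
proof (induct n arbitrary: \<alpha>)
  case 0
  then show ?case unfolding ideal_pow_0 by simp
next
  case (Suc n)
  obtain i \<beta> where i: "i < \<mu>" "\<beta> \<in> expo \<mu> n" "\<alpha> = (\<lambda>j. \<beta> j + (if j = i then 1 else 0))"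
    using expo_Suc_cases[OF Suc(2)] by blast
  have "x i \<in> Idl (x ` {..<\<mu>})" using i(1) x_closed by (intro subsetD[OF genideal_self]) auto
  then show ?case unfolding ideal_pow_Suc i(3) mon_add mon_single[OF i(1)]
    using Suc(1)[OF i(2)] by (intro ideal_prod.prod)
qed

lemma ideal_pow_sub_G: "Idl (x ` {..<\<mu>}) [^]\<^bsub>ideals_set R\<^esub> n \<subseteq> G n"
proof (induct n)
  case 0
  show ?case unfolding ideal_pow_0 G_0 by simp
next
  case (Suc n)
  show ?case
  proof
    fix y assume "y \<in> Idl (x ` {..<\<mu>}) [^]\<^bsub>ideals_set R\<^esub> Suc n"
    then show "y \<in> G (Suc n)" unfolding ideal_pow_Suc
    proof (induct y rule: ideal_prod.induct)
      case (prod i j)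
      then show ?case using G_mult[of i n j 1] Suc genideal_x_G by auto
    qed (rule ideal_addD[OF G_ideal])
  qed
qed

text \<open>A monomial of degree \<mu> t + 1 has some exponent at least t.\<close>

lemma G_pigeonhole:
  assumes N: "ideal N R" and t: "\<And>i. i < \<mu> \<Longrightarrow> x i [^] (t::nat) \<in> N"
  shows "G (\<mu> * t + 1) \<subseteq> N"
proof (rule G_least[OF N])
  fix \<alpha> assume \<alpha>: "\<alpha> \<in> expo \<mu> (\<mu> * t + 1)"
  have "\<exists>i<\<mu>. t \<le> \<alpha> i"
  proof (rule ccontr)
    assume "\<not> ?thesis"
    then have "edeg \<mu> \<alpha> \<le> of_nat (card {..<\<mu>}) * t" unfolding edeg_def by (intro sum_bounded_above) force
    then show False using \<alpha> unfolding expo_def by simp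
  qed
  then obtain i where i: "i < \<mu>" "t \<le> \<alpha> i" by blast
  have "\<alpha> = (\<lambda>j. t * (if j = i then 1 else 0) + (if j = i then \<alpha> j - t else \<alpha> j))" using i(2) by auto
  then have "mon \<alpha> = x i [^] t \<otimes> mon (\<lambda>j. if j = i then \<alpha> j - t else \<alpha> j)"
    using mon_add[of "\<lambda>j. t * (if j = i then 1 else 0)" "\<lambda>j. if j = i then \<alpha> j - t else \<alpha> j"]
      mon_pow[of t "\<lambda>j. if j = i then 1 else 0"] mon_single[OF i(1)] by metis
  then show "mon \<alpha> \<in> N" using t[OF i(1)] ideal.I_r_closed[OF N] by simp
qed

end

section \<open>Saturation and Krull's intersection theorem\<close>

locale char_p_prime_generators = char_p_prime R p P + generators R x \<mu>
  for R :: "('a, 'b) ring_scheme" (structure) and p :: nat and P :: "'a set" and x :: "nat \<Rightarrow> 'a" and \<mu> :: nat +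
  assumes P_gen: "P = Idl (x ` {..<\<mu>})" and noeth: "noetherian_ring R"
begin

text \<open>For an ideal J this is the contraction to R of its extension to T, expressed without
  T.\<close>

definition sat :: "'a set \<Rightarrow> 'a set" where
  "sat J = {y \<in> carrier R. \<exists>s\<in>Q. s \<otimes> y \<in> J}"

lemma sat_ideal:
  assumes J: "ideal J R"
  shows "ideal (sat J) R"
proof (rule cring_idealI)
  show "\<zero> \<in> sat J" unfolding sat_def using one_Q ideal_zeroD[OF J] by (intro CollectI conjI bexI[of _ \<one>]) auto
next
  fix a b assume "a \<in> sat J" "b \<in> sat J"
  then obtain s t where *: "a \<in> carrier R" "b \<in> carrier R" "s \<in> Q" "t \<in> Q" "s \<otimes> a \<in> J" "t \<otimes> b \<in> J" unfolding sat_def by blast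
  have c: "s \<in> carrier R" "t \<in> carrier R" using * by auto
  have "s \<otimes> t \<otimes> (a \<oplus> b) = t \<otimes> (s \<otimes> a) \<oplus> s \<otimes> (t \<otimes> b)" using * c by (simp add: r_distr m_ac)
  then have "s \<otimes> t \<otimes> (a \<oplus> b) \<in> J" using * c ideal_addD[OF J] ideal.I_l_closed[OF J] by simp
  then show "a \<oplus> b \<in> sat J" unfolding sat_def using * compl_mult[OF *(3,4)] by blast
next
  fix r a assume r: "r \<in> carrier R" and "a \<in> sat J"
  then obtain s where *: "a \<in> carrier R" "s \<in> Q" "s \<otimes> a \<in> J" unfolding sat_def by blast
  have "s \<otimes> (r \<otimes> a) = r \<otimes> (s \<otimes> a)" using * r by (simp add: m_lcomm)
  then have "s \<otimes> (r \<otimes> a) \<in> J" using * r ideal.I_l_closed[OF J] by simp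
  then show "r \<otimes> a \<in> sat J" unfolding sat_def using * r by blast
qed (auto simp: sat_def)

lemma sat_sat: "s \<in> Q \<Longrightarrow> y \<in> carrier R \<Longrightarrow> s \<otimes> y \<in> sat J \<Longrightarrow> y \<in> sat J"
proof -
  assume *: "s \<in> Q" "y \<in> carrier R" "s \<otimes> y \<in> sat J"
  then obtain t where t: "t \<in> Q" "t \<otimes> (s \<otimes> y) \<in> J" unfolding sat_def by blast
  have "t \<otimes> s \<otimes> y \<in> J" using t * by (simp add: m_assoc)
  then show ?thesis unfolding sat_def using * compl_mult[OF t(1) *(1)] by blast
qed

lemma sat_self: "ideal J R \<Longrightarrow> J \<subseteq> sat J"
proof
  fix y assume "ideal J R" "y \<in> J"
  moreover from this have "y \<in> carrier R" by (rule ideal.Icarr)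
  ultimately show "y \<in> sat J" unfolding sat_def using one_Q by (intro CollectI conjI bexI[of _ \<one>]) auto
qed

text \<open>Krull's intersection theorem for \<open>R\<^sub>P\<close>, stated in \<open>R\<close> by means of saturated ideals.\<close>

lemma krull:
  assumes f: "f \<in> carrier R" "\<And>n. f \<in> sat (G n)"
  shows "\<exists>s\<in>Q. s \<otimes> f = \<zero>"
proof -
  have P: "ideal P R" by (rule is_ideal)
  define I where "I = (\<Inter>n. sat (G n))"
  have I: "ideal I R" unfolding I_def by (rule i_Intersect) (use sat_ideal[OF G_ideal] in auto)
  have fI: "f \<in> I" unfolding I_def using f(2) by blast
  have I_sat: "y \<in> I" if "s \<in> Q" "y \<in> carrier R" "s \<otimes> y \<in> I" for s y
    using sat_sat[OF that(1,2)] that(3) unfolding I_def by blast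
  have PI: "ideal (P \<cdot> I) R" by (rule ideal_prod_is_ideal[OF P I])
  \<comment> \<open>The aim is I = B, that is, equality of I and P I after localization; a Nakayama
    argument then finishes.\<close>
  define B where "B = sat (P \<cdot> I)"
  have B: "ideal B R" "P \<cdot> I \<subseteq> B" unfolding B_def using sat_ideal[OF PI] sat_self[OF PI] by auto
  have B_sat: "y \<in> B" if "s \<in> Q" "y \<in> carrier R" "s \<otimes> y \<in> B" for s y
    using sat_sat[OF that(1,2)] that(3) unfolding B_def by blast
  have BI: "B \<subseteq> I"
  proof
    fix y assume "y \<in> B"
    then obtain s where s: "y \<in> carrier R" "s \<in> Q" "s \<otimes> y \<in> P \<cdot> I" unfolding B_def sat_def by blast
    then have "s \<otimes> y \<in> I" using ideal_prod_inter[OF P I] by blast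
    then show "y \<in> I" by (rule I_sat[OF s(2,1)])
  qed
  \<comment> \<open>A maximal N meeting I exactly in B will be shown to contain a power of P. Being
    saturated, it then contains I, which forces I = B.\<close>
  let ?F = "{N. ideal N R \<and> B \<subseteq> N \<and> N \<inter> I = B}"
  have "\<exists>N\<in>?F. \<forall>X\<in>?F. N \<subseteq> X \<longrightarrow> X = N"
  proof (rule subset_Zorn)
    fix C assume C: "subset.chain ?F C"
    show "\<exists>U\<in>?F. \<forall>X\<in>C. X \<subseteq> U"
    proof (cases "C = {}")
      case True
      then show ?thesis using B(1) BI by (intro bexI[of _ B]) auto
    next
      case False
      have "subset.chain {I. ideal I R} C" using C unfolding subset_chain_def by auto
      then have "\<Union>C \<in> C" by (rule noetherian_ring.ideal_chain_is_trivial[OF noeth False])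
      then show ?thesis using C unfolding subset_chain_def by (intro bexI[of _ "\<Union>C"]) auto
    qed
  qed
  then obtain N where NF: "N \<in> ?F" and max: "\<forall>X\<in>?F. N \<subseteq> X \<longrightarrow> X = N" by (elim bexE)
  have N: "ideal N R" "B \<subseteq> N" "N \<inter> I = B" using NF by simp_all
  note Nc = ideal_subD[OF N(1)]
  \<comment> \<open>Maximality as a membership test: w is already in N if adjoining it does not
    enlarge the intersection with I.\<close>
  have absorb: "w \<in> N" if w: "w \<in> carrier R" and step: "\<And>r n. r \<in> carrier R \<Longrightarrow> n \<in> N \<Longrightarrow> r \<otimes> w \<oplus> n \<in> I \<Longrightarrow> r \<otimes> w \<oplus> n \<in> B" for w
  proof -
    have sub: "insert w N \<subseteq> carrier R" using w Nc by auto
    let ?X = "Idl (insert w N)"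
    have X: "ideal ?X R" "insert w N \<subseteq> ?X" by (rule genideal_ideal[OF sub], rule genideal_self[OF sub])
    have NN: "Idl N = N" using genideal_minimal[OF N(1) subset_refl] genideal_self[OF Nc] by blast
    have "?X \<inter> I \<subseteq> B"
    proof
      fix y assume y: "y \<in> ?X \<inter> I"
      then obtain r n where "r \<in> carrier R" "n \<in> N" "y = r \<otimes> w \<oplus> n" using genideal_insertE[OF w Nc, of y] NN by auto
      then show "y \<in> B" using step y by auto
    qed
    moreover have "N \<subseteq> ?X" "B \<subseteq> ?X" using X(2) N(2) by auto
    ultimately have "?X \<in> ?F" using X(1) BI by (simp add: subset_antisym)
    then have "?X = N" using max \<open>N \<subseteq> ?X\<close> by blast
    then show ?thesis using X(2) by blast
  qed
  have N_sat: "y \<in> N" if s: "s \<in> Q" "y \<in> carrier R" "s \<otimes> y \<in> N" for s y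
  proof (rule absorb[OF s(2)])
    fix r n assume r: "r \<in> carrier R" and n: "n \<in> N" and yI: "r \<otimes> y \<oplus> n \<in> I"
    have c: "n \<in> carrier R" "s \<in> carrier R" using n Nc s(1) by auto
    have "s \<otimes> (r \<otimes> y \<oplus> n) = r \<otimes> (s \<otimes> y) \<oplus> s \<otimes> n" using r c s(2) by (simp add: r_distr m_lcomm)
    then have "s \<otimes> (r \<otimes> y \<oplus> n) \<in> N" using s(3) r n c ideal_addD[OF N(1)] ideal.I_l_closed[OF N(1)] by simp
    moreover have "s \<otimes> (r \<otimes> y \<oplus> n) \<in> I" using yI c ideal.I_l_closed[OF I] by simp
    ultimately have "s \<otimes> (r \<otimes> y \<oplus> n) \<in> B" using N(3) by blast
    then show "r \<otimes> y \<oplus> n \<in> B" using B_sat[OF s(1)] r c s(2) by simp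
  qed
  have P_pow: "\<exists>i::nat. a [^] i \<in> N" if a: "a \<in> P" for a
  proof -
    have ac: "a \<in> carrier R" using a a_Hcarr by blast
    \<comment> \<open>The colon ideals (N : a^i) stabilise. At such an i, any y = r a^i + n in I has
      a y in P I, inside N, so r a^(i+1) and hence r a^i lie in N, and y is in N \<inter> I =
      B.\<close>
    define Ni where "Ni = (\<lambda>i::nat. {y \<in> carrier R. \<forall>s\<in>{a [^] i}. s \<otimes> y \<in> N})"
    have Ni: "ideal (Ni i) R" for i unfolding Ni_def by (rule ideal_colon[OF N(1)]) (use ac in auto)
    have Suc: "Ni i \<subseteq> Ni (Suc i)" for i
    proof
      fix y assume y: "y \<in> Ni i"
      then have "a [^] Suc i \<otimes> y = a \<otimes> (a [^] i \<otimes> y)" using ac by (simp add: Ni_def m_ac)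
      then show "y \<in> Ni (Suc i)" using y ac ideal.I_l_closed[OF N(1)] unfolding Ni_def by simp
    qed
    have mono: "i \<le> j \<Longrightarrow> Ni i \<subseteq> Ni j" for i j by (rule lift_Suc_mono_le[of Ni]) (use Suc in auto)
    have "subset.chain {I. ideal I R} (range Ni)"
      unfolding subset_chain_def
    proof (intro conjI ballI)
      show "range Ni \<subseteq> {I. ideal I R}" using Ni by auto
      fix X Y assume "X \<in> range Ni" "Y \<in> range Ni"
      then obtain i j where "X = Ni i" "Y = Ni j" by auto
      then show "X \<subseteq> Y \<or> Y \<subseteq> X" using mono[of i j] mono[of j i] linear[of i j] by blast
    qed
    then have "\<Union>(range Ni) \<in> range Ni" by (intro noetherian_ring.ideal_chain_is_trivial[OF noeth]) auto
    then obtain i where "\<Union>(range Ni) = Ni i" by auto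
    then have i: "Ni (Suc i) \<subseteq> Ni i" by blast
    have "a [^] i \<in> N"
    proof (rule absorb)
      show aic: "a [^] i \<in> carrier R" using ac by simp
      fix r n assume r: "r \<in> carrier R" and n: "n \<in> N" and yI: "r \<otimes> a [^] i \<oplus> n \<in> I"
      have nc: "n \<in> carrier R" using n Nc by auto
      have "a \<otimes> (r \<otimes> a [^] i \<oplus> n) \<in> B" using B(2) ideal_prod.prod[OF a yI] by blast
      then have "a \<otimes> (r \<otimes> a [^] i \<oplus> n) \<ominus> a \<otimes> n \<in> N"
        using N(2) n ac ideal_minusD[OF N(1)] ideal.I_l_closed[OF N(1)] by blast
      moreover have "a \<otimes> (r \<otimes> a [^] i \<oplus> n) \<ominus> a \<otimes> n = a [^] Suc i \<otimes> r"
      proof -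
        have "a \<otimes> (r \<otimes> a [^] i \<oplus> n) \<ominus> a \<otimes> n = a \<otimes> (r \<otimes> a [^] i)" using ac aic r nc by algebra
        then show ?thesis using ac r by (simp add: m_ac)
      qed
      ultimately have "r \<in> Ni (Suc i)" unfolding Ni_def using r by simp
      then have "a [^] i \<otimes> r \<in> N" using i unfolding Ni_def by auto
      then have "r \<otimes> a [^] i \<oplus> n \<in> N" using n r aic m_comm[of r "a [^] i"] ideal_addD[OF N(1)] by simp
      then show "r \<otimes> a [^] i \<oplus> n \<in> B" using yI N(3) by blast
    qed
    then show ?thesis by blast
  qed
  have "\<exists>t::nat. \<forall>i<\<mu>. x i [^] t \<in> N"
  proof -
    have "x i \<in> P" if "i < \<mu>" for i unfolding P_gen using that x_closed by (intro subsetD[OF genideal_self]) auto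
    then have "\<forall>i. \<exists>t::nat. i < \<mu> \<longrightarrow> x i [^] t \<in> N" using P_pow by blast
    then obtain t :: "nat \<Rightarrow> nat" where t: "\<And>i. i < \<mu> \<Longrightarrow> x i [^] t i \<in> N" by metis
    have "x i [^] (\<Sum>j<\<mu>. t j) \<in> N" if i: "i < \<mu>" for i
    proof -
      have "t i \<le> (\<Sum>j<\<mu>. t j)" using i by (intro member_le_sum) auto
      then obtain k where "(\<Sum>j<\<mu>. t j) = t i + k" using le_Suc_ex by blast
      then have "x i [^] (\<Sum>j<\<mu>. t j) = x i [^] t i \<otimes> x i [^] k" using x_closed[OF i] by (simp add: nat_pow_mult)
      then show ?thesis using t[OF i] x_closed[OF i] ideal.I_r_closed[OF N(1)] by simp
    qed
    then show ?thesis by blast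
  qed
  then obtain t :: nat where "\<And>i. i < \<mu> \<Longrightarrow> x i [^] t \<in> N" by blast
  then have GN: "G (\<mu> * t + 1) \<subseteq> N" by (rule G_pigeonhole[OF N(1)])
  have "I \<subseteq> N"
  proof
    fix y assume "y \<in> I"
    then have "y \<in> sat (G (\<mu> * t + 1))" unfolding I_def by blast
    then obtain s where "s \<in> Q" "y \<in> carrier R" "s \<otimes> y \<in> N" using GN unfolding sat_def by blast
    then show "y \<in> N" by (rule N_sat)
  qed
  then have IB: "I \<subseteq> B" using N(3) by blast
  obtain A where A: "A \<subseteq> carrier R" "finite A" "I = Idl A" using noetherian_ring.finetely_gen[OF noeth I] by blast
  have AI: "A \<subseteq> I" unfolding A(3) by (rule genideal_self[OF A(1)])
  have "D \<subseteq> A \<Longrightarrow> \<exists>s\<in>Q. \<forall>g\<in>D. s \<otimes> g \<in> P \<cdot> I" if "finite D" for D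
    using that
  proof (induct D rule: finite_induct)
    case empty
    show ?case using one_Q by blast
  next
    case (insert g D)
    then have gD: "g \<in> A" "D \<subseteq> A" by auto
    from insert(3)[OF gD(2)] obtain s where s: "s \<in> Q" "\<forall>g\<in>D. s \<otimes> g \<in> P \<cdot> I" by (elim bexE)
    have "g \<in> B" using gD(1) AI IB by blast
    then obtain t where t: "t \<in> Q" "t \<otimes> g \<in> P \<cdot> I" unfolding B_def sat_def by blast
    have "s \<otimes> t \<otimes> h \<in> P \<cdot> I" if "h \<in> insert g D" for h
    proof -
      have c: "h \<in> carrier R" "s \<in> carrier R" "t \<in> carrier R" using that gD A(1) s(1) t(1) by auto
      show ?thesis
      proof (cases "h = g")
        case True
        then have "s \<otimes> (t \<otimes> h) \<in> P \<cdot> I" using t(2) c(2) ideal.I_l_closed[OF PI] by blast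
        then show ?thesis using c by (simp only: m_assoc)
      next
        case False
        then have "t \<otimes> (s \<otimes> h) \<in> P \<cdot> I" using that s(2) c(3) ideal.I_l_closed[OF PI] by blast
        then show ?thesis using c by (simp only: m_assoc m_lcomm)
      qed
    qed
    then show ?case using compl_mult[OF s(1) t(1)] by blast
  qed
  from this[OF A(2) subset_refl] obtain s where s: "s \<in> Q" "\<forall>g\<in>A. s \<otimes> g \<in> P \<cdot> I" by (elim bexE)
  have sc: "s \<in> carrier R" using s(1) by simp
  obtain fs where fs: "set fs = A" using finite_list[OF A(2)] by blast
  have fsc: "set fs \<subseteq> carrier R" using fs A(1) by simp
  note Z = zeroideal
  have E: "ideal (elim_set P {\<zero>} fs) R" by (rule elim_set_ideal[OF P Z fsc])
  have "I \<subseteq> {y \<in> carrier R. \<forall>l\<in>P. l \<otimes> y \<in> elim_set P {\<zero>} fs}" unfolding A(3)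
    by (rule genideal_minimal[OF ideal_colon[OF E ideal_subD[OF P]]])
      (use A(1) fs elim_set_gen(1)[OF P Z fsc] in auto)
  then have LI: "l \<otimes> y \<in> elim_set P {\<zero>} fs" if "l \<in> P" "y \<in> I" for l y using that by blast
  have PIE: "y \<in> elim_set P {\<zero>} fs" if "y \<in> P \<cdot> I" for y
    using that by (induct y rule: ideal_prod.induct) (auto intro: LI ideal_addD[OF E])
  \<comment> \<open>Nakayama through \<open>elimination\<close> with L = P, N = 0 and c = z = s: the
    inclusion s I \<subseteq> P I yields d with d I = 0, congruent modulo P to a power of s and
    hence outside P.\<close>
  have "\<exists>d\<in>carrier R. d \<ominus> s [^] ((1::nat) * (2 ^ length fs - 1)) \<in> P \<and> (\<forall>g\<in>set fs. d \<otimes> g \<in> {\<zero>})"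
  proof (rule elimination[OF P Z sc fsc sc])
    show "s \<ominus> s [^] (1::nat) \<in> P" using sc ideal_zeroD[OF P] by (simp add: minus_eq r_neg)
  qed (use s(2) fs PIE in blast)
  then obtain d where d: "d \<in> carrier R" "d \<ominus> s [^] ((1::nat) * (2 ^ length fs - 1)) \<in> P" "\<forall>g\<in>A. d \<otimes> g = \<zero>"
    using fs by auto
  have "d \<notin> P"
  proof
    let ?s = "s [^] ((1::nat) * (2 ^ length fs - 1))"
    assume "d \<in> P"
    then have "d \<ominus> (d \<ominus> ?s) \<in> P" using d(2) ideal_minusD[OF P] by blast
    moreover have "d \<ominus> (d \<ominus> ?s) = ?s"
    proof -
      have "?s \<in> carrier R" using sc by simp
      then show ?thesis using d(1) by algebra
    qed
    ultimately show False using pow_P[OF sc] s(1) by auto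
  qed
  then have dQ: "d \<in> Q" using d(1) by simp
  have "I \<subseteq> {y \<in> carrier R. \<forall>s\<in>{d}. s \<otimes> y \<in> {\<zero>}}" unfolding A(3)
    by (rule genideal_minimal[OF ideal_colon[OF Z]]) (use d A(1) in auto)
  then have "d \<otimes> f = \<zero>" using fI by auto
  then show ?thesis using dQ by blast
qed

text \<open>Brings symbolic powers into the form in which \<open>krull\<close> is stated.\<close>

lemma symbolic_power_sat: "symbolic_power R P n \<subseteq> sat (G n)"
proof
  fix f assume "f \<in> symbolic_power R P n"
  then have f: "f \<in> carrier R" "\<iota> f \<in> Idl\<^bsub>T\<^esub> (\<iota> ` (P [^]\<^bsub>ideals_set R\<^esub> n))" unfolding symbolic_power_def by auto
  have J: "ideal (P [^]\<^bsub>ideals_set R\<^esub> n) R" by (rule ideal_pow_ideal[OF is_ideal])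
  from f(2) obtain b s where bs: "\<iota> f = frac b s" "b \<in> P [^]\<^bsub>ideals_set R\<^esub> n" "s \<in> Q" unfolding genideal_iota[OF J] by blast
  have b: "b \<in> G n" "b \<in> carrier R" using bs(2) ideal_pow_sub_G[of n] G_sub[of n] P_gen by auto
  obtain u where u: "u \<in> Q" "u \<otimes> (f \<otimes> s) = u \<otimes> b" using bs(1) iota_eq_frac[OF f(1) b(2) bs(3)] by blast
  have "u \<otimes> s \<otimes> f = u \<otimes> (f \<otimes> s)" using u(1) bs(3) f(1) by (simp add: m_ac)
  then have "u \<otimes> s \<otimes> f \<in> G n" using u b(1) ideal.I_l_closed[OF G_ideal] by simp
  then show "f \<in> sat (G n)" unfolding sat_def using f(1) compl_mult[OF u(1) bs(3)] by blast
qed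

lemma M_T: "Idl\<^bsub>T\<^esub> ((\<lambda>i. \<iota> (x i)) ` {..<\<mu>}) = {frac b t | b t. b \<in> P \<and> t \<in> Q}"
proof -
  have "x ` {..<\<mu>} \<subseteq> carrier R" using x_closed by auto
  from genideal_iota_gen[OF this] show ?thesis unfolding image_image P_gen[symmetric] .
qed

lemma char_p_local_T: "char_p_local T p (\<lambda>i. \<iota> (x i)) \<mu>"
proof -
  have "generators T (\<lambda>i. \<iota> (x i)) \<mu>"
    by (intro generators.intro generators_axioms.intro cring_localization iota_closed x_closed)
  then show ?thesis
  proof (intro char_p_local.intro char_p_T char_p_local_axioms.intro)
    show "\<one>\<^bsub>T\<^esub> \<notin> Idl\<^bsub>T\<^esub> ((\<lambda>i. \<iota> (x i)) ` {..<\<mu>})" unfolding M_T by (rule max_proper)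
    fix a assume "a \<in> carrier T" "a \<notin> Idl\<^bsub>T\<^esub> ((\<lambda>i. \<iota> (x i)) ` {..<\<mu>})"
    then show "a \<in> Units T" unfolding M_T by (rule unit_T)
  qed
qed

sublocale L: char_p_local T p "\<lambda>i. \<iota> (x i)" \<mu>
  by (rule char_p_local_T)

text \<open>Monomials in the \<open>\<iota> (x i)\<close> are images of monomials in P^n, so powers
  of the maximal ideal of T lie in the extensions of the powers of P.\<close>

lemma G_T_symbolic: "f \<in> carrier R \<Longrightarrow> \<iota> f \<in> L.G n \<Longrightarrow> f \<in> symbolic_power R P n"
proof -
  assume f: "f \<in> carrier R" "\<iota> f \<in> L.G n"
  interpret h: ring_hom_cring R T \<iota> by (rule iota_hom)
  let ?J = "P [^]\<^bsub>ideals_set R\<^esub> n"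
  have sub: "\<iota> ` ?J \<subseteq> carrier T" by (intro image_subsetI iota_closed ideal.Icarr[OF ideal_pow_ideal[OF is_ideal]])
  have "L.mon \<alpha> = \<iota> (mon \<alpha>)" for \<alpha>
  proof -
    have "\<iota> (mon \<alpha>) = (\<Otimes>\<^bsub>T\<^esub>i\<in>{..<\<mu>}. (\<iota> \<circ> (\<lambda>i. x i [^] \<alpha> i)) i)"
      unfolding mon_def using x_closed by (intro h.hom_finprod) auto
    also have "\<dots> = L.mon \<alpha>" unfolding L.mon_def
      by (rule T.finprod_cong') (use x_closed iota_closed in \<open>auto simp: iota_pow\<close>)
    finally show ?thesis by simp
  qed
  moreover have "mon \<alpha> \<in> ?J" if "\<alpha> \<in> expo \<mu> n" for \<alpha> using mon_in_ideal_pow[OF that] P_gen by simp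
  ultimately have "L.G n \<subseteq> Idl\<^bsub>T\<^esub> (\<iota> ` ?J)"
    by (intro L.G_least T.genideal_ideal[OF sub]) (use subsetD[OF T.genideal_self[OF sub]] in auto)
  then show ?thesis using f unfolding symbolic_power_def by auto
qed

section \<open>Strong F-regularity of T and p^-e-linear maps on R\<close>

lemma strongly_F_regular_splitting:
  assumes "strongly_F_regular T p" "t \<in> carrier T" "t \<noteq> \<zero>\<^bsub>T\<^esub>"
  shows "\<exists>e. \<exists>\<Phi>\<in>T.cartier e. \<Phi> t = \<one>\<^bsub>T\<^esub>"
proof -
  obtain e g where g: "g \<in> linear_maps T (frob T p e) (self_module T)"
    "\<forall>x\<in>carrier (self_module T). g (x \<odot>\<^bsub>frob T p e\<^esub> t) = x"
    using assms unfolding strongly_F_regular_def splits_def by blast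
  have "g t = \<one>\<^bsub>T\<^esub>" using bspec[OF g(2), of "\<one>\<^bsub>T\<^esub>"] assms(2) by (simp add: self_module_def frob_def)
  then show ?thesis using g(1) unfolding T.linear_maps_frob by blast
qed

text \<open>\<open>frob_coordinates\<close> supplies c, as T is an F-finite domain. Powers of c are
  nonzero, so strong F-regularity splits each of them off; the splitting of Frobenius on T is the
  localized \<open>\<sigma>\<close>.\<close>

lemma strongly_F_regular_linear:
  assumes sfr: "strongly_F_regular T p" and \<sigma>: "\<sigma> \<in> cartier 1" "\<sigma> \<one> = \<one>"
  shows "\<exists>e. \<forall>k. L.nonsplit (e + k) \<subseteq> L.G (p ^ k)"
proof -
  have dom: "domain T" and "F_finite T p" using sfr unfolding strongly_F_regular_def by auto
  then obtain A where "T.frob_gen 1 A" using T.F_finite_iff by blast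
  from T.frob_coordinates[OF dom this] obtain c where c: "c \<in> carrier T - {\<zero>\<^bsub>T\<^esub>}"
    and c_root: "\<forall>J f. f \<in> carrier T \<longrightarrow> J \<subseteq> carrier T \<longrightarrow> (\<forall>\<phi>\<in>T.cartier 1. \<phi> f \<in> J) \<longrightarrow>
    c [^]\<^bsub>T\<^esub> p \<otimes>\<^bsub>T\<^esub> f \<in> Idl\<^bsub>T\<^esub> ((\<lambda>g. g [^]\<^bsub>T\<^esub> p) ` J)" by (elim bexE)
  obtain \<Sigma> where \<Sigma>: "\<Sigma> \<in> T.cartier 1" "\<forall>a\<in>carrier R. \<Sigma> (\<iota> a) = \<iota> (\<sigma> a)" using cartier_extend[OF \<sigma>(1)] by (elim bexE)
  have "\<Sigma> \<one>\<^bsub>T\<^esub> = \<one>\<^bsub>T\<^esub>" using bspec[OF \<Sigma>(2) one_closed] \<sigma>(2) by (simp add: one_loc)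
  interpret D: domain T by (rule dom)
  have "c [^]\<^bsub>T\<^esub> s \<noteq> \<zero>\<^bsub>T\<^esub>" for s :: nat
  proof (induct s)
    case (Suc s)
    then show ?case using D.integral[of "c [^]\<^bsub>T\<^esub> s" c] c by auto
  qed simp
  then have "\<exists>e. c [^]\<^bsub>T\<^esub> s \<notin> L.nonsplit e" for s :: nat
    using strongly_F_regular_splitting[OF sfr, of "c [^]\<^bsub>T\<^esub> s"] c L.proper unfolding L.nonsplit_def by force
  then have "strongly_split_local T p (\<lambda>i. \<iota> (x i)) \<mu> \<Sigma> c"
  proof (intro strongly_split_local.intro strongly_split_local_axioms.intro char_p_local_T \<Sigma>(1) \<open>\<Sigma> \<one>\<^bsub>T\<^esub> = \<one>\<^bsub>T\<^esub>\<close>)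
    show "c \<in> carrier T" using c by (rule DiffD1)
    fix J f assume J: "ideal J T" and f: "f \<in> carrier T" and "\<And>\<phi>. \<phi> \<in> T.cartier 1 \<Longrightarrow> \<phi> f \<in> J"
    then show "c [^]\<^bsub>T\<^esub> p \<otimes>\<^bsub>T\<^esub> f \<in> Idl\<^bsub>T\<^esub> ((\<lambda>g. g [^]\<^bsub>T\<^esub> p) ` J)" using c_root ideal_subD[OF J] by blast
  qed
  then show ?thesis by (rule strongly_split_local.nonsplit_linear)
qed

text \<open>A map on T with value 1 at \<open>\<iota> f\<close> would descend to \<psi> with
  \<open>\<iota> (\<psi> f) = \<iota> v\<close> for some v outside P, so \<psi> f would be outside
  P.\<close>

lemma cartier_unit_nonsplit:
  assumes f: "f \<in> carrier R" and A: "frob_gen 1 A" and \<phi>: "\<And>\<phi>. \<phi> \<in> cartier e \<Longrightarrow> \<phi> f \<in> P"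
  shows "\<iota> f \<in> L.nonsplit e"
proof (rule ccontr)
  assume "\<iota> f \<notin> L.nonsplit e"
  then obtain \<Phi> where \<Phi>: "\<Phi> \<in> T.cartier e" "\<Phi> (\<iota> f) = \<one>\<^bsub>T\<^esub>" using L.nonsplit_unit[OF iota_closed[OF f]] by blast
  obtain B where B: "frob_gen e B" using frob_gen_power[OF A] by blast
  from cartier_descend[OF noeth B \<Phi>(1)] obtain \<psi> v where \<psi>: "\<psi> \<in> cartier e" "v \<in> Q"
    "\<forall>x\<in>carrier R. \<iota> (\<psi> x) = \<iota> v \<otimes>\<^bsub>T\<^esub> \<Phi> (\<iota> x)" by (elim bexE)
  have "\<iota> (\<psi> f) = \<iota> v" using bspec[OF \<psi>(3) f] \<Phi>(2) iota_closed[of v] \<psi>(2) by simp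
  moreover have "\<iota> (\<psi> f) \<in> {frac b t | b t. b \<in> P \<and> t \<in> Q}"
    by (subst frac_in_max_iff[OF cartierD(1)[OF \<psi>(1) f] one_Q]) (rule \<phi>[OF \<psi>(1)])
  ultimately have "v \<in> P" using frac_in_max_iff[OF Q_carrier[OF \<psi>(2)] one_Q] by (simp only:)
  then show False using \<psi>(2) by simp
qed

text \<open>A value outside P becomes a unit in T and can be scaled to 1. The resulting splittings
  also prove that T is a domain.\<close>

lemma strongly_F_regularI:
  assumes F: "F_finite R p" and unit: "\<And>a. a \<in> carrier R \<Longrightarrow> \<iota> a \<noteq> \<zero>\<^bsub>T\<^esub> \<Longrightarrow> \<exists>e. \<exists>\<phi>\<in>cartier e. \<phi> a \<notin> P"
  shows "strongly_F_regular T p"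
proof -
  have split: "\<exists>e. \<exists>\<Phi>\<in>T.cartier e. \<Phi> t = \<one>\<^bsub>T\<^esub>" if t: "t \<in> carrier T" "t \<noteq> \<zero>\<^bsub>T\<^esub>" for t
  proof -
    obtain a s where as: "t = frac a s" "a \<in> carrier R" "s \<in> Q" using t(1) by (rule frac_cases)
    have s1: "frac \<one> s \<in> carrier T" by (rule fraction_closed[OF one_closed as(3)])
    have "\<iota> a \<noteq> \<zero>\<^bsub>T\<^esub>"
    proof
      assume "\<iota> a = \<zero>\<^bsub>T\<^esub>"
      then have "t = \<zero>\<^bsub>T\<^esub>" unfolding as(1) frac_decomp[OF as(2,3)] using T.l_null[OF s1] by (simp only:)
      then show False using t(2) by (rule notE[rotated])
    qed
    from unit[OF as(2) this] obtain e \<phi> where \<phi>: "\<phi> \<in> cartier e" "\<phi> a \<notin> P" by (elim exE bexE)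
    obtain \<Phi> where \<Phi>: "\<Phi> \<in> T.cartier e" "\<forall>a\<in>carrier R. \<Phi> (\<iota> a) = \<iota> (\<phi> a)" using cartier_extend[OF \<phi>(1)] by (elim bexE)
    have "\<Phi> (\<iota> a) \<notin> L.M" using bspec[OF \<Phi>(2) as(2)] frac_in_max_iff[OF cartierD(1)[OF \<phi>(1) as(2)] one_Q] \<phi>(2)
      unfolding M_T by (simp only: not_False_eq_True)
    then have "\<iota> a \<notin> L.nonsplit e" using \<Phi>(1) unfolding L.nonsplit_def by blast
    from L.nonsplit_unit[OF iota_closed[OF as(2)] this] obtain \<Psi>
      where \<Psi>: "\<Psi> \<in> T.cartier e" "\<Psi> (\<iota> a) = \<one>\<^bsub>T\<^esub>" by (elim bexE)
    have sT: "\<iota> s \<in> carrier T" using as(3) iota_closed by simp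
    have st: "\<iota> s \<otimes>\<^bsub>T\<^esub> t = \<iota> a"
    proof -
      have "\<iota> s \<otimes>\<^bsub>T\<^esub> frac a s = frac (s \<otimes> a) (s \<otimes> \<one>)" using mult_fraction[of s a \<one> s] as one_Q by simp
      also have "\<dots> = \<iota> a" by (rule frac_cancel[OF as(2) one_Q as(3)])
      finally show ?thesis using as(1) by simp
    qed
    \<comment> \<open>The map x |-> \<Psi>(s x) takes the value \<Psi>(a) = 1 at t = a/s.\<close>
    show ?thesis
      by (intro exI[of _ e] bexI[OF _ T.cartier_premult[OF \<Psi>(1) sT]]) (simp only: st \<Psi>(2))
  qed
  have one: "\<one>\<^bsub>T\<^esub> \<noteq> \<zero>\<^bsub>T\<^esub>"
  proof
    assume "\<one>\<^bsub>T\<^esub> = \<zero>\<^bsub>T\<^esub>"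
    then show False using L.proper ideal_zeroD[OF L.M_ideal] by simp
  qed
  have dom: "domain T"
  proof (intro domain.intro domain_axioms.intro cring_localization one)
    fix t u assume tu: "t \<otimes>\<^bsub>T\<^esub> u = \<zero>\<^bsub>T\<^esub>" "t \<in> carrier T" "u \<in> carrier T"
    show "t = \<zero>\<^bsub>T\<^esub> \<or> u = \<zero>\<^bsub>T\<^esub>"
    proof (cases "t = \<zero>\<^bsub>T\<^esub>")
      case False
      from split[OF tu(2) False] obtain e \<Phi> where \<Phi>: "\<Phi> \<in> T.cartier e" "\<Phi> t = \<one>\<^bsub>T\<^esub>" by (elim exE bexE)
      obtain k where k: "p ^ e = Suc k" using q_gt_0[of e] gr0_implies_Suc by blast
      \<comment> \<open>Evaluate \<Phi> at u^q t: linearity gives u, while the argument contains the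
        factor t u = 0.\<close>
      have "u [^]\<^bsub>T\<^esub> (p ^ e) \<otimes>\<^bsub>T\<^esub> t = u [^]\<^bsub>T\<^esub> k \<otimes>\<^bsub>T\<^esub> (t \<otimes>\<^bsub>T\<^esub> u)" unfolding k using tu(2,3) by (simp add: T.m_ac)
      also have "\<dots> = \<zero>\<^bsub>T\<^esub>" using tu by simp
      finally have "u = \<Phi> \<zero>\<^bsub>T\<^esub>" using T.cartierD(3)[OF \<Phi>(1) tu(3,2)] \<Phi>(2) tu(3) by simp
      moreover have "\<Phi> \<zero>\<^bsub>T\<^esub> = \<zero>\<^bsub>T\<^esub>"
        using T.cartierD(3)[OF \<Phi>(1), of "\<zero>\<^bsub>T\<^esub>" "\<zero>\<^bsub>T\<^esub>"] T.cartierD(1)[OF \<Phi>(1), of "\<zero>\<^bsub>T\<^esub>"] by simp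
      ultimately show ?thesis by simp
    qed simp
  qed
  have spl: "splits T (self_module T) (frob T p e) (\<lambda>r. r \<odot>\<^bsub>frob T p e\<^esub> t)"
    if t: "t \<in> carrier T" and \<Phi>: "\<Phi> \<in> T.cartier e" "\<Phi> t = \<one>\<^bsub>T\<^esub>" for t e \<Phi>
    unfolding splits_def T.linear_maps_frob
  proof (intro conjI bexI[OF _ \<Phi>(1)])
    show "(\<lambda>r. r \<odot>\<^bsub>frob T p e\<^esub> t) \<in> linear_maps T (self_module T) (frob T p e)"
      using t by (auto simp: linear_maps_def frob_def self_module_def T.frobenius_add T.l_distr T.nat_pow_distrib T.m_assoc)
    show "\<forall>x\<in>carrier (self_module T). \<Phi> (x \<odot>\<^bsub>frob T p e\<^esub> t) = x"
      using T.cartierD(3)[OF \<Phi>(1) _ t] \<Phi>(2) by (auto simp: frob_def self_module_def)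
  qed
  have "\<exists>e. splits T (self_module T) (frob T p e) (\<lambda>r. r \<odot>\<^bsub>frob T p e\<^esub> t)" if "t \<in> carrier T - {\<zero>\<^bsub>T\<^esub>}" for t
  proof -
    have t: "t \<in> carrier T" "t \<noteq> \<zero>\<^bsub>T\<^esub>" using that by auto
    from split[OF t] obtain e \<Phi> where "\<Phi> \<in> T.cartier e" "\<Phi> t = \<one>\<^bsub>T\<^esub>" by (elim exE bexE)
    then show ?thesis by (intro exI[of _ e] spl[OF t(1)])
  qed
  moreover obtain A where A: "frob_gen 1 A" using F F_finite_iff by blast
  moreover have "F_finite T p" unfolding T.F_finite_iff by (rule exI) (rule frob_gen_T[OF A])
  ultimately show ?thesis unfolding strongly_F_regular_def using local_ring_T dom by (intro conjI ballI)
qed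

end

theorem theorem10p5:
  fixes K :: "('k, 'c) ring_scheme"
    and R :: "('k, 'a, 'm) module_scheme"
    and p :: nat
    and P :: "'a set"
  assumes "perfect_field K p"
    and "algebra K R"
    and "noetherian_ring R"
    and "has_char R p"
    and "F_finite R p"
    and "F_pure R p"
    and "primeideal P R"
  shows "strongly_F_regular (localization R P) p \<longleftrightarrow>
    (\<exists>C::nat. C > 0 \<and>
      (\<forall>n::nat. n > 0 \<longrightarrow> diff_power K R P (C * n) \<subseteq> symbolic_power R P n))"
proof -
  have prime: "Factorial_Ring.prime p" using assms(1) unfolding perfect_field_def by simp
  have char: "add_pow R p \<one>\<^bsub>R\<^esub> = \<zero>\<^bsub>R\<^esub>" using assms(4) unfolding has_char_def by simp
  have cring: "cring R" using assms(2) by (rule algebra.axioms(2))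
  interpret char_p_cring R p
    by (intro char_p_cring.intro char_p_cring_axioms.intro cring prime char)
  interpret char_p_algebra K R p
    by (intro char_p_algebra.intro char_p_algebra_axioms.intro char_p_cring_axioms assms)
  obtain S where S: "S \<subseteq> carrier R" "finite S" "P = Idl\<^bsub>R\<^esub> S"
    using noetherian_ring.finetely_gen[OF assms(3) primeideal.axioms(1)[OF assms(7)]] by blast
  obtain x :: "nat \<Rightarrow> 'a" where "bij_betw x {0..<card S} S" using ex_bij_betw_nat_finite[OF S(2)] by blast
  then have x: "x ` {..<card S} = S" unfolding bij_betw_def by (simp add: atLeast0LessThan)
  define \<mu> where "\<mu> = card S"
  interpret char_p_prime R p P
    by (intro char_p_prime.intro char_p_cring_axioms assms)
  interpret char_p_prime_generators R p P x \<mu>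
    by (intro char_p_prime_generators.intro char_p_prime_generators_axioms.intro generators.intro
        generators_axioms.intro char_p_prime_axioms cring assms) (use x S in \<open>auto simp: \<mu>_def\<close>)
  obtain \<sigma> where \<sigma>: "\<sigma> \<in> cartier 1" "\<sigma> \<one>\<^bsub>R\<^esub> = \<one>\<^bsub>R\<^esub>" using F_pure_splitting[OF assms(6)] by (elim bexE)
  from F_finite_iff[THEN iffD1, OF assms(5)] obtain A where A: "frob_gen 1 A" by (elim exE)
  show ?thesis
  proof
    assume sfr: "strongly_F_regular T p"
    from strongly_F_regular_linear[OF sfr \<sigma>] obtain e where e: "\<forall>k. L.nonsplit (e + k) \<subseteq> L.G (p ^ k)"
      by (elim exE)
    \<comment> \<open>With p^k \<le> p n, the order bound card A (p^(e+k) - 1) is at most card A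
      p^(e+1) n. The summand 1 in C makes up for the subtraction in C n - 1 when n > 0.\<close>
    define C where "C = card A * p ^ Suc e + 1"
    have "diff_power K R P (C * n) \<subseteq> symbolic_power R P n" if n: "n > 0" for n
    proof
      fix f assume "f \<in> diff_power K R P (C * n)"
      then have f: "f \<in> carrier R" "\<forall>\<delta>\<in>diff_ops K R (C * n - 1). \<delta> f \<in> P" unfolding diff_power_def by simp_all
      have "\<exists>k. n \<le> p ^ k \<and> p ^ k \<le> p * n"
        by (rule ex_power_between[OF n])
      then obtain k where k: "n \<le> p ^ k" "p ^ k \<le> p * n" by blast
      have "card A * (p ^ (e + k) - 1) \<le> card A * p ^ e * p ^ k" by (simp add: power_add mult.assoc)
      also have "\<dots> \<le> card A * p ^ e * (p * n)" using k(2) by simp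
      also have "\<dots> \<le> C * n - 1" unfolding C_def using n by (simp add: algebra_simps)
      finally have ord: "card A * (p ^ (e + k) - 1) \<le> C * n - 1" .
      have "\<phi> f \<in> P" if \<phi>: "\<phi> \<in> cartier (e + k)" for \<phi>
      proof -
        have "\<phi> f [^]\<^bsub>R\<^esub> (p ^ (e + k)) \<in> P"
          using bspec[OF f(2) frob_linear_diff_ops[OF A ord cartier_frob_linear[OF \<phi>]]] .
        then show ?thesis by (rule pow_P[OF cartierD(1)[OF \<phi> f(1)]])
      qed
      then have "\<iota> f \<in> L.nonsplit (e + k)" by (rule cartier_unit_nonsplit[OF f(1) A])
      then have "\<iota> f \<in> L.G n" using spec[OF e, of k] L.G_mono[OF k(1)] by (meson subsetD)
      then show "f \<in> symbolic_power R P n" by (rule G_T_symbolic[OF f(1)])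
    qed
    then show "\<exists>C::nat. C > 0 \<and> (\<forall>n::nat. n > 0 \<longrightarrow> diff_power K R P (C * n) \<subseteq> symbolic_power R P n)"
      by (intro exI[of _ C]) (simp add: C_def)
  next
    assume "\<exists>C::nat. C > 0 \<and> (\<forall>n::nat. n > 0 \<longrightarrow> diff_power K R P (C * n) \<subseteq> symbolic_power R P n)"
    then obtain C :: nat where C: "\<forall>n>0. diff_power K R P (C * n) \<subseteq> symbolic_power R P n" by (elim exE conjE)
    show "strongly_F_regular T p"
    proof (rule strongly_F_regularI[OF assms(5)])
      fix a assume a: "a \<in> carrier R" "\<iota> a \<noteq> \<zero>\<^bsub>T\<^esub>"
      have "\<exists>n. a \<notin> sat (G n)"
      proof (rule ccontr)
        assume "\<nexists>n. a \<notin> sat (G n)"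
        then have "\<exists>s\<in>Q. s \<otimes>\<^bsub>R\<^esub> a = \<zero>\<^bsub>R\<^esub>" by (intro krull[OF a(1)]) simp
        then show False using a(2) unfolding iota_zero_iff[OF a(1)] by (rule notE[rotated])
      qed
      then obtain n where n: "a \<notin> sat (G n)" by (elim exE)
      \<comment> \<open>The index 0 must be excluded, since the hypothesis speaks of positive n
        only.\<close>
      have "a \<in> sat (G 0)" using sat_self[OF G_ideal, of 0] a(1) unfolding G_0 by (rule subsetD)
      then have "n > 0" using n by (cases n) simp_all
      then have "a \<notin> diff_power K R P (C * n)" using C n symbolic_power_sat[of n] by (meson subsetD)
      then have "\<exists>\<delta>\<in>diff_ops K R (C * n - 1). \<delta> a \<notin> P" unfolding diff_power_def using a(1) by simp
      then obtain \<delta> where \<delta>: "\<delta> \<in> diff_ops K R (C * n - 1)" "\<delta> a \<notin> P" by (elim bexE)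
      \<comment> \<open>An operator in \<open>diff_ops K R (C * n - 1)\<close> is linear over p^(C n
        - 1)-th powers, so C n - 1 itself serves as the level e.\<close>
      from frob_linear_cartier[OF \<sigma> diff_ops_frob_linear[OF \<delta>(1)] a(1)]
      obtain \<phi> where "\<phi> \<in> cartier (C * n - 1)" "\<phi> a = \<delta> a" by (elim bexE)
      then show "\<exists>e. \<exists>\<phi>\<in>cartier e. \<phi> a \<notin> P" using \<delta>(2) by (intro exI[of _ "C * n - 1"] bexI[of _ \<phi>]) simp_all
    qed
  qed
qed

end
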